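(* Let $(\Lambda V,d)$ be a Sullivan minimal algebra over $\mathbb{Q}$ with $V=V^{\geq 2}$ of finite type. Suppose that $\theta\in\mathrm{Der}'(\Lambda V)$ is a cycle of degree $n$ with $L_{-1}(\theta)\neq 0$, and let $m$ be an integer with $2\leq m\leq n-1$ such that $\mathrm{Der}'(\Lambda V)$ satisfies the condition $(\mathrm{G}_k)$ for all $n-m\leq k\leq n-2$. Let $(\Lambda\overline{W}\otimes\Lambda W,d_W)$ be the acyclic closure of $(\Lambda W,d)$, where $W=V_0\oplus V_1$. Then there exists a right $\Lambda W$-module map of degree $n$ $$\Phi_\theta:(\Lambda\overline{W})^{\leq m-1}\otimes\Lambda W\to\mathrm{Der}(\Lambda V)$$ with $$\Phi_\theta(1)=\theta,\qquad D\Phi_\theta(x)=(-1)^n\Phi_\theta(d_Wx)\quad\text{for all } x\in(\Lambda\overline{W})^{\leq m-1}\otimes\Lambda W.$$ Moreover, the restriction of $L_{-1}\circ\Phi_\theta$ to $(\Lambda\overline{W})^{\leq m-1}$ is injective.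
   Context: Derivations. $\Lambda V$ is the free graded-commutative algebra on the graded vector space $V$, and the differential $d$ (of degree $+1$) is decomposable. $\mathrm{Der}_k(\Lambda V)$ is the space of derivations of $\Lambda V$ lowering degree by $k$, i.e. linear maps $\theta$ of degree $-k$ with $\theta(xy)=\theta(x)y+(-1)^{k|x|}x\theta(y)$; we write $|\theta|=k$ and call $k$ the degree of $\theta$. $\mathrm{Der}(\Lambda V)$ is a differential graded Lie algebra with $[\theta_1,\theta_2]=\theta_1\theta_2-(-1)^{|\theta_1||\theta_2|}\theta_2\theta_1$ and $D(\theta)=[d,\theta]$. The sub-DGL $\mathrm{Der}'(\Lambda V)$ is given by $\mathrm{Der}'_k=\mathrm{Der}_k$ for $k>1$, $\mathrm{Der}'_1=$ the $D$-cycles in $\mathrm{Der}_1$, and $\mathrm{Der}'_k=0$ for $k<1$. $\mathrm{Der}(\Lambda V)$ is a right $(\Lambda V,d)$-module (hence a right $\Lambda W$-module) via $(\theta x)(v)=(-1)^{|x||v|}\theta(v)x$ for $x,v\in\Lambda V$; the action of $x\in(\Lambda V)^j$ maps $\mathrm{Der}_k$ to $\mathrm{Der}_{k-j}$. Wordlength. $\Lambda V=\bigoplus_{l\geq 0}\Lambda^lV$ by wordlength. Via $\mathrm{Der}(\Lambda V)\cong\mathrm{Hom}(V,\Lambda V)$, each derivation decomposes as $\theta=\theta_{-1}+\theta_0+\theta_1+\cdots$ with $\theta_l\in\mathrm{Hom}(V,\Lambda^{l+1}V)$ (increasing wordlength by $l$); put $L_l(\theta)=\theta_l$. In particular $L_{-1}(\theta)\in\mathrm{Hom}(V,\mathbb{Q})$.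 Condition $(\mathrm{G}_k)$. $\mathrm{Der}'(\Lambda V)$ satisfies $(\mathrm{G}_k)$ if every cycle $\theta\in\mathrm{Der}'_k(\Lambda V)$ with $L_{-1}(\theta)=0$ is exact, i.e. a boundary in $\mathrm{Der}'(\Lambda V)$. The space $W$. Put $V(0)=\ker d\cap V$ and $V(i+1)=d^{-1}(\Lambda V(i))\cap V$. Choose graded subspaces $V_i\subset V$ with $V_0=V(0)$ and $V_0\oplus\cdots\oplus V_i=V(i)$, so $V=\bigoplus_{i\geq 0}V_i$. Set $W=V_0\oplus V_1$; then $d=0$ on $V_0$ and $d(V_1)\subset\Lambda V_0$, so $(\Lambda W,d)$ is a sub-CDGA of $(\Lambda V,d)$. Acyclic closure. $\overline{W}$ is the suspension of $W$, with elements $\overline{v}$ ($v\in W$) of degree $|\overline{v}|=|v|-1$. Let $\sigma$ be the derivation of $\Lambda\overline{W}\otimes\Lambda W$ of degree $-1$ with $\sigma(v)=\overline{v}$, $\sigma(\overline{v})=0$, and let $s=\frac1l\sigma$ on elements of total wordlength $l\geq 1$ in $\Lambda(\overline{W}\oplus W)$. The CDGA $(\Lambda\overline{W}\otimes\Lambda W,d_W)$ is defined by $d_Wv=dv$ and $d_W\overline{v}=v-s(dv)$ for $v\in W$; it is acyclic. Here $(\Lambda\overline{W})^{\leq m-1}$ is the part of degree at most $m-1$; the subspace $(\Lambda\overline{W})^{\leq m-1}\otimes\Lambda W$ is stable under $d_W$. A map $\Phi$ into $\mathrm{Der}(\Lambda V)$ has degree $n$ if it sends elements of degree $j$ to $\mathrm{Der}_{n-j}(\Lambda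 V)$. *)

theory Defs
  imports Complex_Main "HOL-Library.Multiset"
begin

section \<open>Free graded-commutative algebras over the rationals\<close>

text \<open>
  A graded rational vector space \<open>V\<close> is given by a totally ordered homogeneous basis: the basis is
  the type \<open>'v\<close> and \<open>gdeg v\<close> is the degree of the basis vector \<open>v\<close>. Every graded vector space has such
  a basis. The order only serves to write down the monomial basis of \<open>\<Lambda>V\<close> and its signs.
\<close>

class graded_basis = linorder +
  fixes gdeg :: "'a \<Rightarrow> int"

text \<open>
  A multiset \<open>{#v\<^sub>1, \<dots>, v\<^sub>r#}\<close> with \<open>v\<^sub>1 \<le> \<dots> \<le> v\<^sub>r\<close> stands for the monomial \<open>v\<^sub>1 \<cdots> v\<^sub>r\<close>; it is nonzero
  iff no generator of odd degree is repeated. Reordering the product of the monomials \<open>a\<close> and \<open>b\<close>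
  produces one sign for each pair of odd generators \<open>x\<close> of \<open>a\<close> and \<open>y\<close> of \<open>b\<close> with \<open>y < x\<close>.
\<close>

definition admissible :: "'v::graded_basis multiset \<Rightarrow> bool" where
  "admissible m \<longleftrightarrow> (\<forall>v. odd (gdeg v) \<longrightarrow> count m v \<le> 1)"

definition inversions :: "'v::graded_basis multiset \<Rightarrow> 'v multiset \<Rightarrow> nat" where
  "inversions a b =
    (\<Sum>x\<in>#a. \<Sum>y\<in>#b. if odd (gdeg x) \<and> odd (gdeg y) \<and> y < x then 1 else 0)"

definition splits :: "'v multiset \<Rightarrow> ('v multiset \<times> 'v multiset) set" where
  "splits m = {(a, b). a + b = m}"

lemma finite_submultisets: "finite {a. a \<subseteq># (m::'v multiset)}"
proof (induction m)
  case empty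
  then show ?case by simp
next
  case (add x m)
  have "{a. a \<subseteq># add_mset x m} \<subseteq> {a. a \<subseteq># m} \<union> add_mset x ` {a. a \<subseteq># m}"
  proof
    fix a assume "a \<in> {a. a \<subseteq># add_mset x m}"
    hence a: "a \<subseteq># add_mset x m" by simp
    show "a \<in> {a. a \<subseteq># m} \<union> add_mset x ` {a. a \<subseteq># m}"
    proof (cases "x \<in># a")
      case True
      then obtain b where "a = add_mset x b" by (meson mset_add)
      with a show ?thesis by auto
    next
      case False
      with a have "a \<subseteq># m"
        by (metis diff_single_trivial subset_eq_diff_conv add_mset_add_single)
      then show ?thesis by auto
    qed
  qed
  then show ?case using add by (meson finite_UnI finite_imageI finite_subset)
qed

lemma finite_splits [simp]: "finite (splits m)"
proof (rule finite_subset)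
  show "splits m \<subseteq> {a. a \<subseteq># m} \<times> {a. a \<subseteq># m}"
    by (auto simp: splits_def)
qed (simp add: finite_submultisets)

lemma admissible_empty [simp]: "admissible {#}"
  by (simp add: admissible_def)

lemma admissible_add: "admissible (a + b) \<Longrightarrow> admissible a \<and> admissible b"
  by (metis (no_types, lifting) add_leE admissible_def count_union)

lemma inversions_empty [simp]: "inversions {#} b = 0" "inversions a {#} = 0"
  by (simp_all add: inversions_def)

lemma inversions_add:
  "inversions (a + a') b = inversions a b + inversions a' b"
  "inversions a (b + b') = inversions a b + inversions a b'"
  by (simp_all add: inversions_def sum_mset.distrib)

typedef (overloaded) 'v free_gca =
  "{f :: 'v::graded_basis multiset \<Rightarrow> rat.
      finite {m. f m \<noteq> 0} \<and> (\<forall>m. f m \<noteq> 0 \<longrightarrow> admissible m)}"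
  morphisms coeff Abs_free_gca
  by (rule exI[of _ "\<lambda>_. 0"]) simp

setup_lifting type_definition_free_gca

lemma free_gca_eqI: "(\<And>m. coeff x m = coeff y m) \<Longrightarrow> x = y"
  by (simp add: coeff_inject[symmetric] fun_eq_iff)

definition supp :: "'v::graded_basis free_gca \<Rightarrow> 'v multiset set" where
  "supp x = {m. coeff x m \<noteq> 0}"

lemma finite_supp [simp]: "finite (supp x)"
  using coeff[of x] by (simp add: supp_def)

lemma coeff_not_admissible: "\<not> admissible m \<Longrightarrow> coeff x m = 0"
  using coeff[of x] by auto

instantiation free_gca :: (graded_basis) ab_group_add
begin

lift_definition zero_free_gca :: "'a free_gca" is "\<lambda>_. 0" by simp

lift_definition plus_free_gca :: "'a free_gca \<Rightarrow> 'a free_gca \<Rightarrow> 'a free_gca"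
  is "\<lambda>f g m. f m + g m"
proof -
  fix f g :: "'a multiset \<Rightarrow> rat"
  assume f: "finite {m. f m \<noteq> 0} \<and> (\<forall>m. f m \<noteq> 0 \<longrightarrow> admissible m)"
    and g: "finite {m. g m \<noteq> 0} \<and> (\<forall>m. g m \<noteq> 0 \<longrightarrow> admissible m)"
  have "{m. f m + g m \<noteq> 0} \<subseteq> {m. f m \<noteq> 0} \<union> {m. g m \<noteq> 0}" by auto
  with f g show "finite {m. f m + g m \<noteq> 0} \<and> (\<forall>m. f m + g m \<noteq> 0 \<longrightarrow> admissible m)"
    by (metis (no_types, lifting) add_0 finite_UnI finite_subset)
qed

lift_definition uminus_free_gca :: "'a free_gca \<Rightarrow> 'a free_gca" is "\<lambda>f m. - f m" by simp

definition minus_free_gca :: "'a free_gca \<Rightarrow> 'a free_gca \<Rightarrow> 'a free_gca" where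
  "minus_free_gca x y = x + - y"

instance
  by standard (transfer; simp add: fun_eq_iff minus_free_gca_def; fail | simp add: minus_free_gca_def)+

end

instantiation free_gca :: (graded_basis) ring_1
begin

lift_definition one_free_gca :: "'a free_gca" is "\<lambda>m. if m = {#} then 1 else 0" by simp

lift_definition times_free_gca :: "'a free_gca \<Rightarrow> 'a free_gca \<Rightarrow> 'a free_gca"
  is "\<lambda>f g m. if admissible m
        then (\<Sum>(a, b)\<in>splits m. (-1) ^ inversions a b * f a * g b) else 0"
proof -
  fix f g :: "'a multiset \<Rightarrow> rat"
  assume f: "finite {m. f m \<noteq> 0} \<and> (\<forall>m. f m \<noteq> 0 \<longrightarrow> admissible m)"
    and g: "finite {m. g m \<noteq> 0} \<and> (\<forall>m. g m \<noteq> 0 \<longrightarrow> admissible m)"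
  let ?h = "\<lambda>m. if admissible m
        then (\<Sum>(a, b)\<in>splits m. (-1) ^ inversions a b * f a * g b) else 0"
  have "{m. ?h m \<noteq> 0} \<subseteq> (\<lambda>(a, b). a + b) ` ({m. f m \<noteq> 0} \<times> {m. g m \<noteq> 0})"
  proof
    fix m assume "m \<in> {m. ?h m \<noteq> 0}"
    hence "(\<Sum>(a, b)\<in>splits m. (-1) ^ inversions a b * f a * g b) \<noteq> 0"
      by (auto split: if_splits)
    then obtain p where "p \<in> splits m"
      "(case p of (a, b) \<Rightarrow> (-1) ^ inversions a b * f a * g b) \<noteq> 0"
      by (meson sum.not_neutral_contains_not_neutral)
    then show "m \<in> (\<lambda>(a, b). a + b) ` ({m. f m \<noteq> 0} \<times> {m. g m \<noteq> 0})"
      by (cases p) (force simp: splits_def)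
  qed
  then have "finite {m. ?h m \<noteq> 0}"
    using f g by (meson finite_SigmaI finite_imageI finite_subset)
  then show "finite {m. ?h m \<noteq> 0} \<and> (\<forall>m. ?h m \<noteq> 0 \<longrightarrow> admissible m)"
    by simp
qed

instance
proof
  fix x y z :: "'a free_gca"
  show "x * y * z = x * (y * z)"
  proof (rule free_gca_eqI)
    fix m
    show "coeff (x * y * z) m = coeff (x * (y * z)) m"
    proof (cases "admissible m")
      case False
      then show ?thesis by (simp add: coeff_not_admissible)
    next
      case True
      have adm: "admissible a" "admissible b" if "(a, b) \<in> splits m" for a b
        using that True admissible_add by (auto simp: splits_def)
      let ?L = "SIGMA p:splits m. splits (fst p)"
      let ?R = "SIGMA p:splits m. splits (snd p)"
      have "coeff (x * y * z) m = (\<Sum>(c, h)\<in>splits m. \<Sum>(a, b)\<in>splits c.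
          (-1) ^ inversions c h * ((-1) ^ inversions a b * coeff x a * coeff y b) * coeff z h)"
        using True adm
        by (auto simp: times_free_gca.rep_eq sum_distrib_left sum_distrib_right case_prod_beta
            intro!: sum.cong)
      also have "\<dots> = (\<Sum>((c, h), (a, b))\<in>?L.
          (-1) ^ inversions c h * ((-1) ^ inversions a b * coeff x a * coeff y b) * coeff z h)"
        by (subst sum.Sigma[symmetric]) (auto simp: case_prod_beta)
      also have "\<dots> = (\<Sum>((a, k), (b, h))\<in>?R.
          (-1) ^ inversions a k * coeff x a * ((-1) ^ inversions b h * coeff y b * coeff z h))"
        by (rule sum.reindex_bij_witness[where
              i = "\<lambda>((a, k), (b, h)). ((a + b, h), (a, b))" and
              j = "\<lambda>((c, h), (a, b)). ((a, b + h), (b, h))"])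
           (auto simp: splits_def inversions_add power_add algebra_simps)
      also have "\<dots> = (\<Sum>(a, k)\<in>splits m. \<Sum>(b, h)\<in>splits k.
          (-1) ^ inversions a k * coeff x a * ((-1) ^ inversions b h * coeff y b * coeff z h))"
        by (subst sum.Sigma[symmetric]) (auto simp: case_prod_beta)
      also have "\<dots> = coeff (x * (y * z)) m"
        using True adm
        by (auto simp: times_free_gca.rep_eq sum_distrib_left sum_distrib_right case_prod_beta
            intro!: sum.cong)
      finally show ?thesis .
    qed
  qed
  show "(x + y) * z = x * z + y * z"
    by (rule free_gca_eqI)
      (simp add: times_free_gca.rep_eq plus_free_gca.rep_eq case_prod_beta
        sum.distrib[symmetric] algebra_simps)
  show "x * (y + z) = x * y + x * z"
    by (rule free_gca_eqI)
      (simp add: times_free_gca.rep_eq plus_free_gca.rep_eq case_prod_beta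
        sum.distrib[symmetric] algebra_simps)
  show "1 * x = x"
  proof (rule free_gca_eqI)
    fix m
    show "coeff (1 * x) m = coeff x m"
    proof (cases "admissible m")
      case True
      have "(\<Sum>(a, b)\<in>splits m. (-1) ^ inversions a b * coeff 1 a * coeff x b) =
        (\<Sum>(a, b)\<in>{({#}, m)}. (-1) ^ inversions a b * coeff 1 a * coeff x b)"
        by (rule sum.mono_neutral_right[OF finite_splits]) (auto simp: splits_def one_free_gca.rep_eq split: if_splits)
      then show ?thesis using True
        by (simp add: times_free_gca.rep_eq one_free_gca.rep_eq)
    qed (simp add: coeff_not_admissible)
  qed
  show "x * 1 = x"
  proof (rule free_gca_eqI)
    fix m
    show "coeff (x * 1) m = coeff x m"
    proof (cases "admissible m")
      case True
      have "(\<Sum>(a, b)\<in>splits m. (-1) ^ inversions a b * coeff x a * coeff 1 b) =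
        (\<Sum>(a, b)\<in>{(m, {#})}. (-1) ^ inversions a b * coeff x a * coeff 1 b)"
        by (rule sum.mono_neutral_right[OF finite_splits]) (auto simp: splits_def one_free_gca.rep_eq split: if_splits)
      then show ?thesis using True
        by (simp add: times_free_gca.rep_eq one_free_gca.rep_eq)
    qed (simp add: coeff_not_admissible)
  qed
  have "coeff (0 :: 'a free_gca) {#} \<noteq> coeff 1 {#}"
    by (simp add: zero_free_gca.rep_eq one_free_gca.rep_eq)
  then show "(0 :: 'a free_gca) \<noteq> 1" by auto
qed

end

lift_definition scaleQ :: "rat \<Rightarrow> 'v::graded_basis free_gca \<Rightarrow> 'v free_gca"
  is "\<lambda>c f m. c * f m"
  by (auto elim: rev_finite_subset)

global_interpretation gca: vector_space scaleQ
  by standard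
    (rule free_gca_eqI; simp add: scaleQ.rep_eq plus_free_gca.rep_eq algebra_simps)+

lemma scaleQ_mult [simp]: "scaleQ c x * y = scaleQ c (x * y)" "x * scaleQ c y = scaleQ c (x * y)"
  by (rule free_gca_eqI,
      simp add: times_free_gca.rep_eq scaleQ.rep_eq sum_distrib_left case_prod_beta algebra_simps)+

lift_definition monom :: "'v::graded_basis multiset \<Rightarrow> 'v free_gca"
  is "\<lambda>a m. if m = a \<and> admissible a then 1 else 0"
  by simp

abbreviation gen :: "'v::graded_basis \<Rightarrow> 'v free_gca" where
  "gen v \<equiv> monom {#v#}"


section \<open>Degree and wordlength\<close>

definition mdeg :: "'v::graded_basis multiset \<Rightarrow> int" where
  "mdeg m = (\<Sum>v\<in>#m. gdeg v)"

lift_definition select :: "('v::graded_basis multiset \<Rightarrow> bool) \<Rightarrow> 'v free_gca \<Rightarrow> 'v free_gca"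
  is "\<lambda>P f m. if P m then f m else 0"
  by (auto elim: rev_finite_subset)

definition deg_comp :: "int \<Rightarrow> 'v::graded_basis free_gca \<Rightarrow> 'v free_gca" where
  "deg_comp i = select (\<lambda>m. mdeg m = i)"

definition word_comp :: "int \<Rightarrow> 'v::graded_basis free_gca \<Rightarrow> 'v free_gca" where
  "word_comp p = select (\<lambda>m. int (size m) = p)"

definition homog :: "int \<Rightarrow> 'v::graded_basis free_gca set" where
  "homog i = {x. \<forall>m\<in>supp x. mdeg m = i}"

definition deg_le :: "int \<Rightarrow> 'v::graded_basis free_gca set" where
  "deg_le p = {x. \<forall>m\<in>supp x. mdeg m \<le> p}"

definition word_ge :: "nat \<Rightarrow> 'v::graded_basis free_gca set" where
  "word_ge p = {x. \<forall>m\<in>supp x. p \<le> size m}"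

text \<open>\<open>V\<close> as a subspace of \<open>\<Lambda>V\<close>.\<close>

definition Vspace :: "'v::graded_basis free_gca set" where
  "Vspace = gca.span (range gen)"

text \<open>The subalgebra \<open>\<Lambda>U\<close> generated by \<open>U\<close>.\<close>

definition Lam :: "'v::graded_basis free_gca set \<Rightarrow> 'v free_gca set" where
  "Lam U = gca.span (prod_list ` lists U)"

definition graded_subspace :: "'v::graded_basis free_gca set \<Rightarrow> bool" where
  "graded_subspace U \<longleftrightarrow> gca.subspace U \<and> (\<forall>x\<in>U. \<forall>i. deg_comp i x \<in> U)"

lemma monom_mult:
  "monom a * monom b =
    (if admissible (a + b) then scaleQ ((-1) ^ inversions a b) (monom (a + b)) else 0)"
proof (rule free_gca_eqI)
  fix m
  show "coeff (monom a * monom b) m = coeff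
    (if admissible (a + b) then scaleQ ((-1) ^ inversions a b) (monom (a + b)) else 0) m"
  proof (cases "admissible m")
    case True
    let ?f = "\<lambda>(c, d). (-1) ^ inversions c d * coeff (monom a) c * coeff (monom b) d"
    have "sum ?f (splits m) = sum ?f (splits m \<inter> {(a, b)})"
      by (rule sum.mono_neutral_right[OF finite_splits]) (auto simp: monom.rep_eq split: if_splits)
    also have "\<dots> = (if m = a + b then ?f (a, b) else 0)"
      by (auto simp: splits_def)
    finally show ?thesis using True admissible_add[of a b]
      by (auto simp: times_free_gca.rep_eq scaleQ.rep_eq monom.rep_eq zero_free_gca.rep_eq)
  qed (simp add: coeff_not_admissible)
qed

lemma monom_sorted:
  "sorted xs \<Longrightarrow> admissible (mset xs) \<Longrightarrow> monom (mset xs) = prod_list (map gen xs)"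
proof (induction xs)
  case Nil
  show ?case by (rule free_gca_eqI) (simp add: monom.rep_eq one_free_gca.rep_eq)
next
  case (Cons x xs)
  have "inversions {#x#} (mset xs) = 0"
    using Cons.prems by (force simp: inversions_def)
  moreover have "admissible (mset xs)"
    using Cons.prems admissible_add[of "{#x#}" "mset xs"] by simp
  ultimately show ?case using Cons monom_mult[of "{#x#}" "mset xs"] by simp
qed

lemma odd_mdeg: "odd (mdeg a) = odd (\<Sum>x\<in>#a. if odd (gdeg x) then 1 else (0::nat))"
  by (induction a) (auto simp: mdeg_def)

lemma inversions_swap:
  assumes "admissible (a + b)"
  shows "inversions a b + inversions b a =
    (\<Sum>x\<in>#a. if odd (gdeg x) then 1 else 0) * (\<Sum>x\<in>#b. if odd (gdeg x) then 1 else 0)"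
proof -
  have ne: "x \<noteq> y" if "x \<in># a" "y \<in># b" "odd (gdeg x)" for x y
  proof
    assume "x = y"
    with that have "count (a + b) x \<ge> 2"
      by (metis Suc_1 add_mono_thms_linordered_semiring(1) count_greater_eq_one_iff count_union
          one_add_one)
    with assms that(3) show False by (fastforce simp: admissible_def)
  qed
  have "inversions b a = (\<Sum>x\<in>#a. \<Sum>y\<in>#b. if odd (gdeg x) \<and> odd (gdeg y) \<and> x < y then 1 else 0)"
    unfolding inversions_def by (subst sum_mset.swap) (simp add: conj_ac cong: conj_cong)
  then have "inversions a b + inversions b a =
    (\<Sum>x\<in>#a. \<Sum>y\<in>#b. (if odd (gdeg x) \<and> odd (gdeg y) \<and> y < x then 1 else 0) +
       (if odd (gdeg x) \<and> odd (gdeg y) \<and> x < y then 1 else 0))"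
    by (simp add: inversions_def sum_mset.distrib)
  also have "\<dots> = (\<Sum>x\<in>#a. \<Sum>y\<in>#b. (if odd (gdeg x) then 1 else 0) * (if odd (gdeg y) then 1 else 0))"
    by (rule arg_cong[where f = sum_mset], rule image_mset_cong,
        rule arg_cong[where f = sum_mset], rule image_mset_cong) (use ne in \<open>auto simp: neq_iff\<close>)
  also have "\<dots> = (\<Sum>x\<in>#a. if odd (gdeg x) then 1 else 0) * (\<Sum>x\<in>#b. if odd (gdeg x) then 1 else 0)"
    by (subst sum_mset.swap) (simp only: sum_mset_distrib_left sum_mset_distrib_right)
  finally show ?thesis .
qed

lemma graded_commutative:
  assumes "x \<in> homog i" "y \<in> homog j"
  shows "x * y = scaleQ ((-1) powi (i * j)) (y * x)"
proof (rule free_gca_eqI)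
  fix m
  show "coeff (x * y) m = coeff (scaleQ ((-1) powi (i * j)) (y * x)) m"
  proof (cases "admissible m")
    case True
    have sgn: "(-1) ^ inversions a b * coeff x a * coeff y b =
      (-1) powi (i * j) * ((-1) ^ inversions b a * coeff y b * coeff x a)"
      if ab: "a + b = m" for a b
    proof (cases "coeff x a = 0 \<or> coeff y b = 0")
      case False
      with assms have d: "mdeg a = i" "mdeg b = j" by (auto simp: homog_def supp_def)
      have "even (inversions a b + inversions b a) = even (i * j)"
        using inversions_swap[of a b] True ab odd_mdeg[of a] odd_mdeg[of b] d by auto
      then show ?thesis
        by (cases "even (inversions a b)"; cases "even (inversions b a)")
           (auto simp: power_int_minus_left)
    qed auto
    have "(\<Sum>(a, b)\<in>splits m. (-1) ^ inversions a b * coeff x a * coeff y b) =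
      (\<Sum>(b, a)\<in>splits m. (-1) powi (i * j) * ((-1) ^ inversions b a * coeff y b * coeff x a))"
      by (rule sum.reindex_bij_witness[where i = prod.swap and j = prod.swap])
         (auto simp: splits_def sgn add.commute)
    then show ?thesis using True
      by (simp add: times_free_gca.rep_eq scaleQ.rep_eq sum_distrib_left case_prod_beta)
  qed (simp add: coeff_not_admissible)
qed


section \<open>Derivations\<close>

text \<open>
  Derivations lowering degree by \<open>k\<close> of the graded subalgebra \<open>S\<close>. Values outside \<open>S\<close> are irrelevant.
\<close>

definition derivation_on ::
    "'v::graded_basis free_gca set \<Rightarrow> int \<Rightarrow> ('v free_gca \<Rightarrow> 'v free_gca) \<Rightarrow> bool" where
  "derivation_on S k \<theta> \<longleftrightarrow>
     (\<forall>x\<in>S. \<theta> x \<in> S) \<and>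
     (\<forall>x\<in>S. \<forall>y\<in>S. \<theta> (x + y) = \<theta> x + \<theta> y) \<and>
     (\<forall>c. \<forall>x\<in>S. \<theta> (scaleQ c x) = scaleQ c (\<theta> x)) \<and>
     (\<forall>i. \<forall>x\<in>S \<inter> homog i. \<theta> x \<in> homog (i - k)) \<and>
     (\<forall>i. \<forall>x\<in>S \<inter> homog i. \<forall>y\<in>S. \<theta> (x * y) = \<theta> x * y + scaleQ ((-1) powi (k * i)) (x * \<theta> y))"

definition Der :: "int \<Rightarrow> ('v::graded_basis free_gca \<Rightarrow> 'v free_gca) set" where
  "Der k = {\<theta>. derivation_on UNIV k \<theta>}"

text \<open>
  \<open>D \<theta> = [d, \<theta>] = d \<theta> - (-1)\<^bsup>|\<theta>|\<^esup> \<theta> d\<close> for homogeneous \<open>\<theta>\<close>, extended linearly to sums of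
  homogeneous derivations: with the involution \<open>\<epsilon> x = (-1)\<^bsup>|x|\<^esup> x\<close> one has
  \<open>(-1)\<^bsup>|\<theta>|\<^esup> \<theta> = \<epsilon> \<theta> \<epsilon>\<close> for homogeneous \<open>\<theta>\<close>, and the right hand side is linear in \<open>\<theta>\<close>; see
  \<open>D_Der\<close> below.
\<close>

lift_definition invol :: "'v::graded_basis free_gca \<Rightarrow> 'v free_gca"
  is "\<lambda>f m. (-1) powi mdeg m * f m"
  by (auto elim: rev_finite_subset)

definition D :: "('v::graded_basis free_gca \<Rightarrow> 'v free_gca) \<Rightarrow>
    ('v free_gca \<Rightarrow> 'v free_gca) \<Rightarrow> 'v free_gca \<Rightarrow> 'v free_gca" where
  "D d \<theta> = (\<lambda>x. d (\<theta> x) - invol (\<theta> (invol (d x))))"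

lemma invol_homog: "x \<in> homog i \<Longrightarrow> invol x = scaleQ ((-1) powi i) x"
  by (rule free_gca_eqI) (auto simp: invol.rep_eq scaleQ.rep_eq homog_def supp_def)

lemma invol_add: "invol (x + y) = invol x + invol y"
  by (rule free_gca_eqI) (simp add: invol.rep_eq plus_free_gca.rep_eq algebra_simps)

lemma deg_comp_homog: "deg_comp i x \<in> homog i"
  by (auto simp: deg_comp_def homog_def supp_def select.rep_eq)

lemma coeff_sum: "coeff (\<Sum>i\<in>A. f i) m = (\<Sum>i\<in>A. coeff (f i) m)"
  by (induction A rule: infinite_finite_induct)
     (simp_all add: zero_free_gca.rep_eq plus_free_gca.rep_eq)

lemma deg_comp_sum: "(\<Sum>i\<in>mdeg ` supp x. deg_comp i x) = x"
proof (rule free_gca_eqI)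
  fix m
  show "coeff (\<Sum>i\<in>mdeg ` supp x. deg_comp i x) m = coeff x m"
    by (auto simp: coeff_sum deg_comp_def select.rep_eq finite_supp[unfolded supp_def]
        supp_def sum.delta sum.delta' intro: image_eqI)
qed

lemma homog_induct [case_names zero add]:
  assumes "P 0" and "\<And>i x y. x \<in> homog i \<Longrightarrow> P y \<Longrightarrow> P (x + y)"
  shows "P x"
proof -
  have "P (\<Sum>i\<in>A. deg_comp i x)" if "finite A" for A
    using that by (induction A) (auto intro: assms deg_comp_homog)
  from this[of "mdeg ` supp x"] show ?thesis by (simp add: deg_comp_sum)
qed

lemma D_Der:
  assumes "\<theta> \<in> Der k"
  shows "D d \<theta> x = d (\<theta> x) - scaleQ ((-1) powi k) (\<theta> (d x))"
proof -
  have add: "\<theta> (y + z) = \<theta> y + \<theta> z"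
    and scale: "\<theta> (scaleQ c y) = scaleQ c (\<theta> y)" for y z c
    using assms by (auto simp: Der_def derivation_on_def)
  have h: "\<theta> y \<in> homog (i - k)" if "y \<in> homog i" for i y
    using assms that by (auto simp: Der_def derivation_on_def)
  have i0: "invol 0 = (0 :: 'a free_gca)"
    by (rule free_gca_eqI) (simp add: invol.rep_eq zero_free_gca.rep_eq)
  have iscale: "invol (scaleQ c y) = scaleQ c (invol y)" for c and y :: "'a free_gca"
    by (rule free_gca_eqI) (simp add: invol.rep_eq scaleQ.rep_eq)
  have t0: "\<theta> 0 = 0" using add[of 0 0] by simp
  have "invol (\<theta> (invol y)) = scaleQ ((-1) powi k) (\<theta> y)" for y
  proof (induction y rule: homog_induct)
    case zero
    then show ?case by (simp add: i0 t0)
  next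
    case (add i x y)
    have "invol (\<theta> (invol x)) = scaleQ ((-1) powi k) (\<theta> x)"
      using add(1) h[OF add(1)]
      by (simp add: invol_homog scale iscale power_int_minus_left)
    with add show ?case
      by (simp add: \<open>\<And>z y. \<theta> (y + z) = \<theta> y + \<theta> z\<close> invol_add gca.scale_right_distrib)
  qed
  then show ?thesis by (simp add: D_def)
qed

definition Der' :: "('v::graded_basis free_gca \<Rightarrow> 'v free_gca) \<Rightarrow> int \<Rightarrow>
    ('v free_gca \<Rightarrow> 'v free_gca) set" where
  "Der' d k =
    (if k > 1 then Der k
     else if k = 1 then {\<theta> \<in> Der 1. D d \<theta> = (\<lambda>_. 0)}
     else {\<lambda>_. 0})"

text \<open>
  The right module structure: \<open>(\<theta> x)(v) = (-1)\<^bsup>|x||v|\<^esup> \<theta>(v) x\<close> for homogeneous \<open>x\<close> and \<open>v\<close>, extended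
  bilinearly.
\<close>

definition right_act :: "('v::graded_basis free_gca \<Rightarrow> 'v free_gca) \<Rightarrow> 'v free_gca \<Rightarrow>
    'v free_gca \<Rightarrow> 'v free_gca" where
  "right_act \<theta> x = (\<lambda>v. \<Sum>i\<in>mdeg ` supp v. \<Sum>j\<in>mdeg ` supp x.
     scaleQ ((-1) powi (j * i)) (\<theta> (deg_comp i v) * deg_comp j x))"

lemma deg_comp_same: "x \<in> homog i \<Longrightarrow> deg_comp i x = x"
  by (rule free_gca_eqI) (auto simp: homog_def deg_comp_def select.rep_eq supp_def)

lemma right_act_homog:
  assumes "\<theta> \<in> Der k" "x \<in> homog j" "v \<in> homog i"
  shows "right_act \<theta> x v = scaleQ ((-1) powi (j * i)) (\<theta> v * x)"
proof (cases "x = 0 \<or> v = 0")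
  case True
  have "\<theta> (0 + 0) = \<theta> 0 + \<theta> 0"
    using assms by (simp only: Der_def derivation_on_def) blast
  then show ?thesis using True
    by (auto simp: right_act_def supp_def zero_free_gca.rep_eq)
next
  case False
  have ne: "supp y \<noteq> {}" if "y \<noteq> 0" for y :: "'a free_gca"
    using that free_gca_eqI[of y 0] by (auto simp: supp_def zero_free_gca.rep_eq)
  have "mdeg ` supp x = {j}" "mdeg ` supp v = {i}"
    using assms False ne[of x] ne[of v] by (auto simp: homog_def)
  then show ?thesis using assms by (simp add: right_act_def deg_comp_same)
qed

text \<open>
  \<open>L\<^sub>l \<theta> \<in> Hom(V, \<Lambda>\<^bsup>l+1\<^esup>V)\<close>; a linear map on \<open>V\<close> is represented as a function that is \<open>0\<close> outside \<open>V\<close>.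
\<close>

definition L :: "int \<Rightarrow> ('v::graded_basis free_gca \<Rightarrow> 'v free_gca) \<Rightarrow> 'v free_gca \<Rightarrow> 'v free_gca" where
  "L l \<theta> = (\<lambda>v. if v \<in> Vspace then word_comp (l + 1) (\<theta> v) else 0)"

definition G :: "('v::graded_basis free_gca \<Rightarrow> 'v free_gca) \<Rightarrow> int \<Rightarrow> bool" where
  "G d k \<longleftrightarrow>
    (\<forall>\<theta>\<in>Der' d k. D d \<theta> = (\<lambda>_. 0) \<and> L (-1) \<theta> = (\<lambda>_. 0) \<longrightarrow> (\<exists>\<eta>\<in>Der' d (k + 1). \<theta> = D d \<eta>))"


section \<open>Minimal Sullivan algebras and the space W\<close>

definition sullivan_minimal :: "('v::graded_basis free_gca \<Rightarrow> 'v free_gca) \<Rightarrow> bool" where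
  "sullivan_minimal d \<longleftrightarrow>
     d \<in> Der (-1) \<and>
     (\<forall>x. d (d x) = 0) \<and>
     (\<forall>v\<in>Vspace. d v \<in> word_ge 2) \<and>
     (\<exists>F :: nat \<Rightarrow> 'v free_gca set.
        (\<forall>i. graded_subspace (F i) \<and> F i \<subseteq> F (Suc i)) \<and> (\<Union>i. F i) = Vspace \<and>
        (\<forall>v\<in>F 0. d v = 0) \<and> (\<forall>i. \<forall>v\<in>F (Suc i). d v \<in> Lam (F i)))"

fun Vfilt :: "('v::graded_basis free_gca \<Rightarrow> 'v free_gca) \<Rightarrow> nat \<Rightarrow> 'v free_gca set" where
  "Vfilt d 0 = {v \<in> Vspace. d v = 0}"
| "Vfilt d (Suc i) = {v \<in> Vspace. d v \<in> Lam (Vfilt d i)}"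

definition splitting :: "('v::graded_basis free_gca \<Rightarrow> 'v free_gca) \<Rightarrow>
    (nat \<Rightarrow> 'v free_gca set) \<Rightarrow> bool" where
  "splitting d V \<longleftrightarrow>
     (\<forall>i. graded_subspace (V i)) \<and> V 0 = Vfilt d 0 \<and>
     (\<forall>i. Vfilt d i = {\<Sum>j\<le>i. u j | u. \<forall>j\<le>i. u j \<in> V j} \<and>
          (\<forall>u. (\<forall>j\<le>i. u j \<in> V j) \<and> (\<Sum>j\<le>i. u j) = 0 \<longrightarrow> (\<forall>j\<le>i. u j = 0)))"


section \<open>The acyclic closure\<close>

text \<open>
  Basis of \<open>V\<^sup>- \<oplus> V\<close>, where \<open>V\<^sup>-\<close> is the suspension of \<open>V\<close>. For a graded subspace \<open>W\<close> of \<open>V\<close> the algebra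
  \<open>\<Lambda>W\<^sup>- \<otimes> \<Lambda>W = \<Lambda>(W\<^sup>- \<oplus> W)\<close> is realised as the subalgebra of \<open>\<Lambda>(V\<^sup>- \<oplus> V)\<close> generated by
  \<open>W\<^sup>- \<oplus> W\<close>; the tensor \<open>a \<otimes> b\<close> is the product \<open>a b\<close>.
\<close>

datatype 'v susp = Bar 'v | Inc 'v

instantiation susp :: (graded_basis) graded_basis
begin

fun less_eq_susp :: "'a susp \<Rightarrow> 'a susp \<Rightarrow> bool" where
  "less_eq_susp (Bar u) (Bar v) = (u \<le> v)"
| "less_eq_susp (Bar u) (Inc v) = True"
| "less_eq_susp (Inc u) (Bar v) = False"
| "less_eq_susp (Inc u) (Inc v) = (u \<le> v)"

definition less_susp :: "'a susp \<Rightarrow> 'a susp \<Rightarrow> bool" where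
  "less_susp x y \<longleftrightarrow> x \<le> y \<and> \<not> y \<le> x"

fun gdeg_susp :: "'a susp \<Rightarrow> int" where
  "gdeg_susp (Bar v) = gdeg v - 1"
| "gdeg_susp (Inc v) = gdeg v"

instance
proof
  fix x y z :: "'a susp"
  show "x < y \<longleftrightarrow> x \<le> y \<and> \<not> y \<le> x" by (simp add: less_susp_def)
  show "x \<le> x" by (cases x) auto
  show "x \<le> y \<Longrightarrow> y \<le> z \<Longrightarrow> x \<le> z" by (cases x; cases y; cases z) auto
  show "x \<le> y \<Longrightarrow> y \<le> x \<Longrightarrow> x = y" by (cases x; cases y) auto
  show "x \<le> y \<or> y \<le> x" by (cases x; cases y) auto
qed

end

text \<open>The algebra inclusion \<open>\<Lambda>V \<subseteq> \<Lambda>(V\<^sup>- \<oplus> V)\<close> and the suspension map \<open>V \<rightarrow> V\<^sup>-\<close>.\<close>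

definition incl :: "'v::graded_basis free_gca \<Rightarrow> 'v susp free_gca" where
  "incl x = (\<Sum>m\<in>supp x. scaleQ (coeff x m) (monom (image_mset Inc m)))"

definition bar :: "'v::graded_basis free_gca \<Rightarrow> 'v susp free_gca" where
  "bar x = (\<Sum>v\<in>{v. {#v#} \<in> supp x}. scaleQ (coeff x {#v#}) (gen (Bar v)))"

text \<open>The map \<open>s\<close>, equal to \<open>\<sigma> / l\<close> on elements of wordlength \<open>l \<ge> 1\<close>.\<close>

definition s_map :: "('v::graded_basis susp free_gca \<Rightarrow> 'v susp free_gca) \<Rightarrow>
    'v susp free_gca \<Rightarrow> 'v susp free_gca" where
  "s_map \<sigma> x = (\<Sum>l\<in>size ` supp x - {0}. scaleQ (1 / of_nat l) (\<sigma> (word_comp (int l) x)))"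

text \<open>
  Derivations of the free algebra \<open>\<Lambda>(W\<^sup>- \<oplus> W)\<close> exist and are unique for prescribed values on
  generators, so the following determines \<open>\<sigma>\<close> and \<open>d\<^sub>W\<close> on this subalgebra.
\<close>

definition acyclic_closure :: "('v::graded_basis free_gca \<Rightarrow> 'v free_gca) \<Rightarrow> 'v free_gca set \<Rightarrow>
    ('v susp free_gca \<Rightarrow> 'v susp free_gca) \<Rightarrow> ('v susp free_gca \<Rightarrow> 'v susp free_gca) \<Rightarrow> bool" where
  "acyclic_closure d W \<sigma> d\<^sub>W \<longleftrightarrow>
     derivation_on (Lam (bar ` W \<union> incl ` W)) 1 \<sigma> \<and>
     (\<forall>v\<in>W. \<sigma> (incl v) = bar v \<and> \<sigma> (bar v) = 0) \<and>
     derivation_on (Lam (bar ` W \<union> incl ` W)) (-1) d\<^sub>W \<and>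
     (\<forall>v\<in>W. d\<^sub>W (incl v) = incl (d v) \<and> d\<^sub>W (bar v) = incl v - s_map \<sigma> (incl (d v)))"

text \<open>\<open>(\<Lambda>W\<^sup>-)\<^bsup>\<le>p\<^esup>\<close> and \<open>(\<Lambda>W\<^sup>-)\<^bsup>\<le>p\<^esup> \<otimes> \<Lambda>W\<close>.\<close>

definition bar_le :: "'v::graded_basis free_gca set \<Rightarrow> int \<Rightarrow> 'v susp free_gca set" where
  "bar_le W p = Lam (bar ` W) \<inter> deg_le p"

definition bar_le_tensor :: "'v::graded_basis free_gca set \<Rightarrow> int \<Rightarrow> 'v susp free_gca set" where
  "bar_le_tensor W p = gca.span {a * incl b | a b. a \<in> bar_le W p \<and> b \<in> Lam W}"

definition module_map_on :: "'v::graded_basis free_gca set \<Rightarrow> 'v susp free_gca set \<Rightarrow> int \<Rightarrow>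
    ('v susp free_gca \<Rightarrow> 'v free_gca \<Rightarrow> 'v free_gca) \<Rightarrow> bool" where
  "module_map_on W M n \<Phi> \<longleftrightarrow>
     (\<forall>x\<in>M. \<forall>y\<in>M. \<Phi> (x + y) = (\<lambda>v. \<Phi> x v + \<Phi> y v)) \<and>
     (\<forall>c. \<forall>x\<in>M. \<Phi> (scaleQ c x) = (\<lambda>v. scaleQ c (\<Phi> x v))) \<and>
     (\<forall>j. \<forall>x\<in>M \<inter> homog j. \<Phi> x \<in> Der (n - j)) \<and>
     (\<forall>x\<in>M. \<forall>b\<in>Lam W. \<Phi> (x * incl b) = right_act (\<Phi> x) b)"

end

theory Submission
  imports Defs
begin

text \<open>
  The map \<open>\<Phi>\<close> is determined by a linear map \<open>\<phi>\<close> on \<open>\<Lambda>W\<^sup>-\<close>, which is built degree by degree. For \<open>x\<close> of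
  degree \<open>p\<close> the element \<open>d\<^sub>W x\<close> lies in \<open>(\<Lambda>W\<^sup>-)\<^bsup>\<le>p-1\<^esup> \<otimes> \<Lambda>\<^sup>+W\<close>, so \<open>\<Phi> (d\<^sub>W x)\<close> is already defined. It is a
  cycle because \<open>d\<^sub>W\<close> squares to zero, and \<open>L\<^bsub>-1\<^esub>\<close> kills it because it takes values in multiples of \<open>\<Lambda>\<^sup>+W\<close>;
  the condition \<open>G\<close> provides \<open>\<phi> x\<close>.

  For injectivity, suppose \<open>L\<^bsub>-1\<^esub> (\<phi> x) = 0\<close>. Since \<open>d\<close> is decomposable, \<open>L\<^sub>0 (D (\<phi> x)) = 0\<close>, and this equals up
  to sign \<open>L\<^sub>0 (\<Phi> (d\<^sub>W x))\<close>, which only involves \<open>L\<^bsub>-1\<^esub>\<close> of \<open>\<phi>\<close> on the coefficients of the part of \<open>d\<^sub>W x\<close>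
  linear in \<open>W\<close>. By induction this linear part vanishes. But \<open>\<sigma> (d\<^sub>W x)\<close> is \<open>x\<close> multiplied by its
  wordlength, and \<open>\<sigma>\<close> removes only one factor from \<open>W\<close>; hence \<open>x\<close> is a scalar.
\<close>

section \<open>Linear algebra on monomials\<close>

text \<open>\<open>acyclic_closure\<close> prescribes \<open>\<sigma>\<close> and the differential
  d_W on generators only, so every property of d_W, including that it squares to zero, has to be
  derived. The tool is the anticommutator of d_W and \<open>\<sigma>\<close>, used twice. On
  \<Lambda>V_0 the differential vanishes, so the anticommutator reduces to d_W \<sigma>, which
  multiplies by wordlength; the factor 1/l in s then makes d_W s the identity there. This is where
  the choice of W enters: d maps W into \<Lambda>V_0, whence d_W^2 = 0 on the elements
  \<open>bar w\<close>. On the bar factor it is \<open>\<sigma>\<close> that vanishes, so the other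
  composite multiplies by wordlength, and this gives injectivity. The degrees fit because V starts
  in degree 2. The bar generators have positive degree, so the recursion can start from the scalars;
  and a nonscalar coefficient from \<Lambda>W has degree at least 2, which pushes the bar factors of
  d_W x below the degree of x.\<close>

lemmas coeff_simps [simp] = zero_free_gca.rep_eq plus_free_gca.rep_eq uminus_free_gca.rep_eq
  one_free_gca.rep_eq scaleQ.rep_eq monom.rep_eq select.rep_eq invol.rep_eq coeff_sum

lemma coeff_minus [simp]: "coeff (x - y) m = coeff x m - coeff y m"
  by (simp only: minus_free_gca_def plus_free_gca.rep_eq uminus_free_gca.rep_eq)

lemma in_supp_iff: "m \<in> supp x \<longleftrightarrow> coeff x m \<noteq> 0"
  by (simp add: supp_def)

lemma supp_admissible: "m \<in> supp x \<Longrightarrow> admissible m"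
  using coeff_not_admissible[of m x] by (auto simp: in_supp_iff)

lemma supp_1 [simp]: "supp 1 = {{#}}"
  by (auto simp: in_supp_iff split: if_splits)

lemma sign_if: "(-1 :: rat) powi i = (if even i then 1 else -1)"
  by (simp add: power_int_minus_left)

global_interpretation gcap: vector_space_pair
    "scaleQ :: rat \<Rightarrow> 'a::graded_basis free_gca \<Rightarrow> 'a free_gca"
    "scaleQ :: rat \<Rightarrow> 'b::graded_basis free_gca \<Rightarrow> 'b free_gca"
  by unfold_locales

abbreviation linQ :: "('a::graded_basis free_gca \<Rightarrow> 'b::graded_basis free_gca) \<Rightarrow> bool" where
  "linQ \<equiv> Vector_Spaces.linear scaleQ scaleQ"

lemma linQ_I:
  assumes "\<And>x y. f (x + y) = f x + f y" "\<And>c x. f (scaleQ c x) = scaleQ c (f x)"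
  shows "linQ f"
  by (intro Vector_Spaces.linear.intro module_hom.intro module_hom_axioms.intro gca.module_axioms
      gca.vector_space_axioms assms)

lemma linQ_D:
  assumes "linQ f"
  shows "f (x + y) = f x + f y" "f (scaleQ c x) = scaleQ c (f x)" "f 0 = 0"
    "f (- x) = - f x" "f (x - y) = f x - f y"
    "f (\<Sum>a\<in>A. g a) = (\<Sum>a\<in>A. f (g a))"
  using assms by (simp_all add: gcap.linear_add gcap.linear_scale gcap.linear_0 gcap.linear_neg
      gcap.linear_diff gcap.linear_sum)

lemma monom_expand: "(\<Sum>m\<in>supp x. scaleQ (coeff x m) (monom m)) = x"
proof (rule free_gca_eqI)
  fix m
  have "coeff (\<Sum>k\<in>supp x. scaleQ (coeff x k) (monom k)) m =
    (\<Sum>k\<in>supp x. if k = m then coeff x k else 0)"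
    unfolding coeff_sum by (rule sum.cong) (auto simp: coeff_not_admissible)
  also have "\<dots> = coeff x m"
    by (simp add: in_supp_iff)
  finally show "coeff (\<Sum>k\<in>supp x. scaleQ (coeff x k) (monom k)) m = coeff x m" .
qed

text \<open>Subspaces that are later given by a condition on supports (\<open>homog\<close>,
  \<open>filt\<close>, \<open>barsub\<close>, \<open>deg_le\<close>) are subspaces because they are
  spans of monomials.\<close>

lemma span_monom: "gca.span {monom m | m. P m} = {x. \<forall>m\<in>supp x. P m}"
proof (intro subset_antisym subsetI)
  fix x :: "'a free_gca" assume "x \<in> gca.span {monom m | m. P m}"
  then have "\<forall>m. coeff x m \<noteq> 0 \<longrightarrow> P m"
    by (induction x rule: gca.span_induct_alt) (auto split: if_splits)
  then show "x \<in> {x. \<forall>m\<in>supp x. P m}" by (auto simp: in_supp_iff)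
next
  fix x :: "'a free_gca" assume x: "x \<in> {x. \<forall>m\<in>supp x. P m}"
  have "(\<Sum>m\<in>supp x. scaleQ (coeff x m) (monom m)) \<in> gca.span {monom m | m. P m}"
    using x by (intro gca.span_sum gca.span_scale gca.span_base) auto
  then show "x \<in> gca.span {monom m | m. P m}" by (simp add: monom_expand)
qed

lemma monom_induct [case_names zero add]:
  assumes "P 0"
    and "\<And>c m y. m \<in> supp x \<Longrightarrow> admissible m \<Longrightarrow> P y \<Longrightarrow> P (scaleQ c (monom m) + y)"
  shows "P x"
proof -
  have "P (\<Sum>m\<in>A. scaleQ (coeff x m) (monom m))" if "finite A" "A \<subseteq> supp x" for A
    using that
    by (induction A) (auto intro!: assms intro: supp_admissible)
  from this[of "supp x"] show ?thesis by (simp add: monom_expand)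
qed

lemma supp_monom: "supp (monom m) = (if admissible m then {m} else {})"
  by (auto simp: in_supp_iff split: if_splits)

lemma supp_add: "supp (x + y) \<subseteq> supp x \<union> supp y"
  by (auto simp: in_supp_iff)

lemma supp_scale: "supp (scaleQ c x) \<subseteq> supp x"
  by (auto simp: in_supp_iff)

lemma monom_not_admissible: "\<not> admissible m \<Longrightarrow> monom m = 0"
  by (rule free_gca_eqI) auto

lemma monom_empty [simp]: "monom {#} = 1"
  by (rule free_gca_eqI) auto

lemma Vspace_eq: "(Vspace :: 'a::graded_basis free_gca set) = {x. \<forall>m\<in>supp x. size m = 1}"
proof -
  have "range gen = {monom m | m :: 'a multiset. size m = 1}"
    by (auto simp: image_iff size_eq_Suc_imp_eq_union) (metis One_nat_def size_1_singleton_mset)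
  then show ?thesis unfolding Vspace_def using span_monom[of "\<lambda>m. size m = 1"] by (simp only:)
qed

definition mlin :: "('a::graded_basis multiset \<Rightarrow> 'b::graded_basis free_gca) \<Rightarrow> 'a free_gca \<Rightarrow> 'b free_gca"
  where "mlin F x = (\<Sum>m\<in>supp x. scaleQ (coeff x m) (F m))"

lemma mlin_superset:
  "finite A \<Longrightarrow> supp x \<subseteq> A \<Longrightarrow> mlin F x = (\<Sum>m\<in>A. scaleQ (coeff x m) (F m))"
  unfolding mlin_def by (rule sum.mono_neutral_left) (auto simp: in_supp_iff)

lemma linQ_mlin: "linQ (mlin F)"
proof (rule linQ_I)
  fix x y
  show "mlin F (x + y) = mlin F x + mlin F y"
    using supp_add[of x y]
    by (simp add: mlin_superset[of "supp x \<union> supp y"] gca.scale_left_distrib sum.distrib)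
next
  fix c x
  show "mlin F (scaleQ c x) = scaleQ c (mlin F x)"
    using supp_scale[of c x] by (simp add: mlin_superset[of "supp x"] gca.scale_sum_right)
qed

lemma mlin_monom: "admissible m \<Longrightarrow> mlin F (monom m) = F m"
  by (simp add: mlin_def supp_monom)

lemma linQ_eqI:
  assumes "linQ f" "linQ g" "\<And>m. m \<in> supp x \<Longrightarrow> admissible m \<Longrightarrow> f (monom m) = g (monom m)"
  shows "f x = g x"
proof -
  have "f (\<Sum>m\<in>supp x. scaleQ (coeff x m) (monom m)) = g (\<Sum>m\<in>supp x. scaleQ (coeff x m) (monom m))"
    unfolding linQ_D(6)[OF assms(1)] linQ_D(6)[OF assms(2)] linQ_D(2)[OF assms(1)] linQ_D(2)[OF assms(2)]
    by (intro sum.cong refl arg_cong[where f = "scaleQ _"] assms(3))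
       (auto intro: supp_admissible)
  then show ?thesis by (simp add: monom_expand)
qed

lemma linQ_select: "linQ (select P)"
  by (rule linQ_I) (rule free_gca_eqI; simp)+

lemma linQ_coeff_scale: "linQ (\<lambda>x. scaleQ (coeff x m) u)"
  by (rule linQ_I) (simp_all add: gca.scale_left_distrib)

lemma select_id: "(\<And>m. m \<in> supp x \<Longrightarrow> P m) \<Longrightarrow> select P x = x"
  by (rule free_gca_eqI) (auto simp: in_supp_iff)

lemma select_0: "(\<And>m. m \<in> supp x \<Longrightarrow> \<not> P m) \<Longrightarrow> select P x = 0"
  by (rule free_gca_eqI) (auto simp: in_supp_iff)

lemma select_span:
  assumes "x \<in> gca.span S"
    and "\<And>s. s \<in> S \<Longrightarrow> (\<forall>m\<in>supp s. P m) \<or> (\<forall>m\<in>supp s. \<not> P m)"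
  shows "select P x \<in> gca.span {s \<in> S. \<forall>m\<in>supp s. P m}"
  using assms(1)
proof (induction x rule: gca.span_induct_alt)
  case base
  then show ?case by (simp add: linQ_D(3)[OF linQ_select] gca.span_zero)
next
  case (step c s y)
  have "select P s \<in> gca.span {s \<in> S. \<forall>m\<in>supp s. P m}"
    using assms(2)[OF step(1)] step(1)
    by (auto simp: select_id select_0 gca.span_base gca.span_zero)
  with step show ?case
    by (simp add: linQ_D[OF linQ_select] gca.span_add gca.span_scale)
qed

text \<open>The projection \<open>select P\<close> fixes x and fixes or kills each spanning element.
  This is how a prescribed degree, or a lower bound on the number of factors from W, is imposed on a
  spanning family.\<close>

lemma span_filter:
  assumes "x \<in> gca.span S" "\<And>m. m \<in> supp x \<Longrightarrow> P m"
    and "\<And>s. s \<in> S \<Longrightarrow> (\<forall>m\<in>supp s. P m) \<or> (\<forall>m\<in>supp s. \<not> P m)"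
  shows "x \<in> gca.span {s \<in> S. \<forall>m\<in>supp s. P m}"
  using select_span[OF assms(1,3)] select_id[of x P] assms(2) by simp

section \<open>Additive weights and filtrations\<close>

lemma supp_mult: "supp (x * y) \<subseteq> {a + b | a b. a \<in> supp x \<and> b \<in> supp y}"
proof
  fix m assume "m \<in> supp (x * y)"
  then have "(\<Sum>(a, b)\<in>splits m. (-1) ^ inversions a b * coeff x a * coeff y b) \<noteq> 0"
    by (auto simp: in_supp_iff times_free_gca.rep_eq split: if_splits)
  then obtain p where "p \<in> splits m"
    "(case p of (a, b) \<Rightarrow> (-1) ^ inversions a b * coeff x a * coeff y b) \<noteq> 0"
    by (meson sum.not_neutral_contains_not_neutral)
  then show "m \<in> {a + b | a b. a \<in> supp x \<and> b \<in> supp y}"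
    by (cases p) (force simp: splits_def in_supp_iff)
qed

lemma supp_prod_list_sum:
  assumes "\<And>a b. \<mu> (a + b) = \<mu> a + (\<mu> b :: 'c::comm_monoid_add)" "\<mu> {#} = 0"
    and "\<And>x m. x \<in> set xs \<Longrightarrow> m \<in> supp x \<Longrightarrow> \<mu> m = f x"
  shows "\<forall>m\<in>supp (prod_list xs). \<mu> m = sum_list (map f xs)"
  using assms(3)
proof (induction xs)
  case Nil
  then show ?case using assms(2) by simp
next
  case (Cons x xs)
  show ?case
  proof
    fix m assume "m \<in> supp (prod_list (x # xs))"
    then obtain a b where "m = a + b" "a \<in> supp x" "b \<in> supp (prod_list xs)"
      using supp_mult[of x "prod_list xs"] by auto
    moreover from this have "\<mu> a = f x" by (auto intro: Cons.prems)
    moreover have "\<forall>m\<in>supp (prod_list xs). \<mu> m = sum_list (map f xs)"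
      by (rule Cons.IH) (auto intro: Cons.prems)
    ultimately show "\<mu> m = sum_list (map f (x # xs))" using assms(1) by simp
  qed
qed

lemma coeff_1_mult: "coeff (x * y :: 'a::graded_basis free_gca) {#} = coeff x {#} * coeff y {#}"
proof -
  have "splits ({#} :: 'a multiset) = {({#}, {#})}" by (auto simp: splits_def)
  then show ?thesis by (simp add: times_free_gca.rep_eq)
qed

text \<open>A one-letter monomial splits only trivially, and without a sign. Hence the linear part
  of a product sees only the constant and linear parts of its factors, which is all that is needed
  to compute L_0 of a right multiple.\<close>

lemma coeff_gen_mult:
  "coeff (x * y :: 'a::graded_basis free_gca) {#u#} = coeff x {#} * coeff y {#u#} + coeff x {#u#} * coeff y {#}"
proof -
  have "splits {#u :: 'a#} = {({#}, {#u#}), ({#u#}, {#})}"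
    by (auto simp: splits_def union_is_single)
  moreover have "admissible {#u :: 'a#}" by (simp add: admissible_def)
  ultimately show ?thesis by (simp add: times_free_gca.rep_eq)
qed

text \<open>For an additive weight this is a multiplicative filtration. It is used with
  \<open>size\<close> on \<Lambda>V and with the number \<open>isz\<close> of unsuspended letters on
  the acyclic closure.\<close>

definition filt :: "('a::graded_basis multiset \<Rightarrow> nat) \<Rightarrow> nat \<Rightarrow> 'a free_gca set" where
  "filt \<mu> r = {x. \<forall>m\<in>supp x. r \<le> \<mu> m}"

lemma subspace_supp: "gca.subspace {x. \<forall>m\<in>supp x. P m}"
  by (subst span_monom[symmetric]) (rule gca.subspace_span)

lemma subspace_filt: "gca.subspace (filt \<mu> r)"
  unfolding filt_def by (rule subspace_supp)

lemma filt_mono: "x \<in> filt \<mu> r \<Longrightarrow> s \<le> r \<Longrightarrow> x \<in> filt \<mu> s"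
  by (force simp: filt_def)

lemma filt_0 [simp]: "x \<in> filt \<mu> 0"
  by (simp add: filt_def)

lemma filt_mult:
  assumes "\<And>a b. \<mu> (a + b) = \<mu> a + \<mu> b" "x \<in> filt \<mu> r" "y \<in> filt \<mu> s"
  shows "x * y \<in> filt \<mu> (r + s)"
  unfolding filt_def
proof (intro CollectI ballI)
  fix m assume "m \<in> supp (x * y)"
  then obtain a b where "m = a + b" "a \<in> supp x" "b \<in> supp y" using supp_mult by blast
  then show "r + s \<le> \<mu> m" using assms by (simp add: filt_def add_mono)
qed

lemma mdeg_add [simp]: "mdeg (a + b) = mdeg a + mdeg b"
  by (simp add: mdeg_def)

lemma mdeg_empty [simp]: "mdeg {#} = 0"
  by (simp add: mdeg_def)

lemma mdeg_add_mset [simp]: "mdeg (add_mset v m) = gdeg v + mdeg m"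
  by (simp add: mdeg_def)

lemma homog_D: "x \<in> homog i \<Longrightarrow> m \<in> supp x \<Longrightarrow> mdeg m = i"
  by (simp add: homog_def)

lemma homog_unique: "x \<in> homog i \<Longrightarrow> x \<in> homog j \<Longrightarrow> i \<noteq> j \<Longrightarrow> x = 0"
  by (rule free_gca_eqI) (auto simp: homog_def supp_def)

lemma subspace_homog: "gca.subspace (homog i)"
  unfolding homog_def by (rule subspace_supp)

lemma homog_mult: "x \<in> homog i \<Longrightarrow> y \<in> homog j \<Longrightarrow> x * y \<in> homog (i + j)"
  unfolding homog_def by (auto dest!: subsetD[OF supp_mult])

lemma homog_1: "1 \<in> homog 0"
  by (simp add: homog_def)

lemma homog_monom: "monom m \<in> homog (mdeg m)"
  by (auto simp: homog_def in_supp_iff split: if_splits)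

lemma linQ_deg_comp: "linQ (deg_comp i)"
  unfolding deg_comp_def by (rule linQ_select)

lemma deg_comp_other: "x \<in> homog j \<Longrightarrow> i \<noteq> j \<Longrightarrow> deg_comp i x = 0"
  unfolding deg_comp_def by (rule select_0) (auto simp: homog_def)

lemma linQ_invol: "linQ invol"
  by (rule linQ_I) (rule free_gca_eqI; simp add: algebra_simps)+

definition homogs :: "'a::graded_basis free_gca set" where
  "homogs = (\<Union>i. homog i)"

lemma homogs_prod_list: "set xs \<subseteq> homogs \<Longrightarrow> prod_list xs \<in> homogs"
proof (induction xs)
  case Nil
  then show ?case using homog_1 by (auto simp: homogs_def)
next
  case (Cons x xs)
  then obtain i j where "x \<in> homog i" "prod_list xs \<in> homog j" by (auto simp: homogs_def)
  then have "x * prod_list xs \<in> homog (i + j)" by (rule homog_mult)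
  then show ?case by (auto simp: homogs_def)
qed

section \<open>Generated subalgebras\<close>

lemma subspace_Lam: "gca.subspace (Lam U)"
  unfolding Lam_def by (rule gca.subspace_span)

lemmas Lam_closed = gca.subspace_add[OF subspace_Lam] gca.subspace_scale[OF subspace_Lam]
  gca.subspace_0[OF subspace_Lam] gca.subspace_diff[OF subspace_Lam] gca.subspace_sum[OF subspace_Lam]

lemma Lam_prod_list: "set us \<subseteq> U \<Longrightarrow> prod_list us \<in> Lam U"
  unfolding Lam_def by (rule gca.span_base) (auto simp: in_lists_conv_set)

lemma Lam_1: "1 \<in> Lam U"
  using Lam_prod_list[of "[]" U] by simp

lemma Lam_base: "u \<in> U \<Longrightarrow> u \<in> Lam U"
  using Lam_prod_list[of "[u]" U] by simp

lemma Lam_induct [consumes 1, case_names zero add]: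
  assumes "x \<in> Lam U" "P 0"
    and "\<And>c us y. set us \<subseteq> U \<Longrightarrow> y \<in> Lam U \<Longrightarrow> P y \<Longrightarrow> P (scaleQ c (prod_list us) + y)"
  shows "P x"
proof -
  have "x \<in> Lam U \<and> P x"
    using assms(1) unfolding Lam_def
  proof (induction x rule: gca.span_induct_alt)
    case base
    then show ?case using assms(2) Lam_closed by (metis Lam_def)
  next
    case (step c x y)
    then obtain us where us: "set us \<subseteq> U" "x = prod_list us" by (auto simp: in_lists_conv_set)
    then show ?case using step assms(3)[of us y c] Lam_prod_list[of us U] Lam_closed
      by (metis Lam_def)
  qed
  then show ?thesis ..
qed

lemma Lam_least:
  assumes "gca.subspace T" "1 \<in> T" "\<And>u x. u \<in> U \<Longrightarrow> x \<in> T \<Longrightarrow> u * x \<in> T"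
  shows "Lam U \<subseteq> T"
proof
  have p: "prod_list us \<in> T" if "set us \<subseteq> U" for us
    using that assms(2,3) by (induction us) auto
  fix x assume "x \<in> Lam U"
  then show "x \<in> T"
    by (induction rule: Lam_induct)
       (simp_all add: gca.subspace_add[OF assms(1)] gca.subspace_scale[OF assms(1)]
          gca.subspace_0[OF assms(1)] p)
qed

lemma Lam_mult: "x \<in> Lam U \<Longrightarrow> y \<in> Lam U \<Longrightarrow> x * y \<in> Lam U"
proof -
  assume y: "y \<in> Lam U"
  have p: "prod_list us * y \<in> Lam U" if "set us \<subseteq> U" for us
    using y
  proof (induction rule: Lam_induct)
    case (add c vs y)
    have "prod_list us * prod_list vs = prod_list (us @ vs)" by simp
    then have "prod_list us * prod_list vs \<in> Lam U"
      using that add(1) Lam_prod_list[of "us @ vs" U] by simp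
    with add show ?case by (simp add: distrib_left Lam_closed)
  qed (simp add: Lam_closed)
  assume "x \<in> Lam U"
  then show ?thesis
    by (induction rule: Lam_induct) (simp_all add: distrib_right Lam_closed p)
qed

lemma Lam_subset: "U \<subseteq> Lam U' \<Longrightarrow> Lam U \<subseteq> Lam U'"
  by (rule Lam_least) (auto simp: subspace_Lam Lam_1 intro: Lam_mult)

lemma Lam_mono: "U \<subseteq> U' \<Longrightarrow> Lam U \<subseteq> Lam U'"
  by (rule Lam_subset) (auto intro: Lam_base)

text \<open>The Leibniz rule in \<open>derivation_on\<close> requires a homogeneous left factor, so
  inductions over products run over homogeneous generators. This lemma, together with
  \<open>graded_span\<close>, permits the change of generators.\<close>

lemma Lam_span_eq:
  assumes "H \<subseteq> U" "U \<subseteq> gca.span H"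
  shows "Lam U = Lam H"
proof
  have "gca.span H \<subseteq> Lam H"
    by (rule gca.span_minimal) (auto simp: subspace_Lam intro: Lam_base)
  then show "Lam U \<subseteq> Lam H" using assms(2) by (intro Lam_subset) blast
qed (rule Lam_mono[OF assms(1)])

lemma graded_span:
  assumes "graded_subspace U"
  shows "U \<subseteq> gca.span (U \<inter> homogs)"
proof
  fix x assume "x \<in> U"
  then have "deg_comp i x \<in> U \<inter> homogs" for i
    using assms deg_comp_homog[of i x] by (auto simp: graded_subspace_def homogs_def)
  then have "(\<Sum>i\<in>mdeg ` supp x. deg_comp i x) \<in> gca.span (U \<inter> homogs)"
    by (intro gca.span_sum gca.span_base)
  then show "x \<in> gca.span (U \<inter> homogs)" by (simp add: deg_comp_sum)
qed

section \<open>Derivations of a generated subalgebra\<close>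

lemma derivation_onD:
  assumes "derivation_on S k \<theta>"
  shows "x \<in> S \<Longrightarrow> \<theta> x \<in> S"
    "x \<in> S \<Longrightarrow> y \<in> S \<Longrightarrow> \<theta> (x + y) = \<theta> x + \<theta> y"
    "x \<in> S \<Longrightarrow> \<theta> (scaleQ c x) = scaleQ c (\<theta> x)"
    "x \<in> S \<Longrightarrow> x \<in> homog i \<Longrightarrow> \<theta> x \<in> homog (i - k)"
    "x \<in> S \<Longrightarrow> x \<in> homog i \<Longrightarrow> y \<in> S \<Longrightarrow> \<theta> (x * y) = \<theta> x * y + scaleQ ((-1) powi (k * i)) (x * \<theta> y)"
  using assms by (auto simp: derivation_on_def)

lemma derivation_on_Lam:
  assumes "derivation_on (Lam U) k \<theta>"
  shows "\<theta> 1 = 0" "\<theta> 0 = 0"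
    "x \<in> Lam U \<Longrightarrow> y \<in> Lam U \<Longrightarrow> \<theta> (x - y) = \<theta> x - \<theta> y"
    "finite A \<Longrightarrow> (\<And>a. a \<in> A \<Longrightarrow> f a \<in> Lam U) \<Longrightarrow> \<theta> (sum f A) = (\<Sum>a\<in>A. \<theta> (f a))"
proof -
  note der = derivation_onD[OF assms]
  show "\<theta> 1 = 0" using der(5)[OF Lam_1 homog_1 Lam_1] by simp
  show z: "\<theta> 0 = 0" using der(2)[of 0 0] by (simp add: Lam_closed)
  show "\<theta> (x - y) = \<theta> x - \<theta> y" if "x \<in> Lam U" "y \<in> Lam U"
    using der(2)[of "x - y" y] that by (simp add: Lam_closed)
  show "\<theta> (sum f A) = (\<Sum>a\<in>A. \<theta> (f a))" if "finite A" "\<And>a. a \<in> A \<Longrightarrow> f a \<in> Lam U"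
    using that by (induction A) (simp_all add: z der(2) Lam_closed)
qed

text \<open>The square of an odd derivation is again a derivation.\<close>

lemma odd_derivation_square_zero:
  assumes der: "derivation_on (Lam U) k \<delta>" and "odd k" and H: "H \<subseteq> homogs" "H \<subseteq> Lam U"
    and sq: "\<And>h. h \<in> H \<Longrightarrow> \<delta> (\<delta> h) = 0" and "x \<in> Lam H"
  shows "\<delta> (\<delta> x) = 0"
proof -
  note der = derivation_onD[OF der] derivation_on_Lam[OF der]
  have L: "y \<in> Lam U" if "y \<in> Lam H" for y
    using that Lam_subset[OF H(2)] by blast
  have p: "\<delta> (\<delta> (prod_list hs)) = 0" if "set hs \<subseteq> H" for hs
    using that
  proof (induction hs)
    case Nil
    then show ?case by (simp add: der(6,7))
  next
    case (Cons h hs)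
    let ?y = "prod_list hs"
    have "h \<in> homogs" and hU: "h \<in> Lam U" using Cons.prems H by auto
    then obtain i where "h \<in> homog i" by (auto simp: homogs_def)
    note h = this hU
    have y: "?y \<in> Lam U" using Cons by (intro L Lam_prod_list) simp
    have "\<delta> (\<delta> (h * ?y)) = \<delta> (\<delta> h * ?y) + scaleQ ((-1) powi (k * i)) (\<delta> (h * \<delta> ?y))"
      using h y by (simp add: der(1-3) der(5)[of h i] Lam_mult Lam_closed)
    \<comment> \<open>The two mixed terms carry the signs (-1)^(k(i-k)) and (-1)^(ki). These are
      opposite for odd k, so the terms cancel.\<close>
    also have "\<dots> = (\<delta> (\<delta> h) * ?y + scaleQ ((-1) powi (k * (i - k))) (\<delta> h * \<delta> ?y)) +
        scaleQ ((-1) powi (k * i)) (\<delta> h * \<delta> ?y + scaleQ ((-1) powi (k * i)) (h * \<delta> (\<delta> ?y)))"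
      using h y by (simp add: der(1) der(4) der(5)[where i = i] der(5)[where i = "i - k"])
    finally show ?case using Cons sq[of h] \<open>odd k\<close>
      by (cases "even i") (simp_all add: sign_if)
  qed
  show ?thesis using \<open>x \<in> Lam H\<close>
    by (induction rule: Lam_induct) (simp_all add: der(1-3,7) L Lam_prod_list Lam_closed p)
qed

definition euler :: "'a::graded_basis free_gca \<Rightarrow> 'a free_gca" where
  "euler = mlin (\<lambda>m. scaleQ (of_nat (size m)) (monom m))"

lemma coeff_euler: "coeff (euler x) m = of_nat (size m) * coeff x m"
proof -
  have "coeff (euler x) m = (\<Sum>k\<in>supp x. if k = m then of_nat (size k) * coeff x k else 0)"
    unfolding euler_def mlin_def coeff_sum by (rule sum.cong) (auto simp: coeff_not_admissible)
  also have "\<dots> = of_nat (size m) * coeff x m"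
    by (simp add: in_supp_iff)
  finally show ?thesis .
qed

text \<open>For odd \<open>\<alpha>\<close>, \<open>\<beta>\<close> the commutator \<open>\<alpha>\<beta> + \<beta>\<alpha>\<close> is a derivation of even degree, and it is the
  identity on the generators.\<close>

lemma derivation_composite_euler:
  assumes \<alpha>: "derivation_on (Lam U) k \<alpha>" and \<beta>: "derivation_on (Lam U) l \<beta>" and "odd k" "odd l"
    and H: "H \<subseteq> homogs" "H \<subseteq> Lam U" "H \<subseteq> Vspace"
    and h0: "\<And>h. h \<in> H \<Longrightarrow> \<beta> h = 0" and h1: "\<And>h. h \<in> H \<Longrightarrow> \<beta> (\<alpha> h) = h"
    and "x \<in> Lam H"
  shows "\<beta> (\<alpha> x) = euler x"
proof -
  note a = derivation_onD[OF \<alpha>] derivation_on_Lam[OF \<alpha>]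
  note b = derivation_onD[OF \<beta>] derivation_on_Lam[OF \<beta>]
  have L: "y \<in> Lam U" if "y \<in> Lam H" for y
    using that Lam_subset[OF H(2)] by blast
  \<comment> \<open>Since \<open>\<beta>\<close> vanishes on H and, by the second conjunct, on
    products from H, both mixed terms drop out. As k + l is even, the two remaining terms add up
    without a sign.\<close>
  have p: "\<beta> (\<alpha> (prod_list hs)) = scaleQ (of_nat (length hs)) (prod_list hs) \<and> \<beta> (prod_list hs) = 0"
    if "set hs \<subseteq> H" for hs
    using that
  proof (induction hs)
    case Nil
    then show ?case by (simp add: a(6,7) b(6,7))
  next
    case (Cons h hs)
    let ?y = "prod_list hs"
    have "h \<in> homogs" and hU: "h \<in> Lam U" using Cons.prems H by auto
    then obtain i where "h \<in> homog i" by (auto simp: homogs_def)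
    note h = this hU
    have y: "?y \<in> Lam U" using Cons by (intro L Lam_prod_list) simp
    have "\<beta> (\<alpha> (h * ?y)) = \<beta> (\<alpha> h * ?y) + scaleQ ((-1) powi (k * i)) (\<beta> (h * \<alpha> ?y))"
      using h y by (simp add: a(1-3) a(5)[of h i] b(1-3) Lam_mult Lam_closed)
    also have "\<dots> = (\<beta> (\<alpha> h) * ?y + scaleQ ((-1) powi (l * (i - k))) (\<alpha> h * \<beta> ?y)) +
        scaleQ ((-1) powi (k * i)) (\<beta> h * \<alpha> ?y + scaleQ ((-1) powi (l * i)) (h * \<beta> (\<alpha> ?y)))"
      using h y by (simp add: a(1) a(4) b(5)[where i = i] b(5)[where i = "i - k"])
    finally show ?case using Cons h0[of h] h1[of h] \<open>odd k\<close> \<open>odd l\<close> b(5)[OF h(2,1) y]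
      by (cases "even i") (simp_all add: sign_if gca.scale_left_distrib)
  qed
  have sz: "\<forall>m\<in>supp (prod_list hs). size m = length hs" if "set hs \<subseteq> H" for hs
  proof -
    have "size m = 1" if "h \<in> set hs" "m \<in> supp h" for h m
      using that \<open>set hs \<subseteq> H\<close> H(3) by (auto simp: Vspace_eq)
    then have "\<forall>m\<in>supp (prod_list hs). size m = sum_list (map (\<lambda>_. 1) hs)"
      by (intro supp_prod_list_sum) auto
    then show ?thesis by (simp add: sum_list_triv)
  qed
  have e: "euler (prod_list hs) = scaleQ (of_nat (length hs)) (prod_list hs)" if "set hs \<subseteq> H" for hs
    using sz[OF that] by (intro free_gca_eqI) (auto simp: coeff_euler in_supp_iff)
  have le: "linQ euler" unfolding euler_def by (rule linQ_mlin)
  show ?thesis using \<open>x \<in> Lam H\<close>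
  proof (induction rule: Lam_induct)
    case zero
    then show ?case by (simp add: a(7) b(7) linQ_D[OF le])
  next
    case (add c us y)
    have "prod_list us \<in> Lam U" "y \<in> Lam U"
      using add L Lam_prod_list by blast+
    then show ?case using add p[OF add(1)] e[OF add(1)]
      by (simp add: a(1-3) b(1-3) linQ_D[OF le] Lam_closed)
  qed
qed

section \<open>The algebra of the suspension\<close>

lemma less_susp_simps [simp]:
  "Bar u < Bar v \<longleftrightarrow> u < v" "Inc u < Inc v \<longleftrightarrow> u < v" "Bar u < Inc v" "\<not> Inc u < Bar v"
  by (auto simp: less_susp_def)

text \<open>\<open>ipart\<close> removes the constructor while \<open>bpart\<close> keeps it: the
  unsuspended factor has to act on derivations of \<Lambda>V, whereas the bar factor stays an
  element of the ambient algebra.\<close>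

definition ipart :: "'a susp multiset \<Rightarrow> 'a multiset" where
  "ipart m = (\<Sum>x\<in>#m. case x of Bar v \<Rightarrow> {#} | Inc v \<Rightarrow> {#v#})"

definition bpart :: "'a susp multiset \<Rightarrow> 'a susp multiset" where
  "bpart m = (\<Sum>x\<in>#m. case x of Bar v \<Rightarrow> {#Bar v#} | Inc v \<Rightarrow> {#})"

definition isz :: "'a susp multiset \<Rightarrow> nat" where
  "isz m = size (ipart m)"

lemma part_simps [simp]:
  "ipart {#} = {#}" "ipart (a + b) = ipart a + ipart b"
  "ipart (add_mset (Bar v) m) = ipart m" "ipart (add_mset (Inc v) m) = add_mset v (ipart m)"
  "bpart {#} = {#}" "bpart (a + b) = bpart a + bpart b"
  "bpart (add_mset (Bar v) m) = add_mset (Bar v) (bpart m)" "bpart (add_mset (Inc v) m) = bpart m"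
  by (simp_all add: ipart_def bpart_def)

lemma isz_simps [simp]: "isz {#} = 0" "isz (a + b) = isz a + isz b"
  by (simp_all add: isz_def)

lemma part_image_Inc [simp]:
  "ipart (image_mset Inc b) = b" "bpart (image_mset Inc b) = {#}"
  by (induction b) auto

lemma isz_image_Inc [simp]: "isz (image_mset Inc b) = size b"
  by (simp add: isz_def)

lemma ipart_bpart [simp]: "ipart (bpart m) = {#}"
proof (induction m)
  case (add x m)
  then show ?case by (cases x) auto
qed auto

lemma part_decomp: "bpart m + image_mset Inc (ipart m) = m"
proof (induction m)
  case (add x m)
  then show ?case by (cases x) auto
qed auto

lemma bpart_id: "ipart m = {#} \<Longrightarrow> bpart m = m"
  using part_decomp[of m] by simp

lemma mdeg_image_Inc [simp]: "mdeg (image_mset Inc m) = mdeg m"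
  by (induction m) auto

lemma count_ipart: "count (ipart m) v = count m (Inc v)"
proof (induction m)
  case (add x m)
  then show ?case by (cases x) auto
qed auto

lemma count_image_Inc [simp]:
  "count (image_mset Inc b) (Inc v) = count b v" "count (image_mset Inc b) (Bar v) = 0"
  by (induction b) auto

lemma inversions_image_Inc [simp]:
  "inversions (image_mset Inc a) (image_mset Inc b) = inversions a b"
  by (simp add: inversions_def image_mset.compositionality o_def)

text \<open>The order on \<open>susp\<close> puts every \<open>Bar\<close> before every
  \<open>Inc\<close>, so a bar monomial times an unsuspended one is already sorted. The tensor
  decomposition of monomials is therefore free of signs.\<close>

lemma inversions_bar_inc:
  assumes "ipart a = {#}"
  shows "inversions a (image_mset Inc b) = 0"
proof -
  have "\<not> y < x" if "x \<in># a" "y \<in># image_mset Inc b" for x y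
  proof (cases x)
    case (Inc v)
    then show ?thesis using that assms count_ipart[of a v] by (auto simp: count_eq_zero_iff)
  qed (use that in auto)
  then show ?thesis unfolding inversions_def
    by (intro sum_mset.neutral ballI) (auto intro!: sum_mset.neutral)
qed

lemma admissible_bar_inc:
  assumes "ipart a = {#}"
  shows "admissible (a + image_mset Inc b) \<longleftrightarrow> admissible a \<and> admissible b"
proof -
  have [simp]: "count a (Inc v) = 0" for v
    using count_ipart[of a v] assms by simp
  show ?thesis
  proof
    assume L: "admissible (a + image_mset Inc b)"
    show "admissible a \<and> admissible b" unfolding admissible_def
    proof (intro conjI allI impI)
      fix x :: "'a susp" assume "odd (gdeg x)"
      then show "count a x \<le> 1" using L[unfolded admissible_def, rule_format, of x] by simp
    next
      fix v :: 'a assume "odd (gdeg v)"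
      then show "count b v \<le> 1" using L[unfolded admissible_def, rule_format, of "Inc v"] by simp
    qed
  next
    assume R: "admissible a \<and> admissible b"
    show "admissible (a + image_mset Inc b)" unfolding admissible_def
    proof (intro allI impI)
      fix x :: "'a susp" assume "odd (gdeg x)"
      then show "count (a + image_mset Inc b) x \<le> 1"
        using R by (cases x) (auto simp: admissible_def)
    qed
  qed
qed

lemma admissible_image_Inc [simp]: "admissible (image_mset Inc b) \<longleftrightarrow> admissible b"
  using admissible_bar_inc[of "{#}" b] by simp

lemma monom_bar_inc:
  "ipart a = {#} \<Longrightarrow> monom a * monom (image_mset Inc b) =
    (if admissible a \<and> admissible b then monom (a + image_mset Inc b) else 0)"
  by (simp add: monom_mult admissible_bar_inc inversions_bar_inc)

lemma supp_mlin: "supp (mlin F x) \<subseteq> (\<Union>m\<in>supp x. supp (F m))"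
proof
  fix k assume "k \<in> supp (mlin F x)"
  then have "(\<Sum>m\<in>supp x. coeff x m * coeff (F m) k) \<noteq> 0"
    by (simp add: mlin_def in_supp_iff)
  then obtain m where "m \<in> supp x" "coeff x m * coeff (F m) k \<noteq> 0"
    by (meson sum.not_neutral_contains_not_neutral)
  then show "k \<in> (\<Union>m\<in>supp x. supp (F m))" by (auto simp: in_supp_iff)
qed

lemma incl_eq: "incl = mlin (\<lambda>m. monom (image_mset Inc m))"
  by (rule ext) (simp add: incl_def mlin_def)

lemma linQ_incl: "linQ incl"
  unfolding incl_eq by (rule linQ_mlin)

lemmas incl_simps = linQ_D[OF linQ_incl]

lemma incl_monom: "incl (monom m) = monom (image_mset Inc m)"
  by (cases "admissible m")
     (simp_all add: incl_eq mlin_monom monom_not_admissible linQ_D(3)[OF linQ_mlin])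

lemma incl_1 [simp]: "incl 1 = 1"
  using incl_monom[of "{#}"] by simp

lemma incl_mult: "incl (x * y) = incl x * incl y"
proof (induction x rule: monom_induct)
  case (add c m z)
  have "incl (monom m * y) = incl (monom m) * incl y"
    by (induction y rule: monom_induct)
       (simp_all add: incl_simps incl_monom monom_mult distrib_left flip: image_mset_union)
  with add show ?case by (simp add: incl_simps distrib_right)
qed (simp add: incl_simps)

lemma incl_prod_list: "incl (prod_list xs) = prod_list (map incl xs)"
  by (induction xs) (simp_all add: incl_mult)

lemma supp_incl: "supp (incl x) \<subseteq> image_mset Inc ` supp x"
  using supp_mlin[of "\<lambda>m. monom (image_mset Inc m)" x] by (force simp: incl_eq supp_monom split: if_splits)

lemma incl_homog: "x \<in> homog i \<Longrightarrow> incl x \<in> homog i"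
  using supp_incl[of x] by (force simp: homog_def)

lemma finite_singles: "finite {v. {#v#} \<in> supp x}"
  using finite_vimageI[OF finite_supp[of x], of "\<lambda>v. {#v#}"] by (simp add: vimage_def inj_def)

lemma bar_superset:
  assumes "finite A" "{v. {#v#} \<in> supp x} \<subseteq> A"
  shows "bar x = (\<Sum>v\<in>A. scaleQ (coeff x {#v#}) (gen (Bar v)))"
  unfolding bar_def using assms by (intro sum.mono_neutral_left) (auto simp: in_supp_iff)

lemma linQ_bar: "linQ bar"
proof (rule linQ_I)
  fix x y :: "'a free_gca"
  let ?A = "{v. {#v#} \<in> supp x} \<union> {v. {#v#} \<in> supp y}"
  have "finite ?A" by (simp add: finite_singles)
  moreover have "{v. {#v#} \<in> supp (x + y)} \<subseteq> ?A" using supp_add[of x y] by auto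
  ultimately show "bar (x + y) = bar x + bar y"
    by (simp add: bar_superset[of ?A] gca.scale_left_distrib sum.distrib)
next
  fix c and x :: "'a free_gca"
  have "{v. {#v#} \<in> supp (scaleQ c x)} \<subseteq> {v. {#v#} \<in> supp x}" using supp_scale[of c x] by auto
  then show "bar (scaleQ c x) = scaleQ c (bar x)"
    by (simp add: bar_superset[of "{v. {#v#} \<in> supp x}"] finite_singles gca.scale_sum_right)
qed

lemma supp_bar: "supp (bar x) \<subseteq> {{#Bar v#} | v. {#v#} \<in> supp x}"
proof
  fix k assume "k \<in> supp (bar x)"
  then have "(\<Sum>v\<in>{v. {#v#} \<in> supp x}. coeff x {#v#} * coeff (gen (Bar v)) k) \<noteq> 0"
    by (simp add: bar_def in_supp_iff)
  then obtain v where "{#v#} \<in> supp x" "coeff x {#v#} * coeff (gen (Bar v)) k \<noteq> 0"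
    by (metis (no_types, lifting) mem_Collect_eq sum.not_neutral_contains_not_neutral)
  then show "k \<in> {{#Bar v#} | v. {#v#} \<in> supp x}" by (auto split: if_splits)
qed

lemma bar_homog: "x \<in> homog i \<Longrightarrow> bar x \<in> homog (i - 1)"
  using supp_bar[of x] by (force simp: homog_def)

lemma bar_Vspace: "bar x \<in> Vspace"
  using supp_bar[of x] by (auto simp: Vspace_eq)

lemma incl_Vspace: "x \<in> Vspace \<Longrightarrow> incl x \<in> Vspace"
  using supp_incl[of x] by (auto simp: Vspace_eq)

text \<open>The subalgebra \<open>\<Lambda>V\<^sup>-\<close> of \<open>\<Lambda>(V\<^sup>- \<oplus> V)\<close>.\<close>

definition barsub :: "'a::graded_basis susp free_gca set" where
  "barsub = {x. \<forall>m\<in>supp x. ipart m = {#}}"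

lemma subspace_barsub: "gca.subspace barsub"
  unfolding barsub_def by (rule subspace_supp)

lemma Lam_bar_barsub: "Lam (bar ` W) \<subseteq> barsub"
proof (rule Lam_least[OF subspace_barsub])
  fix u x :: "'a susp free_gca" assume "u \<in> bar ` W" "x \<in> barsub"
  then show "u * x \<in> barsub"
    using supp_mult[of u x] supp_bar by (fastforce simp: barsub_def)
qed (simp add: barsub_def)

section \<open>The right module of derivations\<close>

lemma linQ_homog_eqI:
  assumes "linQ f" "linQ g" "\<And>i x. x \<in> homog i \<Longrightarrow> f x = g x"
  shows "f x = g x"
  by (induction x rule: homog_induct) (simp_all add: linQ_D[OF assms(1)] linQ_D[OF assms(2)] assms(3))

lemma DerD:
  assumes "\<theta> \<in> Der k"
  shows "linQ \<theta>" "x \<in> homog i \<Longrightarrow> \<theta> x \<in> homog (i - k)"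
    "x \<in> homog i \<Longrightarrow> \<theta> (x * y) = \<theta> x * y + scaleQ ((-1) powi (k * i)) (x * \<theta> y)"
  using assms by (auto simp: Der_def derivation_on_def intro!: linQ_I)

lemma DerI:
  assumes "linQ \<theta>" "\<And>i x. x \<in> homog i \<Longrightarrow> \<theta> x \<in> homog (i - k)"
    "\<And>i j x y. x \<in> homog i \<Longrightarrow> y \<in> homog j \<Longrightarrow>
      \<theta> (x * y) = \<theta> x * y + scaleQ ((-1) powi (k * i)) (x * \<theta> y)"
  shows "\<theta> \<in> Der k"
proof -
  note l = linQ_D[OF assms(1)]
  have "\<theta> (x * y) = \<theta> x * y + scaleQ ((-1) powi (k * i)) (x * \<theta> y)" if "x \<in> homog i" for i x y
    by (induction y rule: homog_induct)
       (simp_all add: l distrib_left gca.scale_right_distrib assms(3)[OF that])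
  then show ?thesis using assms(2) by (simp add: Der_def derivation_on_def l)
qed

lemma Der_0: "(\<lambda>_. 0) \<in> Der k"
  by (rule DerI) (auto intro!: linQ_I simp: gca.subspace_0[OF subspace_homog])

lemma Der_add: "\<theta> \<in> Der k \<Longrightarrow> \<eta> \<in> Der k \<Longrightarrow> (\<lambda>v. \<theta> v + \<eta> v) \<in> Der k"
  by (rule DerI)
     (auto intro!: linQ_I gca.subspace_add[OF subspace_homog] dest: DerD(2)
       simp: DerD(3) linQ_D(1,2)[OF DerD(1)] gca.scale_right_distrib distrib_left distrib_right)

lemma Der_scale: "\<theta> \<in> Der k \<Longrightarrow> (\<lambda>v. scaleQ c (\<theta> v)) \<in> Der k"
  by (rule DerI)
     (auto intro!: linQ_I gca.subspace_scale[OF subspace_homog] dest: DerD(2)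
       simp: DerD(3) linQ_D(1,2)[OF DerD(1)] gca.scale_right_distrib mult.commute)

lemma Der_1: "\<theta> \<in> Der k \<Longrightarrow> \<theta> 1 = 0"
  using DerD(3)[of \<theta> k 1 0 1] homog_1 by simp

text \<open>\<open>right_act\<close> sums over degrees that depend on its arguments. Enlarging them
  to common index sets adds only zero terms and makes linearity in both arguments visible.\<close>

lemma right_act_superset:
  assumes "\<theta> 0 = 0" "finite I" "mdeg ` supp v \<subseteq> I" "finite J" "mdeg ` supp x \<subseteq> J"
  shows "right_act \<theta> x v =
    (\<Sum>i\<in>I. \<Sum>j\<in>J. scaleQ ((-1) powi (j * i)) (\<theta> (deg_comp i v) * deg_comp j x))"
proof -
  have z: "deg_comp i y = 0" if "i \<notin> mdeg ` supp y" for i and y :: "'a free_gca"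
    unfolding deg_comp_def using that by (intro select_0) auto
  have "right_act \<theta> x v =
    (\<Sum>i\<in>mdeg ` supp v. \<Sum>j\<in>J. scaleQ ((-1) powi (j * i)) (\<theta> (deg_comp i v) * deg_comp j x))"
    unfolding right_act_def
    by (intro sum.cong refl sum.mono_neutral_left assms) (auto simp: z)
  also have "\<dots> = (\<Sum>i\<in>I. \<Sum>j\<in>J. scaleQ ((-1) powi (j * i)) (\<theta> (deg_comp i v) * deg_comp j x))"
    by (intro sum.mono_neutral_left assms) (auto simp: z assms(1))
  finally show ?thesis .
qed

lemma mdeg_supp_add: "mdeg ` supp (x + y) \<subseteq> mdeg ` supp x \<union> mdeg ` supp y"
  using supp_add[of x y] by auto

lemma mdeg_supp_scale: "mdeg ` supp (scaleQ c x) \<subseteq> mdeg ` supp x"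
  using supp_scale[of c x] by auto

lemmas deg_comp_simps = linQ_D[OF linQ_deg_comp]

lemma linQ_right_act:
  assumes "linQ \<theta>"
  shows "linQ (right_act \<theta> x)"
proof -
  note l = linQ_D[OF assms]
  show ?thesis
  proof (rule linQ_I)
    fix v w
    show "right_act \<theta> x (v + w) = right_act \<theta> x v + right_act \<theta> x w"
      using mdeg_supp_add[of v w]
      by (simp add: right_act_superset[where I = "mdeg ` supp v \<union> mdeg ` supp w" and J = "mdeg ` supp x"]
          l deg_comp_simps distrib_right gca.scale_right_distrib sum.distrib)
  next
    fix c v
    show "right_act \<theta> x (scaleQ c v) = scaleQ c (right_act \<theta> x v)"
      using mdeg_supp_scale[of c v]
      by (simp add: right_act_superset[where I = "mdeg ` supp v" and J = "mdeg ` supp x"]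
          l deg_comp_simps gca.scale_sum_right mult.commute)
  qed
qed

lemma linQ_right_act_arg:
  assumes "linQ \<theta>"
  shows "linQ (\<lambda>x. right_act \<theta> x v)"
proof -
  note l = linQ_D[OF assms]
  show ?thesis
  proof (rule linQ_I)
    fix x y
    show "right_act \<theta> (x + y) v = right_act \<theta> x v + right_act \<theta> y v"
      using mdeg_supp_add[of x y]
      by (simp add: right_act_superset[where J = "mdeg ` supp x \<union> mdeg ` supp y" and I = "mdeg ` supp v"]
          l deg_comp_simps distrib_left gca.scale_right_distrib sum.distrib)
  next
    fix c x
    show "right_act \<theta> (scaleQ c x) v = scaleQ c (right_act \<theta> x v)"
      using mdeg_supp_scale[of c x]
      by (simp add: right_act_superset[where J = "mdeg ` supp x" and I = "mdeg ` supp v"]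
          l deg_comp_simps gca.scale_sum_right mult.commute)
  qed
qed

lemma right_act_fun_add:
  "right_act (\<lambda>v. \<theta> v + \<eta> v) x v = right_act \<theta> x v + right_act \<eta> x v"
  by (simp add: right_act_def distrib_right gca.scale_right_distrib sum.distrib)

lemma right_act_fun_scale:
  "right_act (\<lambda>v. scaleQ c (\<theta> v)) x v = scaleQ c (right_act \<theta> x v)"
  by (simp add: right_act_def gca.scale_sum_right mult.commute)

lemma right_act_fun_0: "right_act (\<lambda>v. 0) x v = 0"
  by (simp add: right_act_def)

lemma right_act_homogs:
  assumes "linQ \<theta>" "x \<in> homog j" "v \<in> homog i"
  shows "right_act \<theta> x v = scaleQ ((-1) powi (j * i)) (\<theta> v * x)"
proof -
  have "right_act \<theta> x v = (\<Sum>i\<in>{i}. \<Sum>j\<in>{j}. scaleQ ((-1) powi (j * i)) (\<theta> (deg_comp i v) * deg_comp j x))"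
    using assms by (intro right_act_superset) (auto simp: linQ_D homog_def)
  then show ?thesis using assms by (simp add: deg_comp_same)
qed

lemma right_act_1: "linQ \<theta> \<Longrightarrow> right_act \<theta> 1 = \<theta>"
  by (rule HOL.ext, rule linQ_homog_eqI[OF linQ_right_act])
     (auto simp: right_act_homogs[OF _ homog_1])

lemma right_act_assoc:
  fixes \<theta> :: "'a::graded_basis free_gca \<Rightarrow> 'a free_gca"
  assumes "linQ \<theta>"
  shows "right_act (right_act \<theta> x) y = right_act \<theta> (x * y)"
proof
  fix v
  note la = linQ_right_act[OF assms] linQ_right_act_arg[OF assms]
  note l2 = linQ_right_act[OF la(1)] linQ_right_act_arg[OF la(1)]
  have *: "right_act (right_act \<theta> x) y v = right_act \<theta> (x * y) v"
    if "x \<in> homog i" "y \<in> homog j" for i j x y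
  proof (rule linQ_homog_eqI[OF l2(1) la(1)])
    fix k and v :: "'a free_gca" assume v: "v \<in> homog k"
    show "right_act (right_act \<theta> x) y v = right_act \<theta> (x * y) v"
      using right_act_homogs[OF la(1) that(2) v] right_act_homogs[OF assms that(1) v]
        right_act_homogs[OF assms homog_mult[OF that] v]
      by (simp add: sign_if mult.assoc)
  qed
  have **: "right_act (right_act \<theta> x) y v = right_act \<theta> (x * y) v" if "x \<in> homog i" for i x
    by (induction y rule: homog_induct) (simp_all add: linQ_D[OF l2(2)] linQ_D[OF la(2)] distrib_left *[OF that])
  show "right_act (right_act \<theta> x) y v = right_act \<theta> (x * y) v"
  proof (induction x rule: homog_induct)
    case zero
    have "right_act \<theta> 0 = (\<lambda>v. 0)" by (rule HOL.ext) (simp add: linQ_D[OF la(2)])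
    then show ?case by (simp add: linQ_D[OF la(2)] right_act_fun_0)
  next
    case (add i x z)
    have "right_act \<theta> (x + z) = (\<lambda>v. right_act \<theta> x v + right_act \<theta> z v)"
      by (rule HOL.ext) (simp add: linQ_D[OF la(2)])
    then show ?case using add **[of x i]
      by (simp add: right_act_fun_add distrib_right linQ_D[OF la(2)])
  qed
qed

text \<open>In \<theta>(v) w x the factor x has to pass w; the sign this costs is cancelled by the
  part of the sign in the action that depends on w.\<close>

lemma right_act_Der:
  fixes \<theta> :: "'a::graded_basis free_gca \<Rightarrow> 'a free_gca"
  assumes \<theta>: "\<theta> \<in> Der k" and x: "x \<in> homog j"
  shows "right_act \<theta> x \<in> Der (k - j)"
proof (rule DerI)
  note l = DerD(1)[OF \<theta>]
  show "linQ (right_act \<theta> x)" by (rule linQ_right_act[OF l])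
  show "right_act \<theta> x v \<in> homog (i - (k - j))" if "v \<in> homog i" for i v
    using homog_mult[OF DerD(2)[OF \<theta> that] x] right_act_homogs[OF l x that]
    by (simp add: gca.subspace_scale[OF subspace_homog] algebra_simps)
  fix i l' and v w :: "'a free_gca" assume v: "v \<in> homog i" and w: "w \<in> homog l'"
  have "w * x = scaleQ ((-1) powi (l' * j)) (x * w)" by (rule graded_commutative[OF w x])
  then have "\<theta> v * w * x = scaleQ ((-1) powi (l' * j)) (\<theta> v * x * w)" by (simp add: mult.assoc)
  then show "right_act \<theta> x (v * w) = right_act \<theta> x v * w + scaleQ ((-1) powi ((k - j) * i)) (v * right_act \<theta> x w)"
    using right_act_homogs[OF l x v] right_act_homogs[OF l x w]
      right_act_homogs[OF l x homog_mult[OF v w]] DerD(3)[OF \<theta> v, of w]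
    by (simp add: distrib_right mult.assoc gca.scale_right_distrib sign_if)
qed

lemma linQ_D_op: "linQ d \<Longrightarrow> linQ \<theta> \<Longrightarrow> linQ (D d \<theta>)"
  unfolding D_def
  by (rule linQ_I) (simp_all add: linQ_D linQ_D[OF linQ_invol] gca.scale_right_diff_distrib)

lemma D_add: "linQ d \<Longrightarrow> D d (\<lambda>v. \<theta> v + \<eta> v) v = D d \<theta> v + D d \<eta> v"
  by (simp add: D_def linQ_D linQ_D[OF linQ_invol])

lemma D_scale: "linQ d \<Longrightarrow> D d (\<lambda>v. scaleQ c (\<theta> v)) v = scaleQ c (D d \<theta> v)"
  by (simp add: D_def linQ_D linQ_D[OF linQ_invol] gca.scale_right_diff_distrib)

lemma D_right_act:
  fixes \<theta> :: "'a::graded_basis free_gca \<Rightarrow> 'a free_gca"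
  assumes d: "d \<in> Der (-1)" and \<theta>: "\<theta> \<in> Der k" and x: "x \<in> homog j"
  shows "D d (right_act \<theta> x) v = right_act (D d \<theta>) x v + scaleQ ((-1) powi k) (right_act \<theta> (d x) v)"
proof -
  note l = DerD(1)[OF \<theta>] and ld = DerD(1)[OF d]
  have lD: "linQ (D d \<theta>)" by (rule linQ_D_op[OF ld l])
  have dx: "d x \<in> homog (j + 1)" using DerD(2)[OF d x] by simp
  show ?thesis
  proof (rule linQ_homog_eqI[where x = v])
    show "linQ (D d (right_act \<theta> x))" by (intro linQ_D_op ld linQ_right_act l)
    show "linQ (\<lambda>v. right_act (D d \<theta>) x v + scaleQ ((-1) powi k) (right_act \<theta> (d x) v))"
      by (rule linQ_I) (simp_all add: linQ_D[OF linQ_right_act[OF lD]] linQ_D[OF linQ_right_act[OF l]]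
          gca.scale_right_distrib mult.commute)
    fix i and v :: "'a free_gca" assume v: "v \<in> homog i"
    have dv: "d v \<in> homog (i + 1)" using DerD(2)[OF d v] by simp
    have "d (\<theta> v * x) = d (\<theta> v) * x + scaleQ ((-1) powi (- 1 * (i - k))) (\<theta> v * d x)"
      by (rule DerD(3)[OF d DerD(2)[OF \<theta> v]])
    then show "D d (right_act \<theta> x) v = right_act (D d \<theta>) x v + scaleQ ((-1) powi k) (right_act \<theta> (d x) v)"
      using right_act_homogs[OF l x v] right_act_homogs[OF l x dv] right_act_homogs[OF l dx v]
        right_act_homogs[OF lD x v] D_Der[OF \<theta>, of d v] D_Der[OF right_act_Der[OF \<theta> x], of d v]
      by (simp add: linQ_D[OF ld] sign_if left_diff_distrib)
  qed
qed

section \<open>Extending a linear map on \<open>\<Lambda>V\<^sup>-\<close> to a module map\<close>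

text \<open>Linearity is demanded on the whole ambient algebra, which avoids domain conditions; only
  the values on the bar factor of W will carry information.\<close>

definition philin :: "('a::graded_basis susp free_gca \<Rightarrow> 'a free_gca \<Rightarrow> 'a free_gca) \<Rightarrow> bool" where
  "philin \<phi> \<longleftrightarrow> (\<forall>v. linQ (\<lambda>x. \<phi> x v)) \<and> (\<forall>x. linQ (\<phi> x))"

text \<open>The right \<Lambda>V-linear extension a b \<mapsto> \<phi>(a) b. It is set up on
  monomials in all of V rather than in W, so no basis of W adapted to the monomials is
  needed.\<close>

definition extend :: "('a::graded_basis susp free_gca \<Rightarrow> 'a free_gca \<Rightarrow> 'a free_gca) \<Rightarrow>
    'a susp free_gca \<Rightarrow> 'a free_gca \<Rightarrow> 'a free_gca" where
  "extend \<phi> x v = mlin (\<lambda>m. right_act (\<phi> (monom (bpart m))) (monom (ipart m)) v) x"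

lemma linQ_extend: "linQ (\<lambda>x. extend \<phi> x v)"
  unfolding extend_def by (rule linQ_mlin)

lemmas extend_simps = linQ_D[OF linQ_extend]

lemma linQ_mult_left: "linQ (\<lambda>x. x * y)" and linQ_mult_right: "linQ (\<lambda>x. y * x)"
  by (rule linQ_I; simp add: distrib_left distrib_right)+

lemma linQ_comp: "linQ f \<Longrightarrow> linQ g \<Longrightarrow> linQ (\<lambda>x. g (f x))"
  by (rule linQ_I) (simp_all add: linQ_D)

lemma philin_right_act:
  assumes "philin \<phi>"
  shows "linQ (\<lambda>a. right_act (\<phi> a) b v)"
proof (rule linQ_I)
  have l: "linQ (\<lambda>x. \<phi> x v)" for v using assms by (simp add: philin_def)
  fix x y c
  have "\<phi> (x + y) = (\<lambda>v. \<phi> x v + \<phi> y v)" "\<phi> (scaleQ c x) = (\<lambda>v. scaleQ c (\<phi> x v))"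
    by (rule HOL.ext, simp add: linQ_D[OF l])+
  then show "right_act (\<phi> (x + y)) b v = right_act (\<phi> x) b v + right_act (\<phi> y) b v"
    "right_act (\<phi> (scaleQ c x)) b v = scaleQ c (right_act (\<phi> x) b v)"
    by (simp_all add: right_act_fun_add right_act_fun_scale)
qed

text \<open>Both sides are bilinear, and on monomials the product a b is sign-free with
  \<open>bpart\<close> and \<open>ipart\<close> returning its two factors. Stated for a general
  bilinear G because it serves \<open>extend\<close> and \<open>slice\<close> alike.\<close>

lemma mlin_bar_incl:
  fixes G :: "'a::graded_basis susp free_gca \<Rightarrow> 'a free_gca \<Rightarrow> 'b::graded_basis free_gca"
  assumes "a \<in> barsub"
    and F: "\<And>y. linQ (\<lambda>x. G x y)" "\<And>x. linQ (\<lambda>y. G x y)"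
  shows "mlin (\<lambda>m. G (monom (bpart m)) (monom (ipart m))) (a * incl b) = G a b"
proof -
  let ?f = "mlin (\<lambda>m. G (monom (bpart m)) (monom (ipart m)))"
  have "?f (monom A * incl b) = G (monom A) b" if A: "A \<in> supp a" for A
  proof (rule linQ_eqI[of "\<lambda>b. ?f (monom A * incl b)"])
    show "linQ (\<lambda>b. ?f (monom A * incl b))"
      by (intro linQ_comp[OF _ linQ_mlin] linQ_comp[OF linQ_incl] linQ_mult_right)
    show "linQ (G (monom A))" by (rule F(2))
    fix m :: "'a multiset" assume m: "admissible m"
    have "ipart A = {#}" "admissible A"
      using A \<open>a \<in> barsub\<close> by (auto simp: barsub_def intro: supp_admissible)
    then show "?f (monom A * incl (monom m)) = G (monom A) (monom m)"
      using m by (simp add: incl_monom monom_bar_inc mlin_monom admissible_bar_inc bpart_id)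
  qed
  then show ?thesis
    using linQ_eqI[of "\<lambda>a. ?f (a * incl b)" "\<lambda>a. G a b" a, OF linQ_comp[OF linQ_mult_left linQ_mlin] F(1)]
    by blast
qed

lemma extend_bar_incl:
  assumes "philin \<phi>" "a \<in> barsub"
  shows "extend \<phi> (a * incl b) = right_act (\<phi> a) b"
proof
  fix v
  have l: "linQ (\<phi> x)" for x using assms(1) by (simp add: philin_def)
  show "extend \<phi> (a * incl b) v = right_act (\<phi> a) b v"
    unfolding extend_def
    by (rule mlin_bar_incl[OF assms(2), where G = "\<lambda>a b. right_act (\<phi> a) b v"])
       (rule philin_right_act[OF assms(1)] linQ_right_act_arg[OF l])+
qed

text \<open>The coefficient in \<open>\<Lambda>V\<^sup>-\<close> of the generator \<open>u\<close> of \<open>V\<close>.\<close>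

definition slice :: "'a::graded_basis \<Rightarrow> 'a susp free_gca \<Rightarrow> 'a susp free_gca" where
  "slice u = mlin (\<lambda>m. scaleQ (coeff (monom (ipart m)) {#u#}) (monom (bpart m)))"

lemma linQ_slice: "linQ (slice u)"
  unfolding slice_def by (rule linQ_mlin)

lemma slice_bar_incl: "a \<in> barsub \<Longrightarrow> slice u (a * incl b) = scaleQ (coeff b {#u#}) a"
  unfolding slice_def
  by (rule mlin_bar_incl[where G = "\<lambda>a b. scaleQ (coeff b {#u#}) a"])
     (auto intro!: linQ_I simp: gca.scale_right_distrib gca.scale_left_distrib mult.commute)

lemma coeff_slice:
  assumes "ipart m = {#u#}"
  shows "coeff (slice u x) (bpart m) = coeff x m"
proof -
  \<comment> \<open>The coefficients are attached to the unit so that \<open>linQ_eqI\<close>, which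
    compares linear maps between free algebras, applies to functionals.\<close>
  have l: "linQ (\<lambda>x. scaleQ (coeff (slice u x) (bpart m)) (1 :: 'a free_gca))"
    by (rule linQ_I) (simp_all add: linQ_D[OF linQ_slice] gca.scale_left_distrib)
  have "scaleQ (coeff (slice u x) (bpart m)) 1 = scaleQ (coeff x m) (1 :: 'a free_gca)"
  proof (rule linQ_eqI[OF l linQ_coeff_scale])
    fix k :: "'a susp multiset" assume k: "admissible k"
    have "admissible (bpart k)" "admissible (ipart k)"
      using admissible_bar_inc[of "bpart k" "ipart k"] k by (auto simp: part_decomp)
    moreover have "k = m \<longleftrightarrow> bpart k = bpart m \<and> ipart k = ipart m"
      by (metis part_decomp)
    ultimately show "scaleQ (coeff (slice u (monom k)) (bpart m)) 1 = scaleQ (coeff (monom k) m) (1 :: 'a free_gca)"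
      using k assms by (auto simp: slice_def mlin_monom)
  qed
  then have "coeff (scaleQ (coeff (slice u x) (bpart m)) (1 :: 'a free_gca)) {#} = coeff (scaleQ (coeff x m) (1 :: 'a free_gca)) {#}"
    by (simp only:)
  then show ?thesis by simp
qed

section \<open>The acyclic closure\<close>

lemma mdeg_ge_size:
  fixes m :: "'a::graded_basis multiset"
  assumes "\<And>v :: 'a. c \<le> gdeg v"
  shows "c * int (size m) \<le> mdeg m"
proof (induction m)
  case (add x m)
  then show ?case using assms[of x] by (simp add: algebra_simps)
qed auto

lemma linQ_Lam_image:
  assumes "linQ f" "f 1 = 1" "\<And>x y. f (x * y) = f x * f y" "x \<in> Lam U"
  shows "f x \<in> Lam (f ` U)"
  using assms(4)
proof (induction rule: Lam_induct)
  case (add c us y)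
  have "f (prod_list us) = prod_list (map f us)"
    by (induction us) (simp_all add: assms)
  moreover have "prod_list (map f us) \<in> Lam (f ` U)" using add(1) by (intro Lam_prod_list) auto
  ultimately show ?case using add by (simp add: linQ_D[OF assms(1)] Lam_closed)
qed (simp add: linQ_D[OF assms(1)] Lam_closed)

lemma size_supp_prod_list:
  assumes "set xs \<subseteq> Vspace" "m \<in> supp (prod_list xs)"
  shows "size m = length xs"
proof -
  have "\<forall>m\<in>supp (prod_list xs). size m = sum_list (map (\<lambda>_. 1) xs)"
    using assms(1) by (intro supp_prod_list_sum) (auto simp: Vspace_eq)
  then show ?thesis using assms(2) by (simp add: sum_list_triv)
qed

lemma select_Lam:
  assumes "x \<in> Lam H"
    and "\<And>hs. set hs \<subseteq> H \<Longrightarrow> (\<forall>m\<in>supp (prod_list hs). P m) \<or> (\<forall>m\<in>supp (prod_list hs). \<not> P m)"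
  shows "select P x \<in> gca.span {prod_list hs | hs. set hs \<subseteq> H \<and> (\<forall>m\<in>supp (prod_list hs). P m)}"
proof -
  have "select P x \<in> gca.span {s \<in> prod_list ` lists H. \<forall>m\<in>supp s. P m}"
    using assms unfolding Lam_def by (intro select_span) (auto simp: in_lists_conv_set subset_iff)
  then show ?thesis by (rule rev_subsetD[OF _ gca.span_mono]) (auto simp: in_lists_conv_set)
qed

lemma span_prod_list_Lam: "gca.span {prod_list hs | hs. set hs \<subseteq> H \<and> Q hs} \<subseteq> Lam H"
  by (rule gca.span_minimal) (auto simp: subspace_Lam intro: Lam_prod_list)

lemma deg_comp_Lam:
  assumes "H \<subseteq> homogs" "x \<in> Lam H"
  shows "deg_comp i x \<in> Lam H"
proof -
  have "(\<forall>m\<in>supp (prod_list hs). mdeg m = i) \<or> (\<forall>m\<in>supp (prod_list hs). mdeg m \<noteq> i)"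
    if "set hs \<subseteq> H" for hs
  proof -
    have "prod_list hs \<in> homogs" using that assms(1) by (intro homogs_prod_list) auto
    then obtain j where "prod_list hs \<in> homog j" by (auto simp: homogs_def)
    then show ?thesis by (cases "i = j") (auto simp: homog_def)
  qed
  then have "select (\<lambda>m. mdeg m = i) x \<in>
      gca.span {prod_list hs | hs. set hs \<subseteq> H \<and> (\<forall>m\<in>supp (prod_list hs). mdeg m = i)}"
    by (intro select_Lam assms)
  then show ?thesis unfolding deg_comp_def
    by (rule subsetD[OF span_prod_list_Lam])
qed

lemma s_map_0 [simp]: "s_map \<sigma> 0 = 0"
  by (simp add: s_map_def supp_def)

text \<open>\<open>Z\<close> stands for \<open>V\<^sub>0\<close>.\<close>

locale closure_setup =
  fixes d :: "'v::graded_basis free_gca \<Rightarrow> 'v free_gca"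
    and Z W :: "'v free_gca set"
    and \<sigma> dW :: "'v susp free_gca \<Rightarrow> 'v susp free_gca"
  assumes gdeg2: "\<And>v::'v. 2 \<le> gdeg v"
    and d: "d \<in> Der (-1)" and dd: "\<And>x. d (d x) = 0"
    and dec: "\<And>v. v \<in> Vspace \<Longrightarrow> d v \<in> filt size 2"
    and Z: "graded_subspace Z" "Z \<subseteq> W" "\<And>z. z \<in> Z \<Longrightarrow> d z = 0"
    and W: "graded_subspace W" "W \<subseteq> Vspace" "\<And>w. w \<in> W \<Longrightarrow> d w \<in> Lam Z"
    and closure: "acyclic_closure d W \<sigma> dW"
begin

section \<open>Homogeneous generators; \<open>\<sigma>\<close> and the differential on the generated
  algebra\<close>

definition H where "H = W \<inter> homogs"
definition HZ where "HZ = Z \<inter> homogs"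
definition A where "A = Lam (bar ` W \<union> incl ` W)"
definition B where "B = Lam (bar ` W)"

lemma H_sub: "H \<subseteq> W" "H \<subseteq> homogs" "HZ \<subseteq> H" "HZ \<subseteq> Z"
  using Z(2) by (auto simp: H_def HZ_def)

lemma linQ_image_span: "linQ f \<Longrightarrow> U \<subseteq> gca.span S \<Longrightarrow> f ` U \<subseteq> gca.span (f ` S)"
  by (metis gcap.linear_span_image image_mono)

lemma Lam_W: "Lam W = Lam H" and Lam_Z: "Lam Z = Lam HZ" and B_eq: "B = Lam (bar ` H)"
  and A_eq: "A = Lam (bar ` H \<union> incl ` H)"
proof -
  have w: "W \<subseteq> gca.span H" and z: "Z \<subseteq> gca.span HZ"
    using graded_span[OF W(1)] graded_span[OF Z(1)] by (auto simp: H_def HZ_def)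
  show "Lam W = Lam H" using w H_sub by (intro Lam_span_eq) auto
  show "Lam Z = Lam HZ" using z H_sub by (intro Lam_span_eq) auto
  have b: "bar ` W \<subseteq> gca.span (bar ` H)" "incl ` W \<subseteq> gca.span (incl ` H)"
    using linQ_image_span[OF linQ_bar w] linQ_image_span[OF linQ_incl w] by auto
  show "B = Lam (bar ` H)" unfolding B_def using b H_sub by (intro Lam_span_eq) auto
  have "gca.span (bar ` H) \<subseteq> gca.span (bar ` H \<union> incl ` H)" "gca.span (incl ` H) \<subseteq> gca.span (bar ` H \<union> incl ` H)"
    by (auto intro!: gca.span_mono)
  then show "A = Lam (bar ` H \<union> incl ` H)" unfolding A_def using b H_sub by (intro Lam_span_eq) auto
qed

lemma s_der: "derivation_on (Lam (bar ` W \<union> incl ` W)) 1 \<sigma>"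
  and d_der: "derivation_on (Lam (bar ` W \<union> incl ` W)) (-1) dW"
  and gens: "w \<in> W \<Longrightarrow> \<sigma> (incl w) = bar w" "w \<in> W \<Longrightarrow> \<sigma> (bar w) = 0"
    "w \<in> W \<Longrightarrow> dW (incl w) = incl (d w)" "w \<in> W \<Longrightarrow> dW (bar w) = incl w - s_map \<sigma> (incl (d w))"
  using closure by (auto simp: acyclic_closure_def)

lemmas s_rules = derivation_onD[OF s_der, folded A_def] derivation_on_Lam[OF s_der, folded A_def]
lemmas d_rules = derivation_onD[OF d_der, folded A_def] derivation_on_Lam[OF d_der, folded A_def]

lemma gens_A: "w \<in> W \<Longrightarrow> bar w \<in> A" "w \<in> W \<Longrightarrow> incl w \<in> A"
  by (auto simp: A_def intro: Lam_base)

lemma A_closed: "x \<in> A \<Longrightarrow> y \<in> A \<Longrightarrow> x * y \<in> A" "1 \<in> A" "0 \<in> A"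
  "x \<in> A \<Longrightarrow> y \<in> A \<Longrightarrow> x + y \<in> A" "x \<in> A \<Longrightarrow> y \<in> A \<Longrightarrow> x - y \<in> A" "x \<in> A \<Longrightarrow> scaleQ c x \<in> A"
  by (simp_all add: A_def Lam_mult Lam_1 Lam_closed)

lemma B_sub_A: "B \<subseteq> A"
  unfolding A_def B_def by (rule Lam_mono) auto

lemma incl_A: "x \<in> Lam W \<Longrightarrow> incl x \<in> A"
  using linQ_Lam_image[OF linQ_incl incl_1 incl_mult, of x W] Lam_mono[of "incl ` W" "bar ` W \<union> incl ` W"]
  by (auto simp: A_def)

lemma homogs_images: "bar ` H \<subseteq> homogs" "incl ` H \<subseteq> homogs"
  using H_sub(2) bar_homog incl_homog by (fastforce simp: homogs_def)+

lemma inclZ: "incl ` HZ \<subseteq> homogs" "incl ` HZ \<subseteq> Vspace"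
proof -
  show "incl ` HZ \<subseteq> homogs" using image_mono[OF H_sub(3), of incl] homogs_images(2) by (rule subset_trans)
  have "HZ \<subseteq> Vspace" using H_sub(1,3) W(2) by blast
  then show "incl ` HZ \<subseteq> Vspace" by (auto intro: incl_Vspace)
qed

lemma \<sigma>_B: "x \<in> B \<Longrightarrow> \<sigma> x = 0"
proof -
  have p: "\<sigma> (prod_list hs) = 0" if "set hs \<subseteq> bar ` H" for hs
    using that
  proof (induction hs)
    case Nil
    then show ?case by (simp add: s_rules)
  next
    case (Cons h hs)
    then obtain w where w: "w \<in> H" "h = bar w" by auto
    then obtain i where i: "h \<in> homog i" using homogs_images by (force simp: homogs_def)
    have "prod_list hs \<in> B" unfolding B_eq using Cons by (intro Lam_prod_list) simp
    moreover have "h \<in> A" "\<sigma> h = 0" using w H_sub gens_A gens(2) by auto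
    ultimately show ?case using Cons s_rules(5)[of h i "prod_list hs"] i B_sub_A by auto
  qed
  assume "x \<in> B"
  then show ?thesis unfolding B_eq
  proof (induction rule: Lam_induct)
    case (add c us y)
    have "prod_list us \<in> A" "y \<in> A"
      using add B_sub_A Lam_prod_list[of us "bar ` H"] unfolding B_eq by auto
    then show ?case using add p[OF add(1)] by (simp add: s_rules(2,3) A_closed)
  qed (simp add: s_rules)
qed

lemma \<sigma>\<sigma>: "x \<in> A \<Longrightarrow> \<sigma> (\<sigma> x) = 0"
  unfolding A_eq
  by (rule odd_derivation_square_zero[OF s_der, of "bar ` H \<union> incl ` H"])
     (use H_sub homogs_images gens_A gens in \<open>auto simp: A_def[symmetric] s_rules(7) subset_iff\<close>)

lemma d_Lam_W: "x \<in> Lam W \<Longrightarrow> d x \<in> Lam W \<and> dW (incl x) = incl (d x)"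
proof -
  have dw: "d w \<in> Lam W" if "w \<in> W" for w
    using W(3)[OF that] Lam_mono[OF Z(2)] by auto
  have p: "d (prod_list hs) \<in> Lam W \<and> dW (incl (prod_list hs)) = incl (d (prod_list hs))" if "set hs \<subseteq> H" for hs
    using that
  proof (induction hs)
    case Nil
    then show ?case by (simp add: Der_1[OF d] Lam_closed d_rules incl_simps)
  next
    case (Cons h hs)
    let ?y = "prod_list hs"
    obtain i where i: "h \<in> homog i" "h \<in> W" using Cons.prems by (auto simp: H_def homogs_def)
    have y: "?y \<in> Lam W" using Cons.prems H_sub by (intro Lam_prod_list) auto
    have "d (h * ?y) = d h * ?y + scaleQ ((-1) powi (- 1 * i)) (h * d ?y)"
      by (rule DerD(3)[OF d i(1)])
    moreover have "dW (incl h * incl ?y) = dW (incl h) * incl ?y + scaleQ ((-1) powi (- 1 * i)) (incl h * dW (incl ?y))"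
      by (rule d_rules(5)) (use i y in \<open>auto intro: gens_A incl_homog incl_A\<close>)
    ultimately show ?case using Cons i y dw[OF i(2)]
      by (simp add: Lam_closed Lam_mult Lam_base incl_mult incl_simps gens)
  qed
  assume "x \<in> Lam W"
  then show ?thesis unfolding Lam_W
  proof (induction rule: Lam_induct)
    case zero
    then show ?case by (simp add: linQ_D[OF DerD(1)[OF d]] incl_simps d_rules Lam_closed)
  next
    case (add c us y)
    have "incl (prod_list us) \<in> A" "incl y \<in> A"
      using add Lam_prod_list[of us H] by (auto intro: incl_A simp: Lam_W)
    then show ?case using add p[OF add(1), unfolded Lam_W]
      by (simp add: linQ_D[OF DerD(1)[OF d]] incl_simps d_rules(2,3) A_closed Lam_closed)
  qed
qed

text \<open>For z in V_0 one has d z = 0, so the correction term in d_W of \<open>bar z\<close> is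
  s(0) = 0 and d_W \<open>\<sigma>\<close> fixes z. The factor 1/l in s is there to turn the
  resulting Euler operator into the identity.\<close>

lemma dW_\<sigma>_euler: "x \<in> Lam (incl ` HZ) \<Longrightarrow> dW (\<sigma> x) = euler x"
proof (rule derivation_composite_euler[OF s_der d_der, of "incl ` HZ"])
  show "incl ` HZ \<subseteq> homogs" "incl ` HZ \<subseteq> Vspace" by (fact inclZ)+
  show "incl ` HZ \<subseteq> Lam (bar ` W \<union> incl ` W)" using H_sub(1,3) by (blast intro: Lam_base)
  fix h assume "h \<in> incl ` HZ"
  then obtain z where "z \<in> HZ" "h = incl z" by blast
  then have z: "z \<in> Z" "z \<in> W" "h = incl z" using H_sub by auto
  then show "dW h = 0" "dW (\<sigma> h) = h" using Z(3)[of z] by (simp_all add: gens incl_simps)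
qed auto

lemma isz_incl_gen: "w \<in> W \<Longrightarrow> incl w \<in> filt isz 1"
  using supp_incl[of w] W(2) by (force simp: filt_def Vspace_eq)

lemma incl_filt: "set ws \<subseteq> W \<Longrightarrow> incl (prod_list ws) \<in> filt isz (length ws)"
proof (induction ws)
  case (Cons w ws)
  then have "incl w * incl (prod_list ws) \<in> filt isz (1 + length ws)"
    by (intro filt_mult isz_incl_gen) auto
  then show ?case by (simp add: incl_mult)
qed simp

lemma \<sigma>_incl_filt: "set ws \<subseteq> H \<Longrightarrow> \<sigma> (incl (prod_list ws)) \<in> filt isz (length ws - 1)"
proof (induction ws)
  case (Cons w ws)
  let ?y = "incl (prod_list ws)"
  have w: "w \<in> W" using Cons.prems H_sub by auto
  obtain i where i: "incl w \<in> homog i" using Cons.prems homogs_images by (force simp: homogs_def)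
  have y: "?y \<in> A" using Cons.prems H_sub by (intro incl_A Lam_prod_list) auto
  have "bar w * ?y \<in> filt isz (0 + length ws)"
    using incl_filt[of ws] Cons.prems H_sub by (intro filt_mult) auto
  \<comment> \<open>For nonempty \<open>ws\<close> the truncated subtraction in the induction
    hypothesis is a true one, and the factor \<open>incl w\<close> makes up for the missing unit.
    For empty \<open>ws\<close> the bound is 0.\<close>
  moreover have "incl w * \<sigma> ?y \<in> filt isz (length ws)"
  proof (cases ws)
    case (Cons a list)
    then have "incl w * \<sigma> ?y \<in> filt isz (1 + (length ws - 1))"
      using Cons.IH Cons.prems w by (intro filt_mult isz_incl_gen) auto
    then show ?thesis using Cons by simp
  qed simp
  ultimately show ?case
    using s_rules(5)[OF gens_A(2)[OF w] i y] w
    by (simp add: incl_mult gens gca.subspace_add[OF subspace_filt] gca.subspace_scale[OF subspace_filt])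
qed simp

section \<open>The correction term s(d w) for w in W\<close>

context
  fixes w y assumes w: "w \<in> W" and y: "y = incl (d w)"
begin

lemma y_Lam: "y \<in> Lam (incl ` HZ)"
  unfolding y using W(3)[OF w] unfolding Lam_Z
  by (rule linQ_Lam_image[OF linQ_incl incl_1 incl_mult])

lemma y_word: "m \<in> supp y \<Longrightarrow> 2 \<le> size m"
  using dec[of w] w W(2) supp_incl[of "d w"] unfolding y by (force simp: filt_def)

lemma word_comp_y:
  "word_comp (int l) y \<in> gca.span {prod_list hs | hs. set hs \<subseteq> incl ` HZ \<and> (\<forall>m\<in>supp (prod_list hs). int (size m) = int l)}"
proof -
  have "(\<forall>m\<in>supp (prod_list hs). int (size m) = int l) \<or> (\<forall>m\<in>supp (prod_list hs). int (size m) \<noteq> int l)"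
    if "set hs \<subseteq> incl ` HZ" for hs
    using size_supp_prod_list[OF subset_trans[OF that inclZ(2)]] by (cases "length hs = l") auto
  then show ?thesis unfolding word_comp_def by (intro select_Lam y_Lam)
qed

lemma word_comp_Lam: "word_comp (int l) y \<in> Lam (incl ` HZ)"
  by (rule subsetD[OF span_prod_list_Lam word_comp_y])

lemma Lam_inclZ_A: "Lam (incl ` HZ) \<subseteq> A"
  unfolding A_def using H_sub by (intro Lam_mono) auto

lemma s_map_A: "s_map \<sigma> y \<in> A"
  unfolding s_map_def A_def
  by (intro Lam_closed(5) Lam_closed(2))
     (use word_comp_Lam Lam_inclZ_A s_rules(1) in \<open>auto simp: A_def\<close>)

lemma terms_A: "scaleQ c (\<sigma> (word_comp (int l) y)) \<in> A"
  using word_comp_Lam[of l] Lam_inclZ_A s_rules(1) A_closed by auto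

lemma \<sigma>_s_map: "\<sigma> (s_map \<sigma> y) = 0"
proof -
  have "\<sigma> (s_map \<sigma> y) = (\<Sum>l\<in>size ` supp y - {0}. \<sigma> (scaleQ (1 / of_nat l) (\<sigma> (word_comp (int l) y))))"
    unfolding s_map_def by (rule s_rules(9)) (auto simp: terms_A)
  also have "\<dots> = 0"
    using word_comp_Lam Lam_inclZ_A by (intro sum.neutral ballI) (auto simp: s_rules \<sigma>\<sigma> subset_iff)
  finally show ?thesis .
qed

text \<open>On the part of wordlength l, d_W \<open>\<sigma>\<close> is multiplication by l. The sum
  over l omits 0, which loses nothing because d w is decomposable.\<close>

lemma dW_s_map: "dW (s_map \<sigma> y) = y"
proof -
  have "dW (s_map \<sigma> y) = (\<Sum>l\<in>size ` supp y - {0}. dW (scaleQ (1 / of_nat l) (\<sigma> (word_comp (int l) y))))"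
    unfolding s_map_def by (rule d_rules(9)) (auto simp: terms_A)
  also have "\<dots> = (\<Sum>l\<in>size ` supp y - {0}. word_comp (int l) y)"
  proof (rule sum.cong)
    fix l assume l: "l \<in> size ` supp y - {0}"
    have "\<sigma> (word_comp (int l) y) \<in> A" using terms_A[of 1 l] by simp
    then have "dW (scaleQ (1 / of_nat l) (\<sigma> (word_comp (int l) y))) = scaleQ (1 / of_nat l) (euler (word_comp (int l) y))"
      by (simp add: d_rules(3) dW_\<sigma>_euler[OF word_comp_Lam])
    also have "\<dots> = word_comp (int l) y"
      using l by (intro free_gca_eqI) (auto simp: coeff_euler word_comp_def)
    finally show "dW (scaleQ (1 / of_nat l) (\<sigma> (word_comp (int l) y))) = word_comp (int l) y" .
  qed simp
  also have "\<dots> = y"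
  proof (rule free_gca_eqI)
    fix m
    show "coeff (\<Sum>l\<in>size ` supp y - {0}. word_comp (int l) y) m = coeff y m"
    proof (cases "m \<in> supp y")
      case True
      then have "size m \<in> size ` supp y - {0}" using y_word[OF True] by auto
      then show ?thesis by (simp add: word_comp_def sum.delta)
    qed (simp add: word_comp_def in_supp_iff)
  qed
  finally show ?thesis .
qed

text \<open>Since d w is decomposable, \<open>\<sigma>\<close> meets at least two factors from V_0
  in each term and suspends only one of them.\<close>

lemma s_map_filt: "s_map \<sigma> y \<in> filt isz 1"
  unfolding s_map_def
proof (intro gca.subspace_sum[OF subspace_filt] gca.subspace_scale[OF subspace_filt])
  fix l assume "l \<in> size ` supp y - {0}"
  then have l: "2 \<le> l" using y_word by auto
  have "gca.subspace {x \<in> A. \<sigma> x \<in> filt isz 1}"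
    by (rule gca.subspaceI)
       (auto simp: A_closed s_rules(2,3,7) gca.subspace_0[OF subspace_filt]
          gca.subspace_add[OF subspace_filt] gca.subspace_scale[OF subspace_filt])
  moreover have "prod_list hs \<in> {x \<in> A. \<sigma> x \<in> filt isz 1}"
    if hs: "set hs \<subseteq> incl ` HZ" "\<forall>m\<in>supp (prod_list hs). int (size m) = int l" for hs
  proof -
    have hA: "prod_list hs \<in> A" using Lam_prod_list[OF hs(1)] Lam_inclZ_A by auto
    have "hs \<in> map incl ` lists HZ" using hs(1) unfolding lists_image[symmetric] by auto
    then obtain ws where ws: "set ws \<subseteq> HZ" "hs = map incl ws" by (auto simp: in_lists_conv_set)
    \<comment> \<open>A product of generators may be zero, and then its support does not reveal the
      number of factors; hence the separate case.\<close>
    have "\<sigma> (prod_list hs) \<in> filt isz 1"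
    proof (cases "supp (prod_list hs) = {}")
      case True
      then have "prod_list hs = 0" by (intro free_gca_eqI) (auto simp: supp_def)
      then show ?thesis by (simp add: s_rules(7) gca.subspace_0[OF subspace_filt])
    next
      case False
      then obtain m where m: "m \<in> supp (prod_list hs)" by auto
      have "set hs \<subseteq> Vspace" using hs(1) inclZ(2) by (rule subset_trans)
      then have "length ws = l" using size_supp_prod_list[of hs m] m hs(2) ws by auto
      then show ?thesis
        using filt_mono[OF \<sigma>_incl_filt[of ws], of 1] l ws H_sub by (auto simp: incl_prod_list)
    qed
    with hA show ?thesis by simp
  qed
  ultimately have "gca.span {prod_list hs | hs. set hs \<subseteq> incl ` HZ \<and> (\<forall>m\<in>supp (prod_list hs). int (size m) = int l)}
      \<subseteq> {x \<in> A. \<sigma> x \<in> filt isz 1}"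
    by (intro gca.span_minimal) auto
  then show "\<sigma> (word_comp (int l) y) \<in> filt isz 1" using word_comp_y[of l] by auto
qed

end

text \<open>It suffices to check generators. On \<open>bar w\<close> the two contributions are d w
  and d_W s(d w), equal by \<open>dW_s_map\<close>; on \<open>incl w\<close> this is d^2 =
  0.\<close>

lemma dWdW: "x \<in> A \<Longrightarrow> dW (dW x) = 0"
  unfolding A_eq
proof (rule odd_derivation_square_zero[OF d_der, of "bar ` H \<union> incl ` H"])
  fix h assume "h \<in> bar ` H \<union> incl ` H"
  then show "dW (dW h) = 0"
  proof
    assume "h \<in> bar ` H"
    then obtain w where w: "w \<in> W" "h = bar w" using H_sub by auto
    then show ?thesis
      using d_rules(8)[OF gens_A(2) s_map_A[OF w(1) refl]] dW_s_map[OF w(1) refl] by (simp add: gens)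
  next
    assume "h \<in> incl ` H"
    then obtain w where w: "w \<in> W" "h = incl w" using H_sub by auto
    have "d w \<in> Lam W" using W(3)[OF w(1)] Lam_mono[OF Z(2)] by auto
    then show ?thesis using w d_Lam_W dd by (simp add: gens incl_simps)
  qed
qed (use homogs_images gens_A H_sub in \<open>auto simp: A_def\<close>)

text \<open>For \<open>x\<close> in \<open>\<Lambda>W\<^sup>-\<close> this recovers \<open>x\<close> from the part of \<open>d\<^sub>W x\<close> that is linear in \<open>W\<close>.\<close>

lemma \<sigma>_dW_euler: "x \<in> B \<Longrightarrow> \<sigma> (dW x) = euler x"
  unfolding B_eq
proof (rule derivation_composite_euler[OF d_der s_der, of "bar ` H"])
  show "bar ` H \<subseteq> homogs" "bar ` H \<subseteq> Vspace"
    using homogs_images by (auto intro: bar_Vspace)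
  show "bar ` H \<subseteq> Lam (bar ` W \<union> incl ` W)" using H_sub by (auto intro: Lam_base)
  fix h assume "h \<in> bar ` H"
  then obtain w where w: "w \<in> W" "h = bar w" using H_sub by auto
  then show "\<sigma> h = 0" "\<sigma> (dW h) = h"
    using s_rules(8)[OF gens_A(2) s_map_A[OF w(1) refl]] \<sigma>_s_map[OF w(1) refl] by (simp_all add: gens)
qed auto

text \<open>By the Leibniz rule it suffices to look at \<open>bar w\<close>, whose image w - s(d w)
  has a factor from V in each term. This is what will make L_{-1} vanish on \<Phi>(d_W x).\<close>

lemma dW_B_filt: "x \<in> B \<Longrightarrow> dW x \<in> filt isz 1"
proof -
  note f = gca.subspace_add[OF subspace_filt] gca.subspace_scale[OF subspace_filt]
    gca.subspace_0[OF subspace_filt] gca.subspace_diff[OF subspace_filt]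
  have p: "dW (prod_list hs) \<in> filt isz 1" if "set hs \<subseteq> bar ` H" for hs
    using that
  proof (induction hs)
    case Nil
    then show ?case by (simp add: d_rules f)
  next
    case (Cons h hs)
    then obtain w where w: "w \<in> W" "h = bar w" using H_sub by auto
    obtain i where i: "h \<in> homog i" using Cons.prems homogs_images by (force simp: homogs_def)
    have "prod_list hs \<in> B" unfolding B_eq using Cons by (intro Lam_prod_list) simp
    then have y: "prod_list hs \<in> A" using B_sub_A by auto
    have "dW h \<in> filt isz 1"
      using w s_map_filt[OF w(1) refl] isz_incl_gen[OF w(1)] by (simp add: gens f)
    then have "dW h * prod_list hs \<in> filt isz (1 + 0)" by (intro filt_mult) auto
    moreover have "h * dW (prod_list hs) \<in> filt isz (0 + 1)" using Cons by (intro filt_mult) auto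
    ultimately show ?case using d_rules(5)[of h i "prod_list hs"] w gens_A(1) i y by (simp add: f)
  qed
  assume "x \<in> B"
  then show ?thesis unfolding B_eq
  proof (induction rule: Lam_induct)
    case (add c us y)
    have "prod_list us \<in> A" "y \<in> A"
      using add B_sub_A Lam_prod_list[of us "bar ` H"] unfolding B_eq by auto
    then show ?case using add p[OF add(1)] by (simp add: d_rules(2,3) A_closed f)
  qed (simp add: d_rules f)
qed

section \<open>Expansion of elements into tensors with controlled degree and number of factors from
  W\<close>

lemma A_span: "A \<subseteq> gca.span {a * incl (prod_list ws) | a ws. a \<in> B \<inter> homogs \<and> set ws \<subseteq> H}"
  (is "_ \<subseteq> gca.span ?T")
  unfolding A_eq
proof (rule Lam_least)
  show "gca.subspace (gca.span ?T)" by (rule gca.subspace_span)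
  have "1 * incl (prod_list []) \<in> ?T"
    using Lam_1[of "bar ` W"] homog_1
    by (intro CollectI exI[of _ 1] exI[of _ "[]"] conjI refl) (auto simp: B_def homogs_def)
  then have "1 * incl (prod_list []) \<in> gca.span ?T" by (rule gca.span_base)
  then show "1 \<in> gca.span ?T" by simp
  fix u x assume u: "u \<in> bar ` H \<union> incl ` H" and "x \<in> gca.span ?T"
  from this(2) show "u * x \<in> gca.span ?T"
  proof (induction x rule: gca.span_induct_alt)
    case (step c t x)
    then obtain a ws where t: "t = a * incl (prod_list ws)" "a \<in> B" "a \<in> homogs" "set ws \<subseteq> H" by auto
    from u have "u * t \<in> gca.span ?T"
    proof
      assume b: "u \<in> bar ` H"
      then have "u * a \<in> B \<inter> homogs"
        using t homogs_images homogs_prod_list[of "[u, a]"] by (auto simp: B_eq intro: Lam_mult Lam_base)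
      then have "(u * a) * incl (prod_list ws) \<in> ?T" using t by blast
      then show ?thesis using t by (simp add: mult.assoc gca.span_base)
    next
      assume "u \<in> incl ` H"
      then obtain w where w: "w \<in> H" "u = incl w" by auto
      obtain i j where "u \<in> homog i" "a \<in> homog j" using homogs_images w t by (force simp: homogs_def)
      \<comment> \<open>A new unsuspended generator is moved past the bar factor and prepended to
        the word. Words are kept explicit because their length is read off later.\<close>
      then have "u * a = scaleQ ((-1) powi (i * j)) (a * u)" by (rule graded_commutative)
      then have "u * t = scaleQ ((-1) powi (i * j)) (a * incl (prod_list (w # ws)))"
        using t w by (simp add: incl_mult flip: mult.assoc)
      moreover have "a * incl (prod_list (w # ws)) \<in> ?T" using t w by (intro CollectI exI[of _ a] exI[of _ "w # ws"]) auto
      ultimately show ?thesis by (simp only: gca.span_scale gca.span_base)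
    qed
    with step show ?case by (simp add: distrib_left gca.span_add gca.span_scale)
  qed (simp add: gca.span_zero)
qed

lemma isz_prod:
  assumes "a \<in> B" "set ws \<subseteq> H" "m \<in> supp (a * incl (prod_list ws))"
  shows "isz m = length ws"
proof -
  obtain p q where pq: "m = p + q" "p \<in> supp a" "q \<in> supp (incl (prod_list ws))"
    using supp_mult assms(3) by blast
  then have "isz p = 0" using assms(1) Lam_bar_barsub[of W] by (auto simp: B_def barsub_def isz_def)
  moreover obtain q' where "q = image_mset Inc q'" "q' \<in> supp (prod_list ws)"
    using pq(3) supp_incl by blast
  moreover from this have "size q' = length ws"
    using assms(2) H_sub W(2) by (intro size_supp_prod_list) auto
  ultimately show ?thesis using pq by simp
qed

text \<open>Each spanning tensor is homogeneous and has a constant number of unsuspended letters in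
  all its monomials, so \<open>span_filter\<close> discards the tensors of the wrong degree or with
  too short a word.\<close>

lemma A_span_filt:
  assumes "x \<in> A" "x \<in> filt isz r" "x \<in> homog j"
  shows "x \<in> gca.span {a * incl (prod_list ws) | a ws i k.
    a \<in> B \<inter> homog i \<and> set ws \<subseteq> H \<and> prod_list ws \<in> homog k \<and> i + k = j \<and> r \<le> length ws}"
    (is "_ \<in> gca.span ?S")
proof -
  let ?T = "{a * incl (prod_list ws) | a ws. a \<in> B \<inter> homogs \<and> set ws \<subseteq> H}"
  let ?P = "\<lambda>m. r \<le> isz m \<and> mdeg m = j"
  have T: "\<exists>i k. a \<in> homog i \<and> prod_list ws \<in> homog k \<and> a * incl (prod_list ws) \<in> homog (i + k)"
    if "a \<in> homogs" "set ws \<subseteq> H" for a ws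
  proof -
    have "prod_list ws \<in> homogs" using that H_sub by (intro homogs_prod_list) auto
    with that obtain i k where "a \<in> homog i" "prod_list ws \<in> homog k" by (auto simp: homogs_def)
    then show ?thesis using homog_mult[OF _ incl_homog] by blast
  qed
  have "x \<in> gca.span {t \<in> ?T. \<forall>m\<in>supp t. ?P m}"
  proof (rule span_filter)
    show "x \<in> gca.span ?T" using assms A_span by blast
    show "?P m" if "m \<in> supp x" for m using that assms by (auto simp: filt_def homog_def)
    fix t assume "t \<in> ?T"
    then obtain a ws where t: "t = a * incl (prod_list ws)" "a \<in> B" "a \<in> homogs" "set ws \<subseteq> H" by auto
    obtain l where "t \<in> homog l" using T[OF t(3,4)] t by auto
    then show "(\<forall>m\<in>supp t. ?P m) \<or> (\<forall>m\<in>supp t. \<not> ?P m)"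
      using isz_prod[OF t(2,4)] t(1) by (auto simp: homog_def)
  qed
  moreover have "{t \<in> ?T. \<forall>m\<in>supp t. ?P m} \<subseteq> gca.span ?S"
  proof
    fix t assume "t \<in> {t \<in> ?T. \<forall>m\<in>supp t. ?P m}"
    then obtain a ws where t: "t = a * incl (prod_list ws)" "a \<in> B" "a \<in> homogs" "set ws \<subseteq> H"
      and P: "\<forall>m\<in>supp t. ?P m" by auto
    obtain i k where ik: "a \<in> homog i" "prod_list ws \<in> homog k" "t \<in> homog (i + k)"
      using T[OF t(3,4)] t by auto
    show "t \<in> gca.span ?S"
    proof (cases "supp t = {}")
      case True
      then have "t = 0" by (intro free_gca_eqI) (auto simp: supp_def)
      then show ?thesis by (simp add: gca.span_zero)
    next
      case False
      then obtain m where m: "m \<in> supp t" by auto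
      have "i + k = j" "r \<le> length ws"
        using P m ik(3) isz_prod[OF t(2,4)] t(1) by (auto simp: homog_def)
      then have "t \<in> ?S" using t ik by blast
      then show ?thesis by (rule gca.span_base)
    qed
  qed
  ultimately show ?thesis
    by (elim rev_subsetD) (rule gca.span_minimal[OF _ gca.subspace_span])
qed

text \<open>The tensors into which d_W x expands for x of degree p. The bound on i comes from total
  degree p + 1 together with degree at least 2 for a nonconstant word in W. It guarantees that
  \<Phi>(d_W x) involves \<phi> only in degrees already treated.\<close>

definition N :: "int \<Rightarrow> 'v susp free_gca set" where
  "N p = {a * incl b | a b i k. a \<in> B \<inter> homog i \<and> b \<in> Lam W \<inter> homog k \<and> coeff b {#} = 0 \<and>
     i + k = p + 1 \<and> i \<le> p - 1}"

lemma dW_mem_N: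
  assumes "x \<in> B" "x \<in> homog p"
  shows "dW x \<in> gca.span (N p)"
proof -
  have x: "x \<in> A" using assms B_sub_A by auto
  have "dW x \<in> homog (p + 1)" using d_rules(4)[OF x assms(2)] by simp
  then have "dW x \<in> gca.span {a * incl (prod_list ws) | a ws i k.
    a \<in> B \<inter> homog i \<and> set ws \<subseteq> H \<and> prod_list ws \<in> homog k \<and> i + k = p + 1 \<and> 1 \<le> length ws}"
    using assms by (intro A_span_filt d_rules(1) x dW_B_filt)
  moreover have "a * incl (prod_list ws) \<in> gca.span (N p)"
    if *: "a \<in> B \<inter> homog i" "set ws \<subseteq> H" "prod_list ws \<in> homog k" "i + k = p + 1" "1 \<le> length ws" for a ws i k
  proof (cases "supp (prod_list ws) = {}")
    case True
    then have "prod_list ws = 0" by (intro free_gca_eqI) (auto simp: supp_def)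
    then show ?thesis by (simp add: gca.span_zero incl_simps)
  next
    case False
    then obtain m where m: "m \<in> supp (prod_list ws)" by auto
    have sz: "size m = length ws" if "m \<in> supp (prod_list ws)" for m
      using that * H_sub W(2) by (intro size_supp_prod_list) auto
    have "2 \<le> k" using mdeg_ge_size[of 2 m] gdeg2 sz[OF m] m *(3,5) by (auto simp: homog_def)
    moreover have "coeff (prod_list ws) {#} = 0" using sz[of "{#}"] *(5) by (cases ws) (auto simp: in_supp_iff)
    moreover have "prod_list ws \<in> Lam W" using * by (simp add: Lam_W Lam_prod_list)
    ultimately have "a * incl (prod_list ws) \<in> N p" using * unfolding N_def by force
    then show ?thesis by (rule gca.span_base)
  qed
  ultimately show ?thesis
    by (elim rev_subsetD) (rule gca.span_minimal[OF _ gca.subspace_span]; auto)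
qed

end

section \<open>Construction of the module map\<close>

lemma D_zero: "linQ d \<Longrightarrow> D d (\<lambda>v. 0) = (\<lambda>_. 0)"
  by (rule HOL.ext) (simp add: D_def linQ_D linQ_D[OF linQ_invol])

text \<open>A derivation replaces one letter at a time by its image. Applied with r = 1 to d, and
  with r = 0 to a derivation whose values on generators have no constant term.\<close>

lemma Der_filt:
  assumes \<delta>: "\<delta> \<in> Der k" and g: "\<And>u. \<delta> (gen u) \<in> filt size (Suc r)" and x: "x \<in> filt size q"
  shows "\<delta> x \<in> filt size (q + r)"
proof -
  note f = gca.subspace_add[OF subspace_filt] gca.subspace_scale[OF subspace_filt]
    gca.subspace_0[OF subspace_filt]
  note l = linQ_D[OF DerD(1)[OF \<delta>]]
  have m: "\<delta> (monom m) \<in> filt size (size m + r)" for m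
  proof (induction m)
    case empty
    then show ?case by (simp add: Der_1[OF \<delta>] f)
  next
    case (add u m)
    show ?case
    proof (cases "admissible (add_mset u m)")
      case True
      have "gen u * monom m = scaleQ ((-1) ^ inversions {#u#} m) (monom (add_mset u m))"
        using True by (simp add: monom_mult)
      then have eq: "monom (add_mset u m) = scaleQ ((-1) ^ inversions {#u#} m) (gen u * monom m)"
        by (simp flip: power_add)
      have "\<delta> (gen u) * monom m \<in> filt size (Suc r + size m)"
        by (intro filt_mult g) (auto simp: filt_def supp_monom)
      moreover have "gen u * \<delta> (monom m) \<in> filt size (1 + (size m + r))"
        by (intro filt_mult add) (auto simp: filt_def supp_monom)
      ultimately show ?thesis
        unfolding eq l(2) DerD(3)[OF \<delta> homog_monom] by (intro f) (simp_all add: add.commute)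
    next
      case False
      then show ?thesis by (simp add: monom_not_admissible l f)
    qed
  qed
  have "(\<Sum>m\<in>supp x. scaleQ (coeff x m) (\<delta> (monom m))) \<in> filt size (q + r)"
  proof (intro gca.subspace_sum[OF subspace_filt] f)
    fix k assume "k \<in> supp x"
    then have "q \<le> size k" using x by (simp add: filt_def)
    then show "\<delta> (monom k) \<in> filt size (q + r)" by (intro filt_mono[OF m]) simp
  qed
  also have "(\<Sum>m\<in>supp x. scaleQ (coeff x m) (\<delta> (monom m))) = \<delta> x"
    by (subst (4) monom_expand[symmetric]) (simp only: l)
  finally show ?thesis .
qed

text \<open>For each v the usual construction from values on an independent set applies. Linearity
  in v survives because the coordinates of x do not depend on v.\<close>

lemma extend_basis_philin:
  assumes "gca.independent S" "\<And>b. b \<in> S \<Longrightarrow> linQ (g b)"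
  obtains \<psi> where "philin \<psi>" "\<And>b. b \<in> S \<Longrightarrow> \<psi> b = g b"
proof -
  define \<psi> where "\<psi> x v = gcap.construct S (\<lambda>b. g b v) x" for x v
  have "linQ (\<lambda>x. \<psi> x v)" for v
    unfolding \<psi>_def by (rule gcap.linear_construct[OF assms(1)])
  moreover have "linQ (\<psi> x)" for x
    by (rule linQ_I)
       (auto simp: \<psi>_def gcap.construct_def linQ_D[OF assms(2)] gca.scale_right_distrib
          gca.scale_sum_right mult.commute sum.distrib[symmetric] intro!: sum.cong)
  moreover have "\<psi> b = g b" if "b \<in> S" for b
    by (rule HOL.ext) (simp add: \<psi>_def gcap.construct_basis[OF assms(1) that])
  ultimately show thesis using that[of \<psi>] by (simp add: philin_def)
qed

lemma philin_simps:
  assumes "philin \<phi>"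
  shows "\<phi> (x + y) = (\<lambda>v. \<phi> x v + \<phi> y v)" "\<phi> (scaleQ c x) = (\<lambda>v. scaleQ c (\<phi> x v))"
    "\<phi> 0 = (\<lambda>v. 0)" "linQ (\<phi> x)" "linQ (\<lambda>x. \<phi> x v)"
  using assms by (auto simp: philin_def linQ_D(1-3)[of "\<lambda>x. \<phi> x _"] intro!: HOL.ext)

lemma extend_fun:
  "extend \<phi> (x + y) = (\<lambda>v. extend \<phi> x v + extend \<phi> y v)"
  "extend \<phi> (scaleQ c x) = (\<lambda>v. scaleQ c (extend \<phi> x v))"
  "extend \<phi> 0 = (\<lambda>v. 0)"
  by (rule HOL.ext, simp add: extend_simps)+

section \<open>Extension of maps from the bar factor to tensors\<close>

context closure_setup
begin

lemma d_lin: "linQ d"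
  by (rule DerD(1)[OF d])

lemma B_barsub: "B \<subseteq> barsub"
  unfolding B_def by (rule Lam_bar_barsub)

lemma B_closed: "x \<in> B \<Longrightarrow> y \<in> B \<Longrightarrow> x + y \<in> B" "x \<in> B \<Longrightarrow> scaleQ c x \<in> B" "0 \<in> B" "1 \<in> B"
  "x \<in> B \<Longrightarrow> y \<in> B \<Longrightarrow> x - y \<in> B"
  by (simp_all add: B_def Lam_1 Lam_closed)

lemma susp_mdeg: "int (size m) \<le> mdeg (m :: 'v susp multiset)"
proof -
  have "1 \<le> gdeg x" for x :: "'v susp"
  proof (cases x)
    case (Bar v)
    then show ?thesis using gdeg2[of v] by simp
  next
    case (Inc v)
    then show ?thesis using gdeg2[of v] by simp
  qed
  then show ?thesis using mdeg_ge_size[of 1 m] by simp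
qed

text \<open>V starts in degree 2, so its suspension starts in degree 1 and the ambient algebra is
  connected.\<close>

lemma homog_0_scalar:
  fixes x :: "'v susp free_gca"
  assumes "x \<in> homog j" "j \<le> 0"
  shows "x = scaleQ (coeff x {#}) 1" "j < 0 \<Longrightarrow> x = 0"
proof -
  have s: "m = {#} \<and> j = 0" if "m \<in> supp x" for m
  proof -
    have "mdeg m = j" by (rule homog_D[OF assms(1) that])
    then have "size m = 0" using susp_mdeg[of m] assms(2) by linarith
    then show ?thesis using \<open>mdeg m = j\<close> by simp
  qed
  show "x = scaleQ (coeff x {#}) 1"
  proof (rule free_gca_eqI)
    fix m show "coeff x m = coeff (scaleQ (coeff x {#}) 1) m"
      using s[of m] by (auto simp: in_supp_iff)
  qed
  show "j < 0 \<Longrightarrow> x = 0"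
    using s by (intro free_gca_eqI) (auto simp: in_supp_iff)
qed

lemma extend_mult:
  assumes p: "philin \<phi>" and "x \<in> A"
  shows "extend \<phi> (x * incl c) = right_act (extend \<phi> x) c"
proof -
  have "x \<in> gca.span {a * incl (prod_list ws) | a ws. a \<in> B \<inter> homogs \<and> set ws \<subseteq> H}"
    using assms A_span by blast
  then show ?thesis
  proof (induction x rule: gca.span_induct_alt)
    case base
    then show ?case by (auto simp: extend_fun right_act_fun_0)
  next
    case (step k t y)
    then obtain a b where t: "t = a * incl b" "a \<in> barsub" using B_barsub by auto
    have "t * incl c = a * incl (b * c)" using t by (simp add: incl_mult mult.assoc)
    then have "extend \<phi> (t * incl c) = right_act (extend \<phi> t) c"
      using t by (simp add: extend_bar_incl[OF p] right_act_assoc philin_simps[OF p])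
    then show ?case using step(2)
      by (auto simp: distrib_right extend_fun right_act_fun_add right_act_fun_scale)
  qed
qed

lemma extend_barsub: "philin \<phi> \<Longrightarrow> x \<in> barsub \<Longrightarrow> extend \<phi> x = \<phi> x"
  using extend_bar_incl[of \<phi> x 1] by (simp add: right_act_1 philin_simps)

text \<open>The invariant of the recursion on p. Its condition in degree j involves
  \<open>extend \<phi>\<close> only on d_W x, hence \<phi> only in degrees at most j - 1, so a
  change of \<phi> in degree p does not disturb the conditions below p.\<close>

definition good :: "('v free_gca \<Rightarrow> 'v free_gca) \<Rightarrow> int \<Rightarrow> ('v susp free_gca \<Rightarrow> 'v free_gca \<Rightarrow> 'v free_gca) \<Rightarrow> int \<Rightarrow> bool"
  where "good \<theta> n \<phi> p \<longleftrightarrow> philin \<phi> \<and> \<phi> 1 = \<theta> \<and>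
    (\<forall>j\<le>p. \<forall>x\<in>B \<inter> homog j. \<phi> x \<in> Der (n - j) \<and>
       D d (\<phi> x) = (\<lambda>v. scaleQ ((-1) powi n) (extend \<phi> (dW x) v)))"

lemma goodD:
  assumes "good \<theta> n \<phi> p"
  shows "philin \<phi>" "\<phi> 1 = \<theta>" "j \<le> p \<Longrightarrow> x \<in> B \<Longrightarrow> x \<in> homog j \<Longrightarrow> \<phi> x \<in> Der (n - j)"
    "j \<le> p \<Longrightarrow> x \<in> B \<Longrightarrow> x \<in> homog j \<Longrightarrow> D d (\<phi> x) = (\<lambda>v. scaleQ ((-1) powi n) (extend \<phi> (dW x) v))"
  using assms by (auto simp: good_def)

text \<open>A spanning family for \<open>bar_le_tensor W p\<close> with both factors homogeneous, as
  the Leibniz rules and \<open>right_act_Der\<close> require.\<close>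

definition Mgen :: "int \<Rightarrow> 'v susp free_gca set" where
  "Mgen p = {a * incl b | a b i k. a \<in> B \<inter> homog i \<and> b \<in> Lam W \<inter> homog k \<and> i \<le> p}"

lemma Mgen_A: "Mgen p \<subseteq> A"
  unfolding Mgen_def using B_sub_A incl_A A_closed(1) by auto

lemma subspace_A: "gca.subspace A"
  unfolding A_def by (rule subspace_Lam)

lemma span_Mgen_A: "gca.span (Mgen p) \<subseteq> A"
  by (rule gca.span_minimal[OF Mgen_A subspace_A])

lemma span_N_Mgen: "gca.span (N p) \<subseteq> gca.span (Mgen (p - 1))"
  by (rule gca.span_mono) (auto simp: N_def Mgen_def)

text \<open>On a tensor a b with a of degree i, D contributes the sign (-1)^(n-i) in front of
  \<phi>(a) d b, and d_W contributes (-1)^i in front of a d b. The uniform factor (-1)^n reconciles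
  the two.\<close>

lemma extend_D:
  assumes good: "good \<theta> n \<phi> p" and x: "x \<in> gca.span (Mgen p)"
  shows "D d (extend \<phi> x) v = scaleQ ((-1) powi n) (extend \<phi> (dW x) v)"
proof -
  have "x \<in> A \<and> D d (extend \<phi> x) v = scaleQ ((-1) powi n) (extend \<phi> (dW x) v)"
    using x
  proof (induction x rule: gca.span_induct_alt)
    case base
    then show ?case
      by (simp add: A_closed extend_fun d_rules D_def linQ_D[OF d_lin] linQ_D[OF linQ_invol])
  next
    case (step c t y)
    then obtain a b i k where t: "t = a * incl b" "a \<in> B" "a \<in> homog i" "b \<in> Lam W" "b \<in> homog k" "i \<le> p"
      by (auto simp: Mgen_def)
    have aA: "a \<in> A" "incl b \<in> A" "a \<in> barsub" using t B_sub_A incl_A B_barsub by auto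
    note p = goodD(1)[OF good]
    have "dW t = dW a * incl b + scaleQ ((-1) powi (- 1 * i)) (a * incl (d b))"
      using d_rules(5)[OF aA(1) t(3) aA(2)] d_Lam_W[OF t(4)] t by simp
    then have "extend \<phi> (dW t) v = right_act (extend \<phi> (dW a)) b v + scaleQ ((-1) powi (- 1 * i)) (right_act (\<phi> a) (d b) v)"
      using aA(3) by (simp add: extend_fun extend_mult[OF p d_rules(1)[OF aA(1)]] extend_bar_incl[OF p])
    moreover have "D d (extend \<phi> t) v = right_act (D d (\<phi> a)) b v + scaleQ ((-1) powi (n - i)) (right_act (\<phi> a) (d b) v)"
      using t D_right_act[OF d goodD(3)[OF good t(6,2,3)] t(5)] by (simp add: extend_bar_incl[OF p aA(3)])
    ultimately have "D d (extend \<phi> t) v = scaleQ ((-1) powi n) (extend \<phi> (dW t) v)"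
      using goodD(4)[OF good t(6,2,3)]
      by (simp add: right_act_fun_scale gca.scale_right_distrib sign_if)
    moreover have "t \<in> A" using step Mgen_A by auto
    ultimately show ?case using step
      by (simp add: A_closed extend_fun d_rules(2,3) D_add[OF d_lin] D_scale[OF d_lin]
          gca.scale_right_distrib mult.commute)
  qed
  then show ?thesis ..
qed

text \<open>A sum of derivations of different degrees need not lie in any \<open>Der\<close>, so x
  is first expanded in tensors of its own degree j.\<close>

lemma extend_Der:
  assumes good: "good \<theta> n \<phi> p" and x: "x \<in> gca.span (Mgen p)" "x \<in> homog j"
  shows "extend \<phi> x \<in> Der (n - j)"
proof -
  have "x \<in> gca.span {t \<in> Mgen p. \<forall>m\<in>supp t. mdeg m = j}"
  proof (rule span_filter[OF x(1)])
    show "mdeg m = j" if "m \<in> supp x" for m using that x by (simp add: homog_def)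
    fix t assume "t \<in> Mgen p"
    then obtain a b i k where "t = a * incl b" "a \<in> homog i" "b \<in> homog k" by (auto simp: Mgen_def)
    then have "t \<in> homog (i + k)" by (simp add: homog_mult incl_homog)
    then show "(\<forall>m\<in>supp t. mdeg m = j) \<or> (\<forall>m\<in>supp t. mdeg m \<noteq> j)"
      by (cases "i + k = j") (auto simp: homog_def)
  qed
  then show ?thesis
  proof (induction x rule: gca.span_induct_alt)
    case base
    then show ?case by (simp add: extend_fun Der_0)
  next
    case (step c t y)
    then obtain a b i k where t: "t = a * incl b" "a \<in> B" "a \<in> homog i" "b \<in> Lam W" "b \<in> homog k" "i \<le> p"
      by (auto simp: Mgen_def)
    \<comment> \<open>A zero tensor is homogeneous of every degree, so the degrees of its factors
      need not add up to j.\<close>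
    have "extend \<phi> t \<in> Der (n - j)"
    proof (cases "t = 0")
      case False
      have "t \<in> homog (i + k)" using t by (simp add: homog_mult incl_homog)
      moreover have "t \<in> homog j" using step by (simp add: homog_def)
      ultimately have "j = i + k" using homog_unique False by blast
      then show ?thesis
        using right_act_Der[OF goodD(3)[OF good t(6,2,3)] t(5)] t B_barsub
        by (simp add: extend_bar_incl[OF goodD(1)[OF good]] subset_iff algebra_simps)
    qed (simp add: extend_fun Der_0)
    with step show ?case by (simp add: extend_fun Der_add Der_scale)
  qed
qed

text \<open>The constant term is multiplicative, and the right factor b has none. This is the
  hypothesis on L_{-1} in condition \<open>G\<close>.\<close>

lemma extend_N_coeff:
  assumes p: "philin \<phi>" and x: "x \<in> gca.span (N q)"
  shows "coeff (extend \<phi> x v) {#} = 0"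
  using x
proof (induction x rule: gca.span_induct_alt)
  case (step c t y)
  then obtain a b i k where t: "t = a * incl b" "a \<in> B" "b \<in> homog k" "coeff b {#} = 0"
    by (auto simp: N_def)
  have l: "linQ (right_act (\<phi> a) b)" by (rule linQ_right_act[OF philin_simps(4)[OF p]])
  have "coeff (right_act (\<phi> a) b v) {#} = 0"
  proof (induction v rule: homog_induct)
    case (add i x y)
    then show ?case
      using right_act_homogs[OF philin_simps(4)[OF p] t(3) add(1)] t(4)
      by (simp add: linQ_D[OF l] coeff_1_mult)
  qed (simp add: linQ_D[OF l])
  then have "coeff (extend \<phi> t v) {#} = 0"
    using t B_barsub by (simp add: extend_bar_incl[OF p] subset_iff)
  with step show ?case by (simp add: extend_fun)
qed (simp add: extend_fun)

text \<open>Since b has no constant term, u can occur in \<phi>(a)(v) b only as the constant term of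
  \<phi>(a)(v) times the linear part of b. The sign is that of the right action, because b has
  degree \<open>gdeg u\<close> whenever it involves u linearly.\<close>

lemma extend_N_slice:
  assumes p: "philin \<phi>" and x: "x \<in> gca.span (N q)" and v: "v \<in> homog l"
  shows "coeff (extend \<phi> x v) {#u#} = (-1) powi (gdeg u * l) * coeff (\<phi> (slice u x) v) {#}"
  using x
proof (induction x rule: gca.span_induct_alt)
  case base
  then show ?case by (simp add: extend_fun linQ_D[OF linQ_slice] philin_simps[OF p])
next
  case (step c t y)
  then obtain a b i k where t: "t = a * incl b" "a \<in> barsub" "b \<in> homog k" "coeff b {#} = 0"
    using B_barsub by (auto simp: N_def)
  have "coeff b {#u#} \<noteq> 0 \<Longrightarrow> k = gdeg u"
    using t(3) by (force simp: homog_def in_supp_iff)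
  then have "coeff (right_act (\<phi> a) b v) {#u#} = (-1) powi (gdeg u * l) * (coeff b {#u#} * coeff (\<phi> a v) {#})"
    using right_act_homogs[OF philin_simps(4)[OF p] t(3) v] t(4)
    by (cases "coeff b {#u#} = 0") (simp_all add: coeff_gen_mult)
  then have "coeff (extend \<phi> t v) {#u#} = (-1) powi (gdeg u * l) * coeff (\<phi> (slice u t) v) {#}"
    using t by (simp add: extend_bar_incl[OF p] slice_bar_incl philin_simps[OF p])
  with step show ?case
    by (simp add: extend_fun linQ_D[OF linQ_slice] philin_simps(1,2)[OF p] algebra_simps)
qed

lemma slice_N:
  assumes "x \<in> gca.span (N q)"
  shows "slice u x \<in> B" "slice u x \<in> homog (q + 1 - gdeg u)"
proof -
  have "slice u x \<in> B \<and> slice u x \<in> homog (q + 1 - gdeg u)"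
    using assms
  proof (induction x rule: gca.span_induct_alt)
    case base
    then show ?case by (simp add: linQ_D[OF linQ_slice] B_closed gca.subspace_0[OF subspace_homog])
  next
    case (step c t y)
    then obtain a b i k where t: "t = a * incl b" "a \<in> B" "a \<in> homog i" "b \<in> homog k" "i + k = q + 1"
      by (auto simp: N_def)
    have s: "slice u t = scaleQ (coeff b {#u#}) a"
      using t B_barsub by (simp add: slice_bar_incl subset_iff)
    have "scaleQ (coeff b {#u#}) a \<in> homog (q + 1 - gdeg u)"
    proof (cases "coeff b {#u#} = 0")
      case False
      then have "k = gdeg u" using t(4) by (force simp: homog_def in_supp_iff)
      then have "i = q + 1 - gdeg u" using t(5) by simp
      then show ?thesis using t(3) by (simp add: gca.subspace_scale[OF subspace_homog])
    qed (simp add: gca.subspace_0[OF subspace_homog])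
    then show ?case using step t(2)
      by (simp add: linQ_D[OF linQ_slice] s B_closed gca.subspace_add[OF subspace_homog]
          gca.subspace_scale[OF subspace_homog] del: gca.scale_scale)
  qed
  then show "slice u x \<in> B" "slice u x \<in> homog (q + 1 - gdeg u)" by auto
qed

section \<open>Recursion on the degree\<close>

lemma good_0:
  assumes \<theta>: "\<theta> \<in> Der n" "D d \<theta> = (\<lambda>_. 0)"
  shows "\<exists>\<phi>. good \<theta> n \<phi> 0"
proof -
  \<comment> \<open>In degrees at most 0 there are only scalars, so the augmentation times \<theta>
    serves as the start.\<close>
  define \<phi> :: "'v susp free_gca \<Rightarrow> 'v free_gca \<Rightarrow> 'v free_gca" where "\<phi> x v = scaleQ (coeff x {#}) (\<theta> v)" for x v
  have p: "philin \<phi>"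
    unfolding philin_def \<phi>_def
    by (auto intro!: linQ_I simp: linQ_D[OF DerD(1)[OF \<theta>(1)]] gca.scale_left_distrib
        gca.scale_right_distrib mult.commute)
  have "\<phi> x \<in> Der (n - j) \<and> D d (\<phi> x) = (\<lambda>v. scaleQ ((-1) powi n) (extend \<phi> (dW x) v))"
    if j: "j \<le> 0" "x \<in> homog j" for j x
  proof (cases "x = 0")
    case True
    then show ?thesis
      by (simp add: philin_simps[OF p] Der_0 D_zero[OF d_lin] d_rules extend_fun)
  next
    case False
    then have "j = 0" using homog_0_scalar(2)[of x j] j by force
    have "dW x = scaleQ (coeff x {#}) (dW 1)"
      by (subst homog_0_scalar(1)[OF j(2,1)]) (rule d_rules(3)[OF A_closed(2)])
    then have "dW x = 0" by (simp add: d_rules)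
    moreover have "D d (\<lambda>v. scaleQ (coeff x {#}) (\<theta> v)) = (\<lambda>_. 0)"
      by (rule HOL.ext) (simp add: D_scale[OF d_lin] \<theta>(2))
    ultimately show ?thesis using Der_scale[OF \<theta>(1)] \<open>j = 0\<close> by (simp add: extend_fun \<phi>_def[abs_def])
  qed
  moreover have "\<phi> 1 = \<theta>" by (rule HOL.ext) (simp add: \<phi>_def)
  ultimately show ?thesis using p by (auto simp: good_def)
qed

lemma good_preimage:
  assumes good: "good \<theta> n \<phi> (p - 1)" and p: "n - p - 1 \<ge> 1" and Gk: "G d (n - p - 1)"
    and x: "x \<in> B" "x \<in> homog p"
  shows "\<exists>\<eta>\<in>Der (n - p). D d \<eta> = (\<lambda>v. scaleQ ((-1) powi n) (extend \<phi> (dW x) v))"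
proof -
  let ?z = "extend \<phi> (dW x)"
  have y: "dW x \<in> gca.span (N p)" by (rule dW_mem_N[OF x])
  then have yM: "dW x \<in> gca.span (Mgen (p - 1))" using span_N_Mgen by blast
  have xA: "x \<in> A" using x B_sub_A by auto
  have "dW x \<in> homog (p + 1)" using d_rules(4)[OF xA x(2)] by simp
  then have der: "?z \<in> Der (n - p - 1)" using extend_Der[OF good yM] by (simp add: algebra_simps)
  have cyc: "D d ?z = (\<lambda>_. 0)"
    by (rule HOL.ext) (simp add: extend_D[OF good yM] dWdW[OF xA] extend_fun)
  have "word_comp 0 (?z v) = 0" for v
    using extend_N_coeff[OF goodD(1)[OF good] y, of v]
    by (intro free_gca_eqI) (auto simp: word_comp_def)
  then have "L (-1) ?z = (\<lambda>_. 0)" by (auto simp: L_def)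
  \<comment> \<open>In degree 1, \<open>Der'\<close> contains only cycles. This boundary case is p =
    n - 2, reached when m = n - 1.\<close>
  moreover have "?z \<in> Der' d (n - p - 1)"
  proof (cases "n - p - 1 = 1")
    case True
    then show ?thesis using der cyc unfolding True by (simp add: Der'_def)
  qed (use der p in \<open>simp add: Der'_def\<close>)
  ultimately obtain \<eta> where \<eta>: "\<eta> \<in> Der' d (n - p)" "?z = D d \<eta>"
    using Gk cyc by (auto simp: G_def)
  have "\<eta> \<in> Der (n - p)" using \<eta>(1) p by (simp add: Der'_def)
  moreover have "D d (\<lambda>v. scaleQ ((-1) powi n) (\<eta> v)) = (\<lambda>v. scaleQ ((-1) powi n) (?z v))"
    by (rule HOL.ext) (simp add: D_scale[OF d_lin] \<eta>(2))
  ultimately show ?thesis using Der_scale by blast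
qed

lemma good_step:
  assumes good: "good \<theta> n \<phi> (p - 1)" and p: "1 \<le> p" "n - p - 1 \<ge> 1" and Gk: "G d (n - p - 1)"
  shows "\<exists>\<phi>'. good \<theta> n \<phi>' p"
proof -
  note lp = goodD(1)[OF good]
  have sub: "gca.subspace (B \<inter> homog p)"
    unfolding B_def by (intro gca.subspace_inter subspace_Lam subspace_homog)
  \<comment> \<open>Preimages under D are not canonical; choosing them on a basis of the degree p
    part makes the choice linear.\<close>
  obtain S where S: "S \<subseteq> B \<inter> homog p" "gca.independent S" "B \<inter> homog p \<subseteq> gca.span S"
    using gca.maximal_independent_subset by blast
  have "\<forall>x\<in>S. \<exists>\<eta>. \<eta> \<in> Der (n - p) \<and> D d \<eta> = (\<lambda>v. scaleQ ((-1) powi n) (extend \<phi> (dW x) v))"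
    using good_preimage[OF good p(2) Gk] S(1) by blast
  then obtain g where g: "\<And>x. x \<in> S \<Longrightarrow> g x \<in> Der (n - p)"
    "\<And>x. x \<in> S \<Longrightarrow> D d (g x) = (\<lambda>v. scaleQ ((-1) powi n) (extend \<phi> (dW x) v))"
    by metis
  obtain \<psi> where \<psi>: "philin \<psi>" "\<And>b. b \<in> S \<Longrightarrow> \<psi> b = g b"
    using extend_basis_philin[OF S(2), of g] DerD(1)[OF g(1)] by blast
  have \<psi>S: "\<psi> x \<in> Der (n - p) \<and> D d (\<psi> x) = (\<lambda>v. scaleQ ((-1) powi n) (extend \<phi> (dW x) v))"
    if "x \<in> B \<inter> homog p" for x
  proof -
    have "x \<in> gca.span S" using that S(3) by blast
    then have "x \<in> A \<and> \<psi> x \<in> Der (n - p) \<and> D d (\<psi> x) = (\<lambda>v. scaleQ ((-1) powi n) (extend \<phi> (dW x) v))"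
    proof (induction x rule: gca.span_induct_alt)
      case base
      then show ?case
        by (simp add: A_closed philin_simps[OF \<psi>(1)] Der_0 D_zero[OF d_lin] d_rules extend_fun)
    next
      case (step c t y)
      have "t \<in> A" using step(1) S(1) B_sub_A by auto
      moreover have "\<psi> t \<in> Der (n - p)" using g(1)[OF step(1)] \<psi>(2)[OF step(1)] by simp
      moreover have "D d (\<psi> (scaleQ c t + y)) = (\<lambda>v. scaleQ ((-1) powi n) (extend \<phi> (dW (scaleQ c t + y)) v))"
      proof
        fix v
        show "D d (\<psi> (scaleQ c t + y)) v = scaleQ ((-1) powi n) (extend \<phi> (dW (scaleQ c t + y)) v)"
          using step \<open>t \<in> A\<close> g(2)[OF step(1)] \<psi>(2)[OF step(1)]
          by (simp add: philin_simps[OF \<psi>(1)] D_add[OF d_lin] D_scale[OF d_lin] d_rules(2,3) A_closed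
              extend_fun gca.scale_right_distrib mult.commute)
      qed
      ultimately show ?case using step
        by (simp add: A_closed philin_simps[OF \<psi>(1)] Der_add Der_scale)
    qed
    then show ?thesis by simp
  qed
  \<comment> \<open>The old map below degree p, the chosen preimages in degree p, and zero above,
    where nothing is required yet.\<close>
  define \<phi>' where "\<phi>' x v = \<phi> (select (\<lambda>m. mdeg m < p) x) v + \<psi> (deg_comp p x) v" for x v
  have lp': "philin \<phi>'"
    unfolding philin_def \<phi>'_def
    by (auto intro!: linQ_I simp: linQ_D[OF linQ_select] deg_comp_simps philin_simps(1-3)[OF lp]
        philin_simps(1-3)[OF \<psi>(1)] gca.scale_right_distrib
        linQ_D[OF philin_simps(4)[OF lp]] linQ_D[OF philin_simps(4)[OF \<psi>(1)]])
  have low: "\<phi>' x = \<phi> x" if "x \<in> homog j" "j < p" for x j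
  proof -
    have "select (\<lambda>m. mdeg m < p) x = x" using that by (intro select_id) (auto simp: homog_def)
    moreover have "deg_comp p x = 0" using that by (intro deg_comp_other) auto
    ultimately show ?thesis by (auto simp: \<phi>'_def philin_simps[OF \<psi>(1)])
  qed
  have top: "\<phi>' x = \<psi> x" if "x \<in> homog p" for x
  proof -
    have "select (\<lambda>m. mdeg m < p) x = 0" using that by (intro select_0) (auto simp: homog_def)
    then show ?thesis using deg_comp_same[OF that] by (auto simp: \<phi>'_def philin_simps[OF lp])
  qed
  \<comment> \<open>The bar factors occurring here have degree below p, where the two maps
    agree.\<close>
  have ext: "extend \<phi>' y = extend \<phi> y" if "y \<in> gca.span (N q)" "q \<le> p" for y q
    using that(1)
  proof (induction y rule: gca.span_induct_alt)
    case base
    then show ?case by (simp add: extend_fun)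
  next
    case (step c t y)
    then obtain a b i where t: "t = a * incl b" "a \<in> barsub" "a \<in> homog i" "i \<le> q - 1"
      using B_barsub by (auto simp: N_def)
    then have "\<phi>' a = \<phi> a" using low[of a i] that(2) by simp
    then have "extend \<phi>' t = extend \<phi> t" using t by (simp add: extend_bar_incl[OF lp] extend_bar_incl[OF lp'])
    with step show ?case by (simp add: extend_fun)
  qed
  have "\<phi>' x \<in> Der (n - j) \<and> D d (\<phi>' x) = (\<lambda>v. scaleQ ((-1) powi n) (extend \<phi>' (dW x) v))"
    if "j \<le> p" "x \<in> B \<inter> homog j" for j x
  proof -
    have e: "extend \<phi>' (dW x) = extend \<phi> (dW x)" using dW_mem_N[of x j] that by (intro ext) auto
    show ?thesis
    proof (cases "j = p")
      case True
      then show ?thesis using \<psi>S[of x] top[of x] that e by simp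
    next
      case False
      then show ?thesis using goodD(3,4)[OF good, of j x] low[of x j] that e by simp
    qed
  qed
  moreover have "\<phi>' 1 = \<theta>" using low[OF homog_1] goodD(2)[OF good] p by simp
  ultimately show ?thesis using lp' unfolding good_def by blast
qed

text \<open>Passing to degree p uses \<open>G\<close> in degree k = n - p - 1, and 1 <= p <= m - 1
  is exactly n - m <= k <= n - 2. The bound m <= n - 1 keeps k at least 1, inside the range where
  \<open>Der'\<close> can be nonzero.\<close>

lemma good_exists:
  assumes \<theta>: "\<theta> \<in> Der n" "D d \<theta> = (\<lambda>_. 0)"
    and m: "m \<le> n - 1" and Gk: "\<And>k. n - m \<le> k \<Longrightarrow> k \<le> n - 2 \<Longrightarrow> G d k"
  shows "int p \<le> m - 1 \<Longrightarrow> \<exists>\<phi>. good \<theta> n \<phi> (int p)"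
proof (induction p)
  case 0
  then show ?case using good_0[OF \<theta>] by simp
next
  case (Suc p)
  then obtain \<phi> where "good \<theta> n \<phi> (int p)" by auto
  then show ?case using Suc.prems m
    by (intro good_step[of \<theta> n \<phi>] Gk) auto
qed

section \<open>Injectivity\<close>

lemma B_eq_0_of_slices:
  assumes x: "x \<in> B" "x \<in> homog p" "p \<noteq> 0" and s: "\<And>u. slice u (dW x) = 0"
  shows "x = 0"
proof -
  have xA: "x \<in> A" using x B_sub_A by auto
  have y1: "dW x \<in> filt isz 1" by (rule dW_B_filt[OF x(1)])
  have "dW x \<in> filt isz 2"
    unfolding filt_def
  proof (intro CollectI ballI)
    fix m assume m: "m \<in> supp (dW x)"
    have "isz m \<noteq> 1"
    proof
      assume "isz m = 1"
      then obtain u where "ipart m = {#u#}" by (metis isz_def size_1_singleton_mset)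
      then show False using coeff_slice[of m u "dW x"] s[of u] m by (simp add: in_supp_iff)
    qed
    then show "2 \<le> isz m" using y1 m by (auto simp: filt_def)
  qed
  moreover have "dW x \<in> homog (p + 1)" using d_rules(4)[OF xA x(2)] by simp
  ultimately have "dW x \<in> gca.span {a * incl (prod_list ws) | a ws i k.
    a \<in> B \<inter> homog i \<and> set ws \<subseteq> H \<and> prod_list ws \<in> homog k \<and> i + k = p + 1 \<and> 2 \<le> length ws}"
    by (intro A_span_filt d_rules(1)[OF xA])
  moreover have "gca.subspace {y \<in> A. \<sigma> y \<in> filt isz 1}"
    by (rule gca.subspaceI)
       (auto simp: A_closed s_rules(2,3,7) gca.subspace_0[OF subspace_filt]
          gca.subspace_add[OF subspace_filt] gca.subspace_scale[OF subspace_filt])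
  moreover have "a * incl (prod_list ws) \<in> {y \<in> A. \<sigma> y \<in> filt isz 1}"
    if a: "a \<in> B" "a \<in> homog i" and ws: "set ws \<subseteq> H" "2 \<le> length ws" for a ws i
  proof -
    let ?b = "incl (prod_list ws)"
    have A: "a \<in> A" "?b \<in> A" using a B_sub_A ws by (auto intro!: incl_A simp: Lam_W Lam_prod_list)
    \<comment> \<open>As \<open>\<sigma>\<close> kills the bar factor, only the word in W loses a
      letter.\<close>
    have "a * \<sigma> ?b \<in> filt isz (0 + (length ws - 1))"
      by (intro filt_mult \<sigma>_incl_filt ws) auto
    then have "a * \<sigma> ?b \<in> filt isz 1" using ws by (auto elim: filt_mono)
    then show ?thesis
      using s_rules(5)[OF A(1) a(2) A(2)] \<sigma>_B[OF a(1)] A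
      by (simp add: A_closed gca.subspace_scale[OF subspace_filt])
  qed
  ultimately have "dW x \<in> {y \<in> A. \<sigma> y \<in> filt isz 1}"
    by (elim rev_subsetD) (rule gca.span_minimal; auto)
  \<comment> \<open>Neither x nor \<open>euler x\<close> has a monomial with a letter from V, so
    this membership forces \<open>euler x\<close> to vanish. Only wordlength 0 is then left in x,
    and that is excluded by the nonzero degree.\<close>
  then have e: "euler x \<in> filt isz 1" using \<sigma>_dW_euler[OF x(1)] by simp
  show ?thesis
  proof (rule free_gca_eqI, rule ccontr)
    fix m assume "coeff x m \<noteq> coeff 0 m"
    then have m: "m \<in> supp x" by (simp add: in_supp_iff)
    then have "isz m = 0" using x(1) B_barsub by (auto simp: barsub_def isz_def)
    then have "m \<notin> supp (euler x)" using e by (auto simp: filt_def dest!: bspec[of _ _ m])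
    then have "coeff (euler x) m = 0" by (simp add: in_supp_iff)
    then have "m = {#}" using m by (simp add: coeff_euler in_supp_iff)
    then show False using homog_D[OF x(2) m] x(3) by simp
  qed
qed

lemma Vspace_coeff_zero:
  assumes "linQ f" "\<And>u. coeff (f (gen u)) {#} = 0" "v \<in> Vspace"
  shows "coeff (f v) {#} = 0"
  using assms(3) unfolding Vspace_def
  by (induction v rule: gca.span_induct_alt) (auto simp: linQ_D[OF assms(1)] assms(2))

text \<open>Strong induction on the degree of a homogeneous x. The hypothesis L_{-1} \<theta>
  \<noteq> 0 is needed precisely for the scalars, where \<phi> x is a multiple of \<theta>.\<close>

lemma good_injective:
  assumes good: "good \<theta> n \<phi> q" and \<theta>: "L (-1) \<theta> \<noteq> (\<lambda>_. 0)"
  shows "p \<le> q \<Longrightarrow> x \<in> B \<Longrightarrow> x \<in> homog p \<Longrightarrow> (\<And>u. coeff (\<phi> x (gen u)) {#} = 0) \<Longrightarrow> x = 0"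
proof (induction "nat p" arbitrary: p x rule: less_induct)
  case less
  note lp = goodD(1)[OF good]
  consider "p < 0" | "p = 0" | "1 \<le> p" by linarith
  then show ?case
  proof cases
    case 1
    then show ?thesis using homog_0_scalar(2)[OF less.prems(3)] by simp
  next
    case 2
    have x: "x = scaleQ (coeff x {#}) 1" using homog_0_scalar(1)[OF less.prems(3)] 2 by simp
    have "coeff x {#} = 0"
    proof (rule ccontr)
      assume c: "coeff x {#} \<noteq> 0"
      have "\<phi> x = (\<lambda>v. scaleQ (coeff x {#}) (\<theta> v))"
        by (subst x) (simp only: philin_simps(2)[OF lp] goodD(2)[OF good])
      then have z: "coeff (\<theta> (gen u)) {#} = 0" for u using less.prems(4)[of u] c by simp
      have "linQ \<theta>" using philin_simps(4)[OF lp, of 1] goodD(2)[OF good] by simp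
      then have "coeff (\<theta> v) {#} = 0" if "v \<in> Vspace" for v
        by (rule Vspace_coeff_zero) (rule z that)+
      then have "word_comp 0 (\<theta> v) = 0" if "v \<in> Vspace" for v
        using that by (intro free_gca_eqI) (auto simp: word_comp_def)
      then show False using \<theta> by (auto simp: L_def)
    qed
    then show ?thesis using x by simp
  next
    case 3
    let ?y = "dW x"
    have y: "?y \<in> gca.span (N p)" by (rule dW_mem_N[OF less.prems(2,3)])
    note der = goodD(3)[OF good less.prems(1-3)]
    have c: "coeff (\<phi> (slice u ?y) (gen w)) {#} = 0" for u w
    proof -
      have g: "\<phi> x (gen u) \<in> filt size (Suc 0)" for u
        using less.prems(4)[of u] by (auto simp: filt_def in_supp_iff Suc_le_eq simp flip: nonempty_has_size)
      have gV: "gen w \<in> filt size 1" for w :: 'v by (auto simp: filt_def supp_monom)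
      have "d (gen w) \<in> filt size (Suc 1)" for w
        using dec[of "gen w"] by (simp add: Vspace_def gca.span_base numeral_2_eq_2)
      then have dw: "d z \<in> filt size (1 + 1)" if "z \<in> filt size 1" for z
        using that by (intro Der_filt[OF d])
      \<comment> \<open>Without constant terms on generators, \<phi> x does not lower wordlength,
        while d raises it. So both terms of D (\<phi> x) send generators to wordlength at least
        2.\<close>
      have "d (\<phi> x (gen w)) \<in> filt size (1 + 1)" using g by (intro dw) simp
      moreover have "\<phi> x (d (gen w)) \<in> filt size (1 + 1 + 0)"
        by (intro Der_filt[OF der g] dw gV)
      ultimately have "D d (\<phi> x) (gen w) \<in> filt size 2"
        unfolding D_Der[OF der]
        by (intro gca.subspace_diff[OF subspace_filt] gca.subspace_scale[OF subspace_filt])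
          (simp_all add: numeral_2_eq_2)
      then have "{#u#} \<notin> supp (D d (\<phi> x) (gen w))" by (auto simp: filt_def dest!: bspec[of _ _ "{#u#}"])
      then have "coeff (D d (\<phi> x) (gen w)) {#u#} = 0" by (simp add: in_supp_iff)
      then have "coeff (extend \<phi> ?y (gen w)) {#u#} = 0"
        by (simp add: goodD(4)[OF good less.prems(1-3)] sign_if split: if_splits)
      then show ?thesis
        using extend_N_slice[OF lp y homog_monom, of "{#w#}" u] by (simp add: sign_if split: if_splits)
    qed
    have "slice u ?y = 0" for u
    proof (rule less.hyps)
      \<comment> \<open>The slice has degree at most p - 1 because every generator u of V has degree
        at least 2.\<close>
      show "nat (p + 1 - gdeg u) < nat p" "p + 1 - gdeg u \<le> q" using gdeg2[of u] 3 less.prems(1) by auto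
    qed (use slice_N[OF y] c in auto)
    then show ?thesis using B_eq_0_of_slices[OF less.prems(2,3)] 3 by simp
  qed
qed

section \<open>From homogeneous elements to the full truncated tensor product\<close>

lemma deg_comp_B: "x \<in> B \<Longrightarrow> deg_comp i x \<in> B"
  unfolding B_eq by (rule deg_comp_Lam[OF homogs_images(1)])

lemma bar_le_tensor_Mgen: "bar_le_tensor W p \<subseteq> gca.span (Mgen p)"
  unfolding bar_le_tensor_def
proof (rule gca.span_minimal[OF _ gca.subspace_span], safe)
  fix a b assume a: "a \<in> bar_le W p" and b: "b \<in> Lam W"
  have "a * incl b = (\<Sum>i\<in>mdeg ` supp a. deg_comp i a) * incl (\<Sum>k\<in>mdeg ` supp b. deg_comp k b)"
    by (simp only: deg_comp_sum)
  also have "\<dots> = (\<Sum>i\<in>mdeg ` supp a. \<Sum>k\<in>mdeg ` supp b. deg_comp i a * incl (deg_comp k b))"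
    by (simp only: incl_simps sum_product)
  also have "\<dots> \<in> gca.span (Mgen p)"
  proof (intro gca.span_sum gca.span_base)
    fix i k assume "i \<in> mdeg ` supp a"
    then have "i \<le> p" using a by (auto simp: bar_le_def deg_le_def)
    moreover have "deg_comp i a \<in> B" using a by (intro deg_comp_B) (simp add: bar_le_def B_def)
    moreover have "deg_comp k b \<in> Lam W" using b deg_comp_Lam[OF H_sub(2)] by (simp add: Lam_W)
    ultimately show "deg_comp i a * incl (deg_comp k b) \<in> Mgen p"
      using deg_comp_homog[of i a] deg_comp_homog[of k b] unfolding Mgen_def by blast
  qed
  finally show "a * incl b \<in> gca.span (Mgen p)" .
qed

lemma good_module_map:
  assumes good: "good \<theta> n \<phi> p"
  shows "module_map_on W (bar_le_tensor W p) n (extend \<phi>)"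
  unfolding module_map_on_def
proof (intro conjI ballI allI)
  note M = subsetD[OF bar_le_tensor_Mgen]
  show "extend \<phi> x \<in> Der (n - j)" if "x \<in> bar_le_tensor W p \<inter> homog j" for x j
    using that by (intro extend_Der[OF good] M) auto
  show "extend \<phi> (x * incl b) = right_act (extend \<phi> x) b" if "x \<in> bar_le_tensor W p" for x b
    using M[OF that] span_Mgen_A by (intro extend_mult goodD(1)[OF good]) blast
qed (simp_all add: extend_fun)

text \<open>Elements of \<open>bar_le\<close> are not homogeneous, but \<phi> of the degree i
  component can have a constant term at u only for i = n - \<open>gdeg u\<close>. At each u at most
  one component contributes, so the vanishing passes to every component separately.\<close>

lemma good_inj_on:
  assumes good: "good \<theta> n \<phi> p" and \<theta>: "L (-1) \<theta> \<noteq> (\<lambda>_. 0)"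
  shows "inj_on (\<lambda>x. L (-1) (extend \<phi> x)) (bar_le W p)"
proof (rule inj_onI)
  note lp = goodD(1)[OF good]
  fix x y assume x: "x \<in> bar_le W p" and y: "y \<in> bar_le W p"
    and eq: "L (-1) (extend \<phi> x) = L (-1) (extend \<phi> y)"
  let ?z = "x - y"
  have B: "x \<in> B" "y \<in> B" "?z \<in> B" using x y by (auto simp: bar_le_def B_def Lam_closed)
  have z0: "coeff (\<phi> ?z (gen u)) {#} = 0" for u
  proof -
    have "gen u \<in> Vspace" by (simp add: Vspace_def gca.span_base)
    then have "word_comp 0 (\<phi> x (gen u)) = word_comp 0 (\<phi> y (gen u))"
      using fun_cong[OF eq, of "gen u"] B B_barsub extend_barsub[OF lp] by (simp add: L_def subset_iff)
    then have "coeff (word_comp 0 (\<phi> x (gen u))) {#} = coeff (word_comp 0 (\<phi> y (gen u))) {#}" by simp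
    then have "coeff (\<phi> x (gen u)) {#} = coeff (\<phi> y (gen u)) {#}" by (simp add: word_comp_def)
    then show ?thesis by (simp add: linQ_D[OF philin_simps(5)[OF lp]])
  qed
  have le: "i \<le> p" if "i \<in> mdeg ` supp ?z" for i
  proof -
    have "gca.subspace (deg_le p :: 'v susp free_gca set)" unfolding deg_le_def by (rule subspace_supp)
    then have "?z \<in> deg_le p" using x y gca.subspace_diff by (auto simp: bar_le_def)
    then show ?thesis using that by (auto simp: deg_le_def)
  qed
  have "deg_comp j ?z = 0" if j: "j \<in> mdeg ` supp ?z" for j
  proof (rule good_injective[OF good \<theta> le[OF j] deg_comp_B[OF B(3)] deg_comp_homog])
    fix u
    have nz: "coeff (\<phi> (deg_comp i ?z) (gen u)) {#} = 0" if "i \<in> mdeg ` supp ?z" "i \<noteq> n - gdeg u" for i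
    proof -
      have "\<phi> (deg_comp i ?z) (gen u) \<in> homog (gdeg u - (n - i))"
        using DerD(2)[OF goodD(3)[OF good le[OF that(1)] deg_comp_B[OF B(3)] deg_comp_homog] homog_monom, of "{#u#}"]
        by simp
      then show ?thesis using that(2) by (force simp: homog_def in_supp_iff)
    qed
    show "coeff (\<phi> (deg_comp j ?z) (gen u)) {#} = 0"
    proof (cases "j = n - gdeg u")
      case True
      have "0 = coeff (\<phi> (\<Sum>i\<in>mdeg ` supp ?z. deg_comp i ?z) (gen u)) {#}"
        using z0[of u] by (simp only: deg_comp_sum)
      also have "\<dots> = (\<Sum>i\<in>mdeg ` supp ?z. coeff (\<phi> (deg_comp i ?z) (gen u)) {#})"
        by (simp only: linQ_D(6)[OF philin_simps(5)[OF lp]] coeff_sum)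
      also have "\<dots> = (\<Sum>i\<in>{j}. coeff (\<phi> (deg_comp i ?z) (gen u)) {#})"
        using j True by (intro sum.mono_neutral_right) (auto intro!: nz)
      finally show ?thesis by simp
    qed (use nz j in auto)
  qed
  then have "(\<Sum>j\<in>mdeg ` supp ?z. deg_comp j ?z) = 0" by (intro sum.neutral) auto
  then show "x = y" by (simp only: deg_comp_sum right_minus_eq)
qed

end

theorem lemma3p2:
  fixes d \<theta> :: "'v::graded_basis free_gca \<Rightarrow> 'v free_gca"
    and V :: "nat \<Rightarrow> 'v free_gca set"
    and W :: "'v free_gca set"
    and \<sigma> d\<^sub>W :: "'v susp free_gca \<Rightarrow> 'v susp free_gca"
    and n m :: int
  assumes "\<forall>v::'v. 2 \<le> gdeg v"
    and "\<forall>k. finite {v::'v. gdeg v = k}"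
    and "sullivan_minimal d"
    and "\<theta> \<in> Der' d n" and "D d \<theta> = (\<lambda>_. 0)" and "L (-1) \<theta> \<noteq> (\<lambda>_. 0)"
    and "2 \<le> m" and "m \<le> n - 1"
    and "\<forall>k. n - m \<le> k \<and> k \<le> n - 2 \<longrightarrow> G d k"
    and "splitting d V" and "W = {a + b | a b. a \<in> V 0 \<and> b \<in> V 1}"
    and "acyclic_closure d W \<sigma> d\<^sub>W"
  shows "\<exists>\<Phi>. module_map_on W (bar_le_tensor W (m - 1)) n \<Phi> \<and>
           \<Phi> 1 = \<theta> \<and>
           (\<forall>x\<in>bar_le_tensor W (m - 1). D d (\<Phi> x) = (\<lambda>v. scaleQ ((-1) powi n) (\<Phi> (d\<^sub>W x) v))) \<and>
           inj_on (\<lambda>x. L (-1) (\<Phi> x)) (bar_le W (m - 1))"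
proof -
  have gr: "graded_subspace (V 0)" "graded_subspace (V 1)" and V0: "V 0 = Vfilt d 0"
    and V1: "Vfilt d 1 = {\<Sum>j\<le>1. u j | u. \<forall>j\<le>(1::nat). u j \<in> V j}"
    using \<open>splitting d V\<close> unfolding splitting_def by blast+
  \<comment> \<open>Membership in the first filtration step is what gives d w in \<Lambda>V_0, as
    V_0 is step 0 of the filtration.\<close>
  have W_filt: "W \<subseteq> Vfilt d 1"
  proof
    fix w assume "w \<in> W"
    then obtain a b where ab: "w = a + b" "a \<in> V 0" "b \<in> V 1" using assms(11) by auto
    let ?u = "\<lambda>j::nat. if j = 0 then a else b"
    have "w = (\<Sum>j\<le>1. ?u j)" "\<forall>j\<le>1. ?u j \<in> V j" using ab by (auto simp: le_Suc_eq)
    then show "w \<in> Vfilt d 1" unfolding V1 by blast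
  qed
  have sW: "graded_subspace W"
    unfolding graded_subspace_def
  proof (intro conjI ballI allI)
    show "gca.subspace W"
      using gca.subspace_sums[of "V 0" "V 1"] gr unfolding assms(11) graded_subspace_def by blast
    show "deg_comp i x \<in> W" if "x \<in> W" for x i
    proof -
      obtain a b where "x = a + b" "a \<in> V 0" "b \<in> V 1" using \<open>x \<in> W\<close> unfolding assms(11) by blast
      then show ?thesis using gr unfolding assms(11) graded_subspace_def
        by (intro CollectI exI[of _ "deg_comp i a"] exI[of _ "deg_comp i b"]) (auto simp: deg_comp_simps)
    qed
  qed
  have "0 \<in> V 1" using gr by (simp add: graded_subspace_def gca.subspace_0)
  then have ZW: "V 0 \<subseteq> W" unfolding assms(11) by force
  interpret closure_setup d "V 0" W \<sigma> d\<^sub>W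
  proof
    show "2 \<le> gdeg v" for v :: 'v using assms(1) by blast
    show "d \<in> Der (-1)" "d (d x) = 0" for x using assms(3) by (auto simp: sullivan_minimal_def)
    show "d v \<in> filt size 2" if "v \<in> Vspace" for v
      using assms(3) that by (auto simp: sullivan_minimal_def filt_def word_ge_def)
    show "d z = 0" if "z \<in> V 0" for z using that V0 by simp
    show "W \<subseteq> Vspace" "w \<in> W \<Longrightarrow> d w \<in> Lam (V 0)" for w
      using W_filt V0 by (auto simp: One_nat_def)
  qed (use gr ZW sW assms(12) in auto)
  \<comment> \<open>The bounds on m give n at least 3, where \<open>Der'\<close> is all of
    \<open>Der\<close>.\<close>
  have \<theta>: "\<theta> \<in> Der n" using assms(4,7,8) by (simp add: Der'_def)
  obtain \<phi> where good: "good \<theta> n \<phi> (m - 1)"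
    using good_exists[OF \<theta> assms(5,8), of "nat (m - 1)"] assms(7,9) by auto
  have "extend \<phi> 1 = \<theta>"
    using extend_barsub[OF goodD(1)[OF good], of 1] goodD(2)[OF good] B_barsub B_closed(4) by auto
  moreover have "D d (extend \<phi> x) = (\<lambda>v. scaleQ ((-1) powi n) (extend \<phi> (d\<^sub>W x) v))"
    if "x \<in> bar_le_tensor W (m - 1)" for x
    using extend_D[OF good] that bar_le_tensor_Mgen by blast
  ultimately show ?thesis
    using good_module_map[OF good] good_inj_on[OF good assms(6)] by blast
qed

end
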